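(* Let $\alpha>0$, $M_0>0$ and $0<M_{\min}<M$. There exist constants $C,C_1>0$ depending only on $\alpha,M,M_0,M_{\min}$ such that the following holds for all positive integers $n,p$ and every $\epsilon\in[0,1/5)$. Set $k=\lceil n^{\frac{1}{2\alpha+1}}\rceil\wedge p$, let $\hat\Gamma$ be any maximizer of $\mathcal{D}_{\mathcal{U}_k}(\Gamma,\{X_i\}_{i=1}^n)$ over $\Gamma\in\mathcal{F}_k$, and let $\hat\Sigma=\hat\Gamma/\beta$. Then for any $\delta\in(0,1/2)$ satisfying $C_1\frac{\min(n^{\frac{1}{2\alpha+1}}+\log p,\;p)+\log(1/\delta)}{n}<1$, $$\|\hat\Sigma-\Sigma\|_{\rm op}^2\le C\left(\left(\min\left\{n^{-\frac{2\alpha}{2\alpha+1}}+\frac{\log p}{n},\ \frac pn\right\}\vee\epsilon^2\right)+\frac{\log(1/\delta)}{n}\right)$$ with $\mathbb{P}_{(\epsilon,\Sigma,Q)}$-probability at least $1-2\delta$, uniformly over all $\Sigma\in\mathcal{F}_\alpha(M,M_0,M_{\min})$ and all probability distributions $Q$ on $\mathbb{R}^p$.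
   Context: Contamination model: for $\epsilon\in[0,1]$, a covariance matrix $\Sigma\in\mathbb{R}^{p\times p}$ and a probability distribution $Q$ on $\mathbb{R}^p$, $\mathbb{P}_{(\epsilon,\Sigma,Q)}=(1-\epsilon)N(0,\Sigma)+\epsilon Q$; $X_1,\dots,X_n$ are i.i.d. from it, and the same symbol denotes their joint law. Classes: $\mathcal{F}_k=\{\Sigma=(\sigma_{ij})\in\mathbb{R}^{p\times p},\ \Sigma\succeq0:\ \sigma_{ij}=0\text{ if }|i-j|>k\}$; $\mathcal{F}(M)=\{\Sigma=\Sigma^T\succeq0:\ s_{\max}(\Sigma)\le M\}$; and $$\mathcal{F}_\alpha(M,M_0,M_{\min})=\Big\{\Sigma=(\sigma_{ij})\in\mathcal{F}(M):\ \max_j\sum_{\{i:|i-j|>k\}}|\sigma_{ij}|\le M_0k^{-\alpha}\text{ for all integers }k\ge1,\ s_{\min}(\Sigma)>M_{\min}\Big\},$$ where $s_{\max},s_{\min}$ are the largest and smallest singular values, and $M,M_0,M_{\min}$ do not scale with $p$ or $n$. Directions: with $S^{p-1}$ the Euclidean unit sphere of $\mathbb{R}^p$, $\mathcal{V}_{[l_1,l_2]}=\{u\in S^{p-1}:u_i=0\text{ if }i\notin[l_1,l_2]\}$; $\mathcal{U}_k=\bigcup_{l=1}^{p+1-2k}\mathcal{V}_{[l,l+2k-1]}$ if $2k\le p$, and $\mathcal{U}_k=S^{p-1}$ if $2k>p$. Empirical matrix depth relative to $\mathcal{U}\subset S^{p-1}$: $$\mathcal{D}_{\mathcal{U}}(\Gamma,\{X_i\}_{i=1}^n)=\min_{u\in\mathcal{U}}\min\left\{\frac1n\sum_{i=1}^n\mathbb{I}\{|u^TX_i|^2\le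 u^T\Gamma u\},\ \frac1n\sum_{i=1}^n\mathbb{I}\{|u^TX_i|^2\ge u^T\Gamma u\}\right\};$$ it takes finitely many values, so maximizers exist. The constant $\beta$ is defined by $\Phi(\sqrt\beta)=3/4$ with $\Phi$ the standard normal cumulative distribution function. $\|\cdot\|_{\rm op}$ is the operator norm; $a\vee b=\max(a,b)$, $a\wedge b=\min(a,b)$. *)

theory Defs
  imports "HOL-Probability.Probability" "Jordan_Normal_Form.Spectral_Radius"
begin

unbundle no vec_syntax
unbundle no inner_syntax

text \<open>
  The dimension \<open>p\<close> varies inside the theorem, so vectors and matrices are those of
  \<open>Jordan_Normal_Form\<close>, with explicit carriers. Coordinates are numbered
  \<open>0, \<dots>, p - 1\<close> instead of \<open>1, \<dots>, p\<close>.
\<close>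

definition enorm :: "real Matrix.vec \<Rightarrow> real" where
  "enorm v = sqrt (v \<bullet> v)"

definition unit_sphere :: "nat \<Rightarrow> real Matrix.vec set" where
  "unit_sphere p = {u \<in> carrier_vec p. enorm u = 1}"

definition op_norm :: "nat \<Rightarrow> real mat \<Rightarrow> real" where
  "op_norm p A = (SUP u\<in>unit_sphere p. enorm (A *\<^sub>v u))"

definition psd :: "nat \<Rightarrow> real mat \<Rightarrow> bool" where
  "psd p A \<longleftrightarrow> A \<in> carrier_mat p p \<and> transpose_mat A = A \<and>
     (\<forall>v\<in>carrier_vec p. 0 \<le> v \<bullet> (A *\<^sub>v v))"

definition singular_values :: "real mat \<Rightarrow> real set" where
  "singular_values A = sqrt ` spectrum (transpose_mat A * A)"

definition s_max :: "real mat \<Rightarrow> real" where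
  "s_max A = Max (singular_values A)"

definition s_min :: "real mat \<Rightarrow> real" where
  "s_min A = Min (singular_values A)"


subsection \<open>Matrix classes\<close>

definition banded_class :: "nat \<Rightarrow> nat \<Rightarrow> real mat set" where
  "banded_class p k = {\<Sigma>. psd p \<Sigma> \<and>
     (\<forall>i<p. \<forall>j<p. \<bar>int i - int j\<bar> > int k \<longrightarrow> \<Sigma> $$ (i, j) = 0)}"

definition bounded_class :: "nat \<Rightarrow> real \<Rightarrow> real mat set" where
  "bounded_class p M = {\<Sigma>. psd p \<Sigma> \<and> s_max \<Sigma> \<le> M}"

definition bandable_class ::
    "nat \<Rightarrow> real \<Rightarrow> real \<Rightarrow> real \<Rightarrow> real \<Rightarrow> real mat set" where
  "bandable_class p \<alpha> M M\<^sub>0 M_min = {\<Sigma> \<in> bounded_class p M.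
     (\<forall>k::nat. 1 \<le> k \<longrightarrow>
        (MAX j\<in>{..<p}. \<Sum>i | i < p \<and> \<bar>int i - int j\<bar> > int k. \<bar>\<Sigma> $$ (i, j)\<bar>)
          \<le> M\<^sub>0 * real k powr (- \<alpha>)) \<and>
     s_min \<Sigma> > M_min}"


subsection \<open>Directions and empirical matrix depth\<close>

definition supported_dirs :: "nat \<Rightarrow> nat \<Rightarrow> nat \<Rightarrow> real Matrix.vec set" where
  "supported_dirs p l1 l2 = {u \<in> unit_sphere p. \<forall>i<p. i \<notin> {l1..l2} \<longrightarrow> u $ i = 0}"

definition local_dirs :: "nat \<Rightarrow> nat \<Rightarrow> real Matrix.vec set" where
  "local_dirs p k =
     (if 2 * k \<le> p then (\<Union>l\<in>{0..p - 2 * k}. supported_dirs p l (l + 2 * k - 1))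
      else unit_sphere p)"

text \<open>
  The infimum is a minimum: the expression takes values in \<open>{0, 1/n, \<dots>, 1}\<close>.
\<close>

definition matrix_depth ::
    "real Matrix.vec set \<Rightarrow> nat \<Rightarrow> (nat \<Rightarrow> real Matrix.vec) \<Rightarrow> real mat \<Rightarrow> real" where
  "matrix_depth U n X \<Gamma> = (INF u\<in>U. min
     (1 / real n * (\<Sum>i<n. of_bool (\<bar>u \<bullet> X i\<bar>\<^sup>2 \<le> u \<bullet> (\<Gamma> *\<^sub>v u))))
     (1 / real n * (\<Sum>i<n. of_bool (\<bar>u \<bullet> X i\<bar>\<^sup>2 \<ge> u \<bullet> (\<Gamma> *\<^sub>v u)))))"

definition depth_maximizer ::
    "nat \<Rightarrow> nat \<Rightarrow> nat \<Rightarrow> (nat \<Rightarrow> real Matrix.vec) \<Rightarrow> real mat \<Rightarrow> bool" where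
  "depth_maximizer p k n X \<Gamma> \<longleftrightarrow> \<Gamma> \<in> banded_class p k \<and>
     (\<forall>\<Gamma>'\<in>banded_class p k.
        matrix_depth (local_dirs p k) n X \<Gamma>' \<le> matrix_depth (local_dirs p k) n X \<Gamma>)"

definition depth_beta :: real where
  "depth_beta = (THE b. cdf std_normal_distribution (sqrt b) = 3 / 4)"

lemma depth_beta_ex1: "\<exists>!b. cdf std_normal_distribution (sqrt b) = 3 / 4"
proof -
  interpret N: real_distribution std_normal_distribution by (rule real_dist_normal_dist)
  let ?F = "cdf std_normal_distribution"
  have cont: "isCont ?F x" for x
  proof -
    have "emeasure std_normal_distribution {x} = 0"
      by (simp add: emeasure_density nn_integral_0_iff_AE AE_lborel_singleton
            cong: nn_integral_cong_AE)
    then show ?thesis by (simp add: N.isCont_cdf measure_def)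
  qed
  have strict: "?F x < ?F y" if "x < y" for x y
  proof -
    have "emeasure std_normal_distribution {x<..y} \<noteq> 0"
    proof
      assume "emeasure std_normal_distribution {x<..y} = 0"
      then have "AE z in lborel. ennreal (std_normal_density z) * indicator {x<..y} z = 0"
        by (subst (asm) emeasure_density) (auto simp: nn_integral_0_iff_AE)
      then have "AE z in lborel. z \<notin> {x<..y}"
      proof eventually_elim
        case (elim z)
        moreover have "0 < std_normal_density z" by (simp add: normal_density_pos)
        ultimately show ?case by (auto simp: indicator_def ennreal_eq_0_iff split: if_splits)
      qed
      then have "emeasure lborel {x<..y} = 0"
        by (subst (asm) AE_iff_measurable[of "{x<..y}"]) auto
      with that show False by simp
    qed
    then have "0 < measure std_normal_distribution {x<..y}"
      by (simp add: N.emeasure_eq_measure zero_less_measure_iff)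
    with N.cdf_diff_eq[OF that] show ?thesis by linarith
  qed
  have "\<exists>x. ?F x < 3/4"
    using eventually_happens[OF order_tendstoD(2)[OF N.cdf_lim_at_bot, of "3/4"]] by auto
  then obtain x where x: "?F x < 3/4" ..
  have "\<exists>y. ?F y > 3/4"
    using eventually_happens[OF order_tendstoD(1)[OF N.cdf_lim_at_top_prob, of "3/4"]] by auto
  then obtain y where y: "?F y > 3/4" ..
  have "x \<le> y" using N.cdf_nondecreasing[of y x] x y by linarith
  then obtain z where z: "?F z = 3/4"
    using IVT[of ?F x "3/4" y] x y cont by fastforce
  have inj: "a = b" if "?F a = ?F b" for a b
    using strict[of a b] strict[of b a] that by (cases a b rule: linorder_cases) auto
  have "sqrt (z\<^sup>2) = z \<or> sqrt (- (z\<^sup>2)) = z"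
    unfolding real_sqrt_minus real_sqrt_abs by linarith
  then obtain b where b: "sqrt b = z" by blast
  show ?thesis
  proof (rule ex1I[of _ b])
    show "?F (sqrt b) = 3/4" using b z by simp
    fix c assume "?F (sqrt c) = 3/4"
    with z have "sqrt c = z" by (auto intro: inj[of "sqrt c" z])
    with b show "c = b" by (metis real_sqrt_eq_iff)
  qed
qed

lemma cdf_sqrt_depth_beta: "cdf std_normal_distribution (sqrt depth_beta) = 3 / 4"
  unfolding depth_beta_def by (rule theI') (rule depth_beta_ex1)


subsection \<open>The contamination model\<close>

text \<open>
  Distributions on \<open>p\<close>-dimensional space are measures on coordinate functions
  \<open>{..<p} \<rightarrow> real\<close> (extensional functions \<open>nat \<Rightarrow> real\<close>); \<open>vec p x\<close> is the
  vector with coordinate function \<open>x\<close>.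
\<close>

abbreviation borel_space :: "nat \<Rightarrow> (nat \<Rightarrow> real) measure" where
  "borel_space p \<equiv> PiM {..<p} (\<lambda>_. borel)"

text \<open>
  The centred normal law with covariance \<open>\<Sigma>\<close>, possibly singular, is the law of \<open>A Z\<close>, where
  \<open>Z\<close> is a vector of independent standard normal variables and \<open>A A\<^sup>T = \<Sigma>\<close>. The law does
  not depend on the chosen factor \<open>A\<close>; one exists by \<open>psd_factor_exists\<close> below.
\<close>

definition cov_factor :: "nat \<Rightarrow> real mat \<Rightarrow> real mat" where
  "cov_factor p \<Sigma> = (SOME A. A \<in> carrier_mat p p \<and> A * transpose_mat A = \<Sigma>)"

lemma real_psd_factor:
  fixes \<sigma> :: "nat \<Rightarrow> nat \<Rightarrow> real"
  assumes "\<And>i j. i < n \<Longrightarrow> j < n \<Longrightarrow> \<sigma> i j = \<sigma> j i"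
    and "\<And>v. 0 \<le> (\<Sum>i<n. \<Sum>j<n. v i * v j * \<sigma> i j)"
  shows "\<exists>a. \<forall>i<n. \<forall>j<n. \<sigma> i j = (\<Sum>k<n. a i k * a j k :: real)"
  using assms
proof (induction n arbitrary: \<sigma>)
  case 0
  show ?case by simp
next
  case (Suc n)
  note sym = Suc.prems(1) and pos = Suc.prems(2)
  define s where "s = \<sigma> n n"
  have expand: "(\<Sum>i<Suc n. \<Sum>j<Suc n. v i * v j * \<sigma> i j) =
      (\<Sum>i<n. \<Sum>j<n. v i * v j * \<sigma> i j) + 2 * v n * (\<Sum>i<n. v i * \<sigma> i n) + (v n)\<^sup>2 * s" for v
  proof -
    have "(\<Sum>j<n. v n * v j * \<sigma> n j) = v n * (\<Sum>i<n. v i * \<sigma> i n)"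
      unfolding sum_distrib_left by (intro sum.cong) (auto simp: sym[of n])
    moreover have "(\<Sum>i<n. v i * v n * \<sigma> i n) = v n * (\<Sum>i<n. v i * \<sigma> i n)"
      unfolding sum_distrib_left by (intro sum.cong) auto
    ultimately show ?thesis
      by (simp add: sum.distrib s_def power2_eq_square algebra_simps)
  qed
  have s0: "0 \<le> s"
    using pos[of "\<lambda>i. if i = n then 1 else 0"] unfolding expand by simp
  show ?case
  proof (cases "s = 0")
    case True
    have zero: "\<sigma> m n = 0" if m: "m < n" for m
    proof (rule ccontr)
      assume nz: "\<sigma> m n \<noteq> 0"
      define t where "t = - (\<sigma> m m + 1) / (2 * \<sigma> m n)"
      define v where "v = (\<lambda>i. if i = m then 1 else if i = n then t else 0)"
      have "(\<Sum>i<n. \<Sum>j<n. v i * v j * \<sigma> i j) = (\<Sum>i<n. if i = m then \<sigma> m m else 0)"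
      proof (rule sum.cong[OF refl])
        fix i assume "i \<in> {..<n}"
        then have "(\<Sum>j<n. v i * v j * \<sigma> i j) = (\<Sum>j<n. if j = m then v i * \<sigma> i m else 0)"
          by (intro sum.cong) (auto simp: v_def)
        also have "\<dots> = v i * \<sigma> i m" using m by simp
        finally show "(\<Sum>j<n. v i * v j * \<sigma> i j) = (if i = m then \<sigma> m m else 0)"
          using \<open>i \<in> {..<n}\<close> by (auto simp: v_def)
      qed
      also have "\<dots> = \<sigma> m m" using m by simp
      finally have 1: "(\<Sum>i<n. \<Sum>j<n. v i * v j * \<sigma> i j) = \<sigma> m m" .
      have "(\<Sum>i<n. v i * \<sigma> i n) = (\<Sum>i<n. if i = m then \<sigma> m n else 0)"
        by (intro sum.cong) (auto simp: v_def)
      also have "\<dots> = \<sigma> m n" using m by simp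
      finally have 2: "(\<Sum>i<n. v i * \<sigma> i n) = \<sigma> m n" .
      have vn: "v n = t" using m by (simp add: v_def)
      have "0 \<le> \<sigma> m m + 2 * t * \<sigma> m n"
        using pos[of v] unfolding expand 1 2 vn True by simp
      also have "2 * t * \<sigma> m n = - (\<sigma> m m + 1)"
        using nz by (simp add: t_def field_simps)
      finally show False by simp
    qed
    have "\<exists>a. \<forall>i<n. \<forall>j<n. \<sigma> i j = (\<Sum>k<n. a i k * a j k)"
    proof (rule Suc.IH)
      show "0 \<le> (\<Sum>i<n. \<Sum>j<n. v i * v j * \<sigma> i j)" for v
        using pos[of v] zero unfolding expand True by simp
    qed (use sym in auto)
    then obtain a where a: "\<And>i j. i < n \<Longrightarrow> j < n \<Longrightarrow> \<sigma> i j = (\<Sum>k<n. a i k * a j k)" by blast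
    define b where "b = (\<lambda>i k. if i < n \<and> k < n then a i k else 0)"
    have "\<sigma> i j = (\<Sum>k<Suc n. b i k * b j k)" if "i < Suc n" "j < Suc n" for i j
      using that zero[of i] zero[of j] sym[of n j] True a[of i j]
      by (auto simp: b_def less_Suc_eq s_def)
    then show ?thesis by blast
  next
    case False
    with s0 have s: "0 < s" by simp
    define \<tau> where "\<tau> = (\<lambda>i j. \<sigma> i j - \<sigma> i n * \<sigma> j n / s)"
    have "\<exists>a. \<forall>i<n. \<forall>j<n. \<tau> i j = (\<Sum>k<n. a i k * a j k)"
    proof (rule Suc.IH)
      show "\<tau> i j = \<tau> j i" if "i < n" "j < n" for i j
        using sym[of i j] that by (simp add: \<tau>_def mult.commute)
      show "0 \<le> (\<Sum>i<n. \<Sum>j<n. v i * v j * \<tau> i j)" for v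
      proof -
        define c where "c = (\<Sum>i<n. v i * \<sigma> i n)"
        define w where "w = v(n := - c / s)"
        have 1: "(\<Sum>i<n. \<Sum>j<n. w i * w j * \<sigma> i j) = (\<Sum>i<n. \<Sum>j<n. v i * v j * \<sigma> i j)"
          by (intro sum.cong) (auto simp: w_def)
        have 2: "(\<Sum>i<n. w i * \<sigma> i n) = c"
          unfolding c_def by (intro sum.cong) (auto simp: w_def)
        have wn: "w n = - c / s" by (simp add: w_def)
        have "c * c / s = (\<Sum>i<n. \<Sum>j<n. v i * v j * (\<sigma> i n * \<sigma> j n / s))"
          unfolding c_def sum_product sum_divide_distrib
          by (intro sum.cong) (auto simp: algebra_simps)
        then have "(\<Sum>i<n. \<Sum>j<n. v i * v j * \<tau> i j) =
            (\<Sum>i<n. \<Sum>j<n. v i * v j * \<sigma> i j) - c * c / s"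
          by (simp add: \<tau>_def right_diff_distrib sum_subtractf)
        also have "\<dots> = (\<Sum>i<n. \<Sum>j<n. v i * v j * \<sigma> i j) + 2 * (- c / s) * c + (- c / s)\<^sup>2 * s"
          using s by (simp add: field_simps power2_eq_square)
        also have "\<dots> \<ge> 0" using pos[of w] unfolding expand 1 2 wn .
        finally show ?thesis .
      qed
    qed
    then obtain a where a: "\<And>i j. i < n \<Longrightarrow> j < n \<Longrightarrow> \<tau> i j = (\<Sum>k<n. a i k * a j k)" by blast
    define b where "b = (\<lambda>i k. if k = n then \<sigma> i n / sqrt s else if i < n then a i k else 0)"
    have last: "b i n * b j n = \<sigma> i n * \<sigma> j n / s" for i j
      using s by (simp add: b_def)
    have "\<sigma> i j = (\<Sum>k<Suc n. b i k * b j k)" if "i < Suc n" "j < Suc n" for i j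
    proof (cases "i < n \<and> j < n")
      case True
      then have "(\<Sum>k<n. b i k * b j k) = \<tau> i j"
        unfolding a[OF conjunct1[OF True] conjunct2[OF True]]
        by (intro sum.cong) (auto simp: b_def)
      then show ?thesis using last by (simp add: \<tau>_def)
    next
      case False
      then have "(\<Sum>k<n. b i k * b j k) = 0"
        by (intro sum.neutral) (auto simp: b_def)
      moreover have "\<sigma> i j = \<sigma> i n * \<sigma> j n / s"
        using False that sym[of n j] s by (auto simp: less_Suc_eq s_def)
      ultimately show ?thesis using last by simp
    qed
    then show ?thesis by blast
  qed
qed

lemma psd_factor_exists:
  assumes "psd p \<Sigma>"
  shows "\<exists>A. A \<in> carrier_mat p p \<and> A * transpose_mat A = \<Sigma>"
proof -
  from assms have S: "\<Sigma> \<in> carrier_mat p p" and T: "transpose_mat \<Sigma> = \<Sigma>"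
    and pos: "\<And>v. v \<in> carrier_vec p \<Longrightarrow> 0 \<le> v \<bullet> (\<Sigma> *\<^sub>v v)"
    by (auto simp: psd_def)
  have "\<exists>a. \<forall>i<p. \<forall>j<p. \<Sigma> $$ (i, j) = (\<Sum>k<p. a i k * a j k)"
  proof (rule real_psd_factor)
    show "\<Sigma> $$ (i, j) = \<Sigma> $$ (j, i)" if "i < p" "j < p" for i j
      using arg_cong[OF T, of "\<lambda>A. A $$ (i, j)"] S that by simp
    show "0 \<le> (\<Sum>i<p. \<Sum>j<p. v i * v j * \<Sigma> $$ (i, j))" for v
      using pos[of "Matrix.vec p v"] S
      by (simp add: scalar_prod_def sum_distrib_left atLeast0LessThan mult_ac)
  qed
  then obtain a where a: "\<And>i j. i < p \<Longrightarrow> j < p \<Longrightarrow> \<Sigma> $$ (i, j) = (\<Sum>k<p. a i k * a j k)"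
    by blast
  have "mat p p (\<lambda>(i, k). a i k) * transpose_mat (mat p p (\<lambda>(i, k). a i k)) = \<Sigma>"
    using S by (intro eq_matI) (auto simp: a scalar_prod_def atLeast0LessThan)
  then show ?thesis by (intro exI[of _ "mat p p (\<lambda>(i, k). a i k)"]) simp
qed

lemma cov_factor:
  assumes "psd p \<Sigma>"
  shows "cov_factor p \<Sigma> \<in> carrier_mat p p"
    and "cov_factor p \<Sigma> * transpose_mat (cov_factor p \<Sigma>) = \<Sigma>"
  using someI_ex[OF psd_factor_exists[OF assms]] unfolding cov_factor_def by auto

definition mv_normal :: "nat \<Rightarrow> real mat \<Rightarrow> (nat \<Rightarrow> real) measure" where
  "mv_normal p \<Sigma> = distr (PiM {..<p} (\<lambda>_. std_normal_distribution)) (borel_space p)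
     (\<lambda>z. \<lambda>i\<in>{..<p}. (cov_factor p \<Sigma> *\<^sub>v Matrix.vec p z) $ i)"

lemma mv_normal_measurable:
  assumes "psd p \<Sigma>"
  shows "(\<lambda>z. \<lambda>i\<in>{..<p}. (cov_factor p \<Sigma> *\<^sub>v Matrix.vec p z) $ i)
    \<in> PiM {..<p} (\<lambda>_. std_normal_distribution) \<rightarrow>\<^sub>M borel_space p"
proof (rule measurable_restrict)
  fix i assume "i \<in> {..<p}"
  then have "(cov_factor p \<Sigma> *\<^sub>v Matrix.vec p z) $ i = (\<Sum>j<p. cov_factor p \<Sigma> $$ (i, j) * z j)" for z
    using cov_factor(1)[OF assms] by (simp add: scalar_prod_def atLeast0LessThan)
  moreover have "(\<lambda>z. \<Sum>j<p. cov_factor p \<Sigma> $$ (i, j) * z j)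
      \<in> borel_measurable (PiM {..<p} (\<lambda>_. std_normal_distribution))"
  proof (intro borel_measurable_sum borel_measurable_times borel_measurable_const)
    fix j assume "j \<in> {..<p}"
    then have "(\<lambda>z. z j) \<in> PiM {..<p} (\<lambda>_. std_normal_distribution) \<rightarrow>\<^sub>M std_normal_distribution"
      by (rule measurable_component_singleton)
    then show "(\<lambda>z. z j) \<in> borel_measurable (PiM {..<p} (\<lambda>_. std_normal_distribution))"
      by simp
  qed
  ultimately show "(\<lambda>z. (cov_factor p \<Sigma> *\<^sub>v Matrix.vec p z) $ i)
      \<in> borel_measurable (PiM {..<p} (\<lambda>_. std_normal_distribution))"
    by simp
qed

lemma sets_mv_normal [simp]: "sets (mv_normal p \<Sigma>) = sets (borel_space p)"
  by (simp add: mv_normal_def)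

lemma prob_space_mv_normal:
  assumes "psd p \<Sigma>"
  shows "prob_space (mv_normal p \<Sigma>)"
  unfolding mv_normal_def
  by (intro prob_space.prob_space_distr[OF _ mv_normal_measurable[OF assms]] prob_space_PiM
      real_distribution.axioms(1)[OF real_dist_normal_dist])

text \<open>The characteristic function; in particular \<open>mv_normal\<close> depends only on \<open>\<Sigma>\<close>.\<close>

lemma char_mv_normal:
  assumes \<Sigma>: "psd p \<Sigma>" and u: "u \<in> carrier_vec p"
  shows "(CLINT x|mv_normal p \<Sigma>. iexp (u \<bullet> Matrix.vec p x)) =
    complex_of_real (exp (- (u \<bullet> (\<Sigma> *\<^sub>v u)) / 2))"
proof -
  define A where "A = cov_factor p \<Sigma>"
  define w where "w = transpose_mat A *\<^sub>v u"
  have A: "A \<in> carrier_mat p p" and AA: "A * transpose_mat A = \<Sigma>"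
    using cov_factor[OF \<Sigma>] by (auto simp: A_def)
  have w: "w \<in> carrier_vec p"
    unfolding w_def using A u by (intro mult_mat_vec_carrier[of _ p p]) auto
  interpret N: real_distribution std_normal_distribution by (rule real_dist_normal_dist)
  interpret P: product_sigma_finite "\<lambda>_::nat. std_normal_distribution"
    by unfold_locales
  have lin: "u \<bullet> Matrix.vec p (\<lambda>i\<in>{..<p}. (A *\<^sub>v Matrix.vec p z) $ i) = (\<Sum>j<p. w $ j * z j)" for z
  proof -
    have "Matrix.vec p (\<lambda>i\<in>{..<p}. (A *\<^sub>v Matrix.vec p z) $ i) = A *\<^sub>v Matrix.vec p z"
      using A by (intro eq_vecI) auto
    also have "u \<bullet> (A *\<^sub>v Matrix.vec p z) = w \<bullet> Matrix.vec p z"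
      using A u transpose_vec_mult_scalar[of A p p "Matrix.vec p z" u] by (simp add: w_def)
    finally show ?thesis by (simp add: scalar_prod_def atLeast0LessThan)
  qed
  have meas: "(\<lambda>x. iexp (u \<bullet> Matrix.vec p x)) \<in> borel_measurable (borel_space p)"
    using u by (simp add: scalar_prod_def atLeast0LessThan)
  have ww: "(\<Sum>j<p. (w $ j)\<^sup>2) = u \<bullet> (\<Sigma> *\<^sub>v u)"
  proof -
    have "u \<bullet> (\<Sigma> *\<^sub>v u) = u \<bullet> (A *\<^sub>v w)"
      using A u by (simp add: AA[symmetric] w_def)
    also have "\<dots> = w \<bullet> w"
      using A u w transpose_vec_mult_scalar[of A p p w u] by (simp add: w_def)
    also have "\<dots> = (\<Sum>j<p. (w $ j)\<^sup>2)"
      using w by (simp add: scalar_prod_def atLeast0LessThan power2_eq_square)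
    finally show ?thesis by simp
  qed
  have "(CLINT x|mv_normal p \<Sigma>. iexp (u \<bullet> Matrix.vec p x)) =
      (CLINT z|PiM {..<p} (\<lambda>_. std_normal_distribution). iexp (\<Sum>j<p. w $ j * z j))"
    unfolding mv_normal_def
    by (subst integral_distr[OF mv_normal_measurable[OF \<Sigma>] meas])
      (simp add: lin flip: A_def)
  also have "\<dots> = (CLINT z|PiM {..<p} (\<lambda>_. std_normal_distribution). \<Prod>j<p. iexp (w $ j * z j))"
    by (simp add: exp_sum sum_distrib_left)
  also have "\<dots> = (\<Prod>j<p. CLINT z|std_normal_distribution. iexp (w $ j * z))"
    by (rule P.product_integral_prod) (auto intro!: N.integrable_iexp)
  also have "\<dots> = (\<Prod>j<p. char std_normal_distribution (w $ j))"
    by (simp add: char_def)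
  also have "\<dots> = (\<Prod>j<p. complex_of_real (exp (- (w $ j)\<^sup>2 / 2)))"
    by (simp add: char_std_normal_distribution)
  also have "\<dots> = complex_of_real (exp (\<Sum>j<p. - (w $ j)\<^sup>2 / 2))"
    by (simp only: exp_sum[OF finite_lessThan] of_real_prod)
  also have "(\<Sum>j<p. - (w $ j)\<^sup>2 / 2) = - (u \<bullet> (\<Sigma> *\<^sub>v u)) / 2"
    by (simp add: ww[symmetric] sum_negf sum_divide_distrib)
  finally show ?thesis .
qed

definition contaminated ::
    "nat \<Rightarrow> real \<Rightarrow> real mat \<Rightarrow> (nat \<Rightarrow> real) measure \<Rightarrow> (nat \<Rightarrow> real) measure" where
  "contaminated p \<epsilon> \<Sigma> Q = measure_of (space (borel_space p)) (sets (borel_space p))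
     (\<lambda>A. ennreal (1 - \<epsilon>) * emeasure (mv_normal p \<Sigma>) A + ennreal \<epsilon> * emeasure Q A)"

lemma sets_contaminated [simp]: "sets (contaminated p \<epsilon> \<Sigma> Q) = sets (borel_space p)"
  by (simp add: contaminated_def sets.sigma_sets_eq)

lemma emeasure_contaminated:
  assumes "sets Q = sets (borel_space p)" "A \<in> sets (borel_space p)"
  shows "emeasure (contaminated p \<epsilon> \<Sigma> Q) A =
    ennreal (1 - \<epsilon>) * emeasure (mv_normal p \<Sigma>) A + ennreal \<epsilon> * emeasure Q A"
proof (rule emeasure_measure_of[OF contaminated_def])
  show "countably_additive (sets (contaminated p \<epsilon> \<Sigma> Q))
     (\<lambda>A. ennreal (1 - \<epsilon>) * emeasure (mv_normal p \<Sigma>) A + ennreal \<epsilon> * emeasure Q A)"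
  proof (rule countably_additiveI)
    fix B :: "nat \<Rightarrow> _"
    assume B: "range B \<subseteq> sets (contaminated p \<epsilon> \<Sigma> Q)" "disjoint_family B"
    have N: "(\<Sum>i. emeasure (mv_normal p \<Sigma>) (B i)) = emeasure (mv_normal p \<Sigma>) (\<Union>i. B i)"
      using B by (intro suminf_emeasure) auto
    have Q: "(\<Sum>i. emeasure Q (B i)) = emeasure Q (\<Union>i. B i)"
      using B assms(1) by (intro suminf_emeasure) auto
    show "(\<Sum>i. ennreal (1 - \<epsilon>) * emeasure (mv_normal p \<Sigma>) (B i) + ennreal \<epsilon> * emeasure Q (B i)) =
      ennreal (1 - \<epsilon>) * emeasure (mv_normal p \<Sigma>) (\<Union> (range B)) + ennreal \<epsilon> * emeasure Q (\<Union> (range B))"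
      by (subst suminf_add[symmetric]) (simp_all only: summableI ennreal_suminf_cmult N Q)
  qed
qed (use assms sets.space_closed in \<open>auto simp: positive_def\<close>)

lemma prob_space_contaminated:
  assumes "psd p \<Sigma>" "prob_space Q" "sets Q = sets (borel_space p)" "0 \<le> \<epsilon>" "\<epsilon> \<le> 1"
  shows "prob_space (contaminated p \<epsilon> \<Sigma> Q)"
proof
  have sp: "space (contaminated p \<epsilon> \<Sigma> Q) = space (borel_space p)"
    "space Q = space (borel_space p)" "space (mv_normal p \<Sigma>) = space (borel_space p)"
    by (rule sets_eq_imp_space_eq, simp add: assms(3))+
  have "emeasure (mv_normal p \<Sigma>) (space (borel_space p)) = 1"
    using prob_space.emeasure_space_1[OF prob_space_mv_normal[OF assms(1)]] by (simp add: sp)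
  moreover have "emeasure Q (space (borel_space p)) = 1"
    using prob_space.emeasure_space_1[OF assms(2)] by (simp add: sp)
  ultimately show "emeasure (contaminated p \<epsilon> \<Sigma> Q) (space (contaminated p \<epsilon> \<Sigma> Q)) = 1"
    using assms(4,5)
    by (simp only: sp emeasure_contaminated[OF assms(3) sets.top])
       (simp flip: ennreal_plus)
qed

definition sample_law ::
    "nat \<Rightarrow> nat \<Rightarrow> real \<Rightarrow> real mat \<Rightarrow> (nat \<Rightarrow> real) measure \<Rightarrow> (nat \<Rightarrow> nat \<Rightarrow> real) measure"
  where
  "sample_law n p \<epsilon> \<Sigma> Q = PiM {..<n} (\<lambda>_. contaminated p \<epsilon> \<Sigma> Q)"

definition sample_space :: "nat \<Rightarrow> nat \<Rightarrow> (nat \<Rightarrow> nat \<Rightarrow> real) set" where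
  "sample_space n p = space (PiM {..<n} (\<lambda>_. borel_space p))"

definition sample_vectors :: "nat \<Rightarrow> (nat \<Rightarrow> nat \<Rightarrow> real) \<Rightarrow> nat \<Rightarrow> real Matrix.vec" where
  "sample_vectors p x i = Matrix.vec p (x i)"

end

theory Submission
  imports Defs
begin

text \<open>
  The depth of \<open>\<Gamma>\<close> in direction \<open>u\<close> counts the observations with \<open>|u\<^sup>T X|\<^sup>2\<close> on either side of
  \<open>u\<^sup>T \<Gamma> u\<close>, so depth close to \<open>1/2\<close> forces \<open>u\<^sup>T \<Gamma> u\<close> to be close to a median of \<open>|u\<^sup>T X|\<^sup>2\<close>, which for
  Gaussian data is \<open>\<beta> u\<^sup>T \<Sigma> u\<close>. Contamination shifts the frequencies by at most about
  \<open>\<epsilon> / (1 - \<epsilon>) < 1/4\<close>. The band of width \<open>k\<close> of \<open>\<beta> \<Sigma>\<close> is positive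
  semidefinite once the banding bias is below \<open>M\<^sub>m\<^sub>i\<^sub>n\<close>, so it is a candidate, and its depth is at least \<open>(1 - \<epsilon>) / 2\<close> up to the banding bias and the sampling fluctuation; the maximizer is at least
  as deep, and inverting the distribution function of \<open>|N(0,1)|\<close> turns this into
  \<open>|u\<^sup>T \<Gamma> u / \<beta> - u\<^sup>T \<Sigma> u| = O(\<epsilon> + bias + fluctuation)\<close> for every \<open>u\<close> in the family of directions
  (\<open>deepest_scatter_close\<close>). A banded quadratic form is an alternating sum of its restrictions to
  windows of length \<open>2k\<close> (\<open>qform_banded_le\<close>), so these directional bounds control the operator norm
  without a logarithmic loss.

  The law \<open>Q\<close> is arbitrary, so the frequencies under the contaminated law \<open>P\<close> have no useful
  regularity. However \<open>(1 - \<epsilon>) N(0, \<Sigma>)\<close> has a density \<open>w\<close> with \<open>0 \<le> w \<le> 1\<close> with respect to \<open>P\<close>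
  (\<open>contaminated_weight\<close>). Replacing every count by the count weighted with \<open>w(X\<^sub>i)\<close> costs only the
  mean of \<open>1 - w(X\<^sub>i)\<close>, which concentrates at \<open>\<epsilon>\<close>, and every expectation of a weighted quantity is a
  Gaussian expectation.

  The rate demands that the weighted frequencies of \<open>{|u\<^sup>T X| \<le> c \<sigma>(u)}\<close>, with
  \<open>\<sigma>(u)\<^sup>2 = u\<^sup>T \<Sigma> u\<close>, are within \<open>O(\<rho>)\<close> of their means, where \<open>\<rho>\<^sup>2\<close> is of the order of
  \<open>(k + log p + log (1/\<delta>)) / n\<close>, uniformly in \<open>u\<close> and with no further logarithm
  (\<open>whp_uniform_deviation\<close>). Because counts are monotone in the threshold, four thresholds \<open>c\<close>
  suffice and only \<open>u\<close> varies. The proof chains over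
  nets of radius \<open>8\<^sup>-\<^sup>j\<close>, applying Bernstein's inequality to the difference of the indicators of
  consecutive net points, and stops when the radius is about \<open>\<rho>\<^sup>3\<close>. From there the slab is widened by
  \<open>\<rho>\<close>, and the few observations that still move across its boundary are counted by Chebyshev's
  inequality with a uniform bound on second moments (\<open>whp_uniform_second_moment\<close>).
\<close>

section \<open>High-probability statements and exponential inequalities\<close>

text \<open>
  The event of good outcomes need not be measurable: it is enough that it contains a measurable
  event of large probability. The estimator in the main result is an arbitrary selection of
  maximizers, so its error is not known to be a random variable.
\<close>

definition whp :: "'a measure \<Rightarrow> real \<Rightarrow> ('a \<Rightarrow> bool) \<Rightarrow> bool" where
  "whp M b R \<longleftrightarrow> (\<exists>E\<in>sets M. (\<forall>x\<in>E. R x) \<and> 1 - b \<le> measure M E)"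

lemma whp_mono:
  assumes "whp M b R" "b \<le> b'" "\<And>x. x \<in> space M \<Longrightarrow> R x \<Longrightarrow> R' x"
  shows "whp M b' R'"
proof -
  obtain E where E: "E \<in> sets M" "\<And>x. x \<in> E \<Longrightarrow> R x" "1 - b \<le> measure M E"
    using assms(1) unfolding whp_def by blast
  have "\<forall>x\<in>E. R' x" using E assms(3) sets.sets_into_space by blast
  moreover have "1 - b' \<le> measure M E" using E(3) assms(2) by linarith
  ultimately show ?thesis unfolding whp_def using E(1) by blast
qed

context prob_space
begin

lemma whp_conj:
  assumes "whp M b R" "whp M b' R'"
  shows "whp M (b + b') (\<lambda>x. R x \<and> R' x)"
proof -
  obtain E where E: "E \<in> sets M" "\<And>x. x \<in> E \<Longrightarrow> R x" "1 - b \<le> prob E"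
    using assms(1) unfolding whp_def by blast
  obtain F where F: "F \<in> sets M" "\<And>x. x \<in> F \<Longrightarrow> R' x" "1 - b' \<le> prob F"
    using assms(2) unfolding whp_def by blast
  have "prob (E \<union> F) = prob E + prob F - prob (E \<inter> F)"
    using E(1) F(1) by (intro measure_Un3) (auto simp: fmeasurable_eq_sets)
  then have "1 - (b + b') \<le> prob (E \<inter> F)"
    using E(3) F(3) prob_le_1[of "E \<union> F"] by linarith
  then show ?thesis unfolding whp_def using E F by (intro bexI[of _ "E \<inter> F"]) auto
qed

lemma whp_ball:
  assumes "finite A" "\<And>a. a \<in> A \<Longrightarrow> whp M (b a) (R a)"
  shows "whp M (sum b A) (\<lambda>x. \<forall>a\<in>A. R a x)"
  using assms
proof (induction A rule: finite_induct)
  case empty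
  show ?case unfolding whp_def by (intro bexI[of _ "space M"]) (auto simp: prob_space)
next
  case (insert a A)
  have "whp M (b a + sum b A) (\<lambda>x. R a x \<and> (\<forall>a\<in>A. R a x))"
    by (intro whp_conj insert) auto
  then show ?case using insert.hyps by (simp add: whp_def)
qed

lemma whp_ball_card:
  assumes "finite A" "\<And>a. a \<in> A \<Longrightarrow> whp M b (R a)"
  shows "whp M (real (card A) * b) (\<lambda>x. \<forall>a\<in>A. R a x)"
  using whp_ball[OF assms(1), of "\<lambda>_. b" R] assms(2) by simp

text \<open>
  The exponential Markov inequality for i.i.d. sums. It is stated with the moment generating function
  as a hypothesis because it serves both bounded variables (Bernstein) and squares of Gaussian
  projections, which are only exponentially integrable.
\<close>

lemma whp_chernoff:
  fixes n :: nat
  assumes g: "g \<in> borel_measurable M"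
    and mgf: "(\<integral>\<^sup>+x. ennreal (exp (g x)) \<partial>M) \<le> ennreal (exp a)"
  shows "whp (PiM {..<n} (\<lambda>_. M)) (exp (- L)) (\<lambda>x. (\<Sum>i<n. g (x i)) \<le> real n * a + L)"
proof -
  interpret PP: product_prob_space "\<lambda>_::nat. M" "{..<n}" by unfold_locales
  let ?P = "PiM {..<n} (\<lambda>_. M)" and ?s = "real n * a + L"
  have [measurable]: "g \<in> borel_measurable M" by (rule g)
  have S: "(\<lambda>x. \<Sum>i<n. g (x i)) \<in> borel_measurable ?P"
    by (intro borel_measurable_sum) measurable
  define B where "B = {x \<in> space ?P. ?s < (\<Sum>i<n. g (x i))}"
  have B: "B \<in> sets ?P" unfolding B_def using S by measurable
  have "(\<integral>\<^sup>+x. ennreal (exp (\<Sum>i<n. g (x i))) \<partial>?P) = (\<integral>\<^sup>+x. (\<Prod>i<n. ennreal (exp (g (x i)))) \<partial>?P)"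
    by (simp add: exp_sum prod_ennreal)
  also have "\<dots> = (\<Prod>i<n. \<integral>\<^sup>+x. ennreal (exp (g x)) \<partial>M)"
    by (rule PP.product_nn_integral_prod) auto
  also have "\<dots> \<le> (\<Prod>i<n. ennreal (exp a))"
    by (intro prod_mono_ennreal mgf)
  also have "\<dots> = ennreal (exp (real n * a))"
    by (simp add: ennreal_power exp_of_nat_mult)
  finally have I: "(\<integral>\<^sup>+x. ennreal (exp (\<Sum>i<n. g (x i))) \<partial>?P) \<le> ennreal (exp (real n * a))" .
  have "ennreal (exp ?s) * emeasure ?P B = (\<integral>\<^sup>+x. ennreal (exp ?s) * indicator B x \<partial>?P)"
    using B by (simp add: nn_integral_cmult_indicator)
  also have "\<dots> \<le> (\<integral>\<^sup>+x. ennreal (exp (\<Sum>i<n. g (x i))) \<partial>?P)"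
    by (intro nn_integral_mono) (auto simp: B_def indicator_def intro!: ennreal_leI)
  also note I
  finally have "ennreal (exp ?s) * ennreal (measure ?P B) \<le> ennreal (exp (real n * a))"
    by (simp add: PP.P.emeasure_eq_measure)
  then have "exp ?s * measure ?P B \<le> exp (real n * a)"
    by (simp add: ennreal_mult'[symmetric])
  then have "measure ?P B \<le> exp (real n * a) / exp ?s"
    by (simp add: field_simps)
  also have "\<dots> = exp (- L)" by (simp add: exp_diff[symmetric])
  finally have "measure ?P B \<le> exp (- L)" .
  moreover have "measure ?P (space ?P - B) = 1 - measure ?P B" using B by (rule PP.P.prob_compl)
  ultimately have "1 - exp (- L) \<le> measure ?P (space ?P - B)" by linarith
  moreover have "\<forall>x\<in>space ?P - B. (\<Sum>i<n. g (x i)) \<le> ?s" by (auto simp: B_def)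
  ultimately show ?thesis using B unfolding whp_def by blast
qed

end

lemma exp_le_quadratic:
  fixes x :: real
  assumes "x \<le> 1"
  shows "exp x \<le> 1 + x + x\<^sup>2"
proof (cases "0 \<le> x")
  case True
  then show ?thesis using assms by (rule exp_bound)
next
  case False
  have "1 - x \<le> exp (- x)" using exp_ge_add_one_self[of "- x"] by simp
  then have "exp x * (1 - x) \<le> exp x * exp (- x)" by (intro mult_left_mono) auto
  then have 1: "exp x * (1 - x) \<le> 1" by (simp add: exp_minus)
  have "(1 + x + x\<^sup>2) * (1 - x) = 1 - x ^ 3" by (simp add: algebra_simps power2_eq_square power3_eq_cube)
  also have "x ^ 3 \<le> 0" using False by (simp add: power3_eq_cube mult_nonpos_nonneg mult_nonneg_nonpos zero_le_mult_iff mult_le_0_iff)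
  then have "1 - x ^ 3 \<ge> 1" by simp
  finally have "exp x * (1 - x) \<le> (1 + x + x\<^sup>2) * (1 - x)" using 1 by linarith
  then show ?thesis using False by (simp add: mult_le_cancel_right)
qed

context prob_space
begin

text \<open>
  Bernstein's inequality with a free parameter \<open>l\<close> in place of the optimized tail. The chaining
  argument chooses \<open>l\<close> itself, scale by scale, which keeps the deviations geometric.
  The proof uses \<open>exp x \<le> 1 + x + x\<^sup>2\<close> for \<open>x \<le> 1\<close>, valid here since \<open>l |Y - E Y| \<le> 2 l \<le> 1\<close>.
\<close>

lemma whp_bernstein:
  fixes Y :: "'a \<Rightarrow> real" and n :: nat
  assumes Y: "Y \<in> borel_measurable M" and bnd: "\<And>x. x \<in> space M \<Longrightarrow> \<bar>Y x\<bar> \<le> 1"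
    and q: "expectation (\<lambda>x. (Y x)\<^sup>2) \<le> q"
    and lam: "0 < l" "l \<le> 1/2" and n: "0 < n"
  shows "whp (PiM {..<n} (\<lambda>_. M)) (exp (- L))
    (\<lambda>x. (\<Sum>i<n. Y (x i)) / real n \<le> expectation Y + l * q + L / (l * real n))"
proof -
  have [measurable]: "Y \<in> borel_measurable M" by (rule Y)
  have iY: "integrable M Y"
    by (rule integrable_const_bound[of _ 1]) (use bnd in auto)
  have iY2: "integrable M (\<lambda>x. (Y x)\<^sup>2)"
    by (rule integrable_const_bound[of _ 1]) (use bnd in \<open>auto simp: abs_square_le_1\<close>)
  define \<mu> where "\<mu> = expectation Y"
  have "\<bar>\<mu>\<bar> \<le> expectation (\<lambda>x. \<bar>Y x\<bar>)" unfolding \<mu>_def by (rule integral_abs_bound)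
  also have "\<dots> \<le> expectation (\<lambda>_. 1)"
    using iY bnd by (intro integral_mono) auto
  finally have mu: "\<bar>\<mu>\<bar> \<le> 1" by (simp add: prob_space)
  define g where "g = (\<lambda>x. l * (Y x - \<mu>))"
  have gm[measurable]: "g \<in> borel_measurable M" unfolding g_def by measurable
  have g1: "g x \<le> 1" if "x \<in> space M" for x
  proof -
    have "g x \<le> l * 2" unfolding g_def using bnd[OF that] mu lam by (intro mult_left_mono) auto
    then show ?thesis using lam by linarith
  qed
  have gq: "1 + g x + (g x)\<^sup>2 = (1 - l * \<mu> + l\<^sup>2 * \<mu>\<^sup>2) + (l - 2 * l\<^sup>2 * \<mu>) * Y x + l\<^sup>2 * (Y x)\<^sup>2" for x
    unfolding g_def by (simp add: power2_eq_square algebra_simps)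
  have gint: "integrable M (\<lambda>x. 1 + g x + (g x)\<^sup>2)"
    unfolding gq using iY iY2 by auto
  have gE: "expectation (\<lambda>x. 1 + g x + (g x)\<^sup>2) = 1 + l\<^sup>2 * (expectation (\<lambda>x. (Y x)\<^sup>2) - \<mu>\<^sup>2)"
    unfolding gq using iY iY2 by (simp add: prob_space \<mu>_def[symmetric]) (simp add: algebra_simps power2_eq_square)
  have "(\<integral>\<^sup>+x. ennreal (exp (g x)) \<partial>M) \<le> (\<integral>\<^sup>+x. ennreal (1 + g x + (g x)\<^sup>2) \<partial>M)"
    using g1 by (intro nn_integral_mono ennreal_leI exp_le_quadratic) auto
  also have "\<dots> = ennreal (expectation (\<lambda>x. 1 + g x + (g x)\<^sup>2))"
  proof (rule nn_integral_eq_integral[OF gint])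
    have "0 \<le> 1 + t + t\<^sup>2" for t :: real
      using zero_le_power2[of "t + 1/2"] by (simp add: power2_eq_square algebra_simps)
    then show "AE x in M. 0 \<le> 1 + g x + (g x)\<^sup>2" by auto
  qed
  also have "\<dots> \<le> ennreal (exp (l\<^sup>2 * q))"
  proof (rule ennreal_leI)
    have "0 \<le> \<mu>\<^sup>2" by simp
    then have "l\<^sup>2 * (expectation (\<lambda>x. (Y x)\<^sup>2) - \<mu>\<^sup>2) \<le> l\<^sup>2 * q"
      using q by (intro mult_left_mono) (linarith, simp)
    then show "expectation (\<lambda>x. 1 + g x + (g x)\<^sup>2) \<le> exp (l\<^sup>2 * q)"
      unfolding gE using exp_ge_add_one_self[of "l\<^sup>2 * q"] by linarith
  qed
  finally have "whp (PiM {..<n} (\<lambda>_. M)) (exp (- L)) (\<lambda>x. (\<Sum>i<n. g (x i)) \<le> real n * (l\<^sup>2 * q) + L)"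
    by (rule whp_chernoff[OF gm])
  then show ?thesis
  proof (rule whp_mono)
    fix x assume "(\<Sum>i<n. g (x i)) \<le> real n * (l\<^sup>2 * q) + L"
    also have "(\<Sum>i<n. g (x i)) = l * ((\<Sum>i<n. Y (x i)) - real n * \<mu>)"
      by (simp add: g_def sum_subtractf sum_distrib_left[symmetric])
    finally have "(\<Sum>i<n. Y (x i)) \<le> (real n * (l\<^sup>2 * q) + L) / l + real n * \<mu>"
      using lam by (simp add: field_simps)
    also have "\<dots> = real n * (\<mu> + l * q + L / (l * real n))"
      using lam n by (simp add: field_simps power2_eq_square)
    finally show "(\<Sum>i<n. Y (x i)) / real n \<le> expectation Y + l * q + L / (l * real n)"
      using n by (simp add: field_simps \<mu>_def)
  qed simp
qed

end

section \<open>Nets of sparse directions\<close>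

lemma sum_exp_abs_int_le:
  fixes R :: real
  assumes R: "0 < R"
  shows "(\<Sum>k\<in>{- int K..int K}. exp (- \<bar>real_of_int k\<bar> / R)) \<le> 2 * (R + 1)"
proof -
  define x where "x = exp (- 1 / R)"
  have x: "0 < x" "x < 1" using R by (auto simp: x_def)
  have "1 + 1 / R \<le> exp (1 / R)" by (rule exp_ge_add_one_self)
  then have "x * (1 + 1 / R) \<le> x * exp (1 / R)" using x by (intro mult_left_mono) auto
  also have "x * exp (1 / R) = 1" by (simp add: x_def exp_add[symmetric])
  finally have "x * (R + 1) \<le> R" using R by (simp add: field_simps)
  then have "1 \<le> (R + 1) * (1 - x)" by (simp add: algebra_simps)
  then have inv: "1 / (1 - x) \<le> R + 1" using x by (simp add: pos_divide_le_eq)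
  have pw: "exp (- (real k / R)) = x ^ k" for k
    unfolding x_def by (simp add: exp_of_nat_mult[symmetric])
  have half: "(\<Sum>k\<le>K. x ^ k) \<le> R + 1"
  proof -
    have "(\<Sum>k\<le>K. x ^ k) \<le> (\<Sum>k. x ^ k)"
      using x by (intro sum_le_suminf summable_geometric) auto
    also have "\<dots> = 1 / (1 - x)" using x by (intro suminf_geometric) auto
    finally show ?thesis using inv by simp
  qed
  let ?f = "\<lambda>k::int. exp (- \<bar>real_of_int k\<bar> / R)"
  have "{- int K..int K} = int ` {..K} \<union> (\<lambda>k. - int k) ` {..K}"
  proof (intro equalityI subsetI)
    fix k assume k: "k \<in> {- int K..int K}"
    show "k \<in> int ` {..K} \<union> (\<lambda>k. - int k) ` {..K}"
    proof (cases "0 \<le> k")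
      case True
      then have "k = int (nat k)" "nat k \<le> K" using k by auto
      then show ?thesis by blast
    next
      case False
      then have "k = - int (nat (- k))" "nat (- k) \<le> K" using k by auto
      then show ?thesis by blast
    qed
  qed auto
  then have "sum ?f {- int K..int K} = sum ?f (int ` {..K} \<union> (\<lambda>k. - int k) ` {..K})" by simp
  also have "\<dots> \<le> sum ?f (int ` {..K}) + sum ?f ((\<lambda>k. - int k) ` {..K})"
    by (subst sum.union_inter[symmetric]) (auto intro!: sum_nonneg)
  also have "sum ?f (int ` {..K}) = (\<Sum>k\<le>K. x ^ k)"
    by (subst sum.reindex) (auto simp: pw)
  also have "sum ?f ((\<lambda>k. - int k) ` {..K}) = (\<Sum>k\<le>K. x ^ k)"
    by (subst sum.reindex) (auto simp: inj_on_def pw)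
  finally show ?thesis using half by simp
qed

text \<open>
  The number of integer points in an \<open>\<ell>\<^sup>1\<close> ball of radius \<open>R d\<close> in dimension \<open>d\<close> grows only like
  \<open>(C R)\<^sup>d\<close>: each such point has \<open>exp (- |z| / R) \<ge> exp (- d)\<close>, and the sum of \<open>exp (- |z| / R)\<close> over the
  whole lattice factorizes into \<open>d\<close> geometric series. This replaces the usual volume comparison.
\<close>

lemma card_int_vectors_le:
  fixes W :: "'i set" and R :: real
  assumes W: "finite W" "card W \<le> d" and R: "0 < R"
  defines "Z \<equiv> {z \<in> PiE W (\<lambda>_. UNIV). (\<Sum>i\<in>W. \<bar>real_of_int (z i)\<bar>) \<le> R * real d}"
  shows "finite Z" and "real (card Z) \<le> (2 * exp 1 * (R + 1)) ^ d"
proof -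
  define K where "K = nat \<lceil>R * real d\<rceil>"
  define Y where "Y = PiE W (\<lambda>_. {- int K..int K})"
  have fY: "finite Y" unfolding Y_def using W by (intro finite_PiE) auto
  have ZY: "Z \<subseteq> Y"
  proof
    fix z assume z: "z \<in> Z"
    have "z i \<in> {- int K..int K}" if i: "i \<in> W" for i
    proof -
      have "\<bar>real_of_int (z i)\<bar> \<le> (\<Sum>i\<in>W. \<bar>real_of_int (z i)\<bar>)"
        using W i by (intro member_le_sum) auto
      also have "\<dots> \<le> R * real d" using z by (simp add: Z_def)
      also have "\<dots> \<le> real K" unfolding K_def by (rule real_nat_ceiling_ge)
      finally show ?thesis by (auto simp: abs_le_iff)
    qed
    then show "z \<in> Y" using z unfolding Y_def Z_def by (auto simp: PiE_iff)
  qed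
  show "finite Z" using ZY fY by (rule finite_subset)
  have ge1: "1 \<le> 2 * (R + 1)" using R by simp
  have "real (card Z) * exp (- real d) = (\<Sum>z\<in>Z. exp (- real d))" by simp
  also have "\<dots> \<le> (\<Sum>z\<in>Z. \<Prod>i\<in>W. exp (- \<bar>real_of_int (z i)\<bar> / R))"
  proof (rule sum_mono)
    fix z assume "z \<in> Z"
    then have "(\<Sum>i\<in>W. \<bar>real_of_int (z i)\<bar>) / R \<le> real d"
      using R by (simp add: Z_def field_simps)
    then have "exp (- real d) \<le> exp (- ((\<Sum>i\<in>W. \<bar>real_of_int (z i)\<bar>) / R))" by simp
    also have "\<dots> = (\<Prod>i\<in>W. exp (- \<bar>real_of_int (z i)\<bar> / R))"
      using W(1) by (simp add: exp_sum[symmetric] sum_divide_distrib sum_negf)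
    finally show "exp (- real d) \<le> (\<Prod>i\<in>W. exp (- \<bar>real_of_int (z i)\<bar> / R))" .
  qed
  also have "\<dots> \<le> (\<Sum>z\<in>Y. \<Prod>i\<in>W. exp (- \<bar>real_of_int (z i)\<bar> / R))"
    using fY ZY by (intro sum_mono2) (auto intro!: prod_nonneg)
  also have "\<dots> = (\<Prod>i\<in>W. \<Sum>k\<in>{- int K..int K}. exp (- \<bar>real_of_int k\<bar> / R))"
    unfolding Y_def using W by (subst prod_sum_PiE) auto
  also have "\<dots> \<le> (\<Prod>i\<in>W. 2 * (R + 1))"
    by (intro prod_mono conjI sum_nonneg sum_exp_abs_int_le R) auto
  also have "\<dots> = (2 * (R + 1)) ^ card W" by simp
  also have "\<dots> \<le> (2 * (R + 1)) ^ d" using ge1 W(2) by (intro power_increasing) auto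
  finally have "real (card Z) \<le> (2 * (R + 1)) ^ d * exp (real d)"
    by (simp add: exp_minus field_simps)
  also have "exp (real d) = exp 1 ^ d" by (simp add: exp_of_nat_mult[symmetric])
  finally show "real (card Z) \<le> (2 * exp 1 * (R + 1)) ^ d"
    by (simp add: power_mult_distrib mult_ac)
qed

lemma L2_set_sum_abs_le:
  "finite W \<Longrightarrow> (\<Sum>i\<in>W. \<bar>f i\<bar>) \<le> sqrt (real (card W)) * L2_set f W"
  using L2_set_mult_ineq[of "\<lambda>_. 1" f W] by (simp add: L2_set_def)

definition supported :: "'i set set \<Rightarrow> ('i \<Rightarrow> real) set" where
  "supported V = {u. \<exists>W\<in>V. \<forall>i. i \<notin> W \<longrightarrow> u i = 0}"

text \<open>
  Rounding every coordinate down to a multiple of \<open>\<eta> / \<surd>d\<close> moves a vector by at most \<open>\<eta>\<close>. By the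
  Cauchy--Schwarz inequality a Euclidean ball of radius \<open>b + \<eta>\<close> becomes, in lattice units, part of an
  \<open>\<ell>\<^sup>1\<close> ball of radius \<open>(b / \<eta> + 1) d\<close>, so there are at most \<open>(C (b / \<eta> + 2))\<^sup>d\<close> roundings.
\<close>

lemma net_single:
  fixes W :: "'i set" and \<eta> b :: real
  assumes W: "finite W" "card W \<le> d" and d: "1 \<le> d" and eta: "0 < \<eta>" and b: "0 \<le> b"
  shows "\<exists>T. finite T \<and> real (card T) \<le> (2 * exp 1 * (b / \<eta> + 2)) ^ d \<and>
    (\<forall>u. (\<forall>i. i \<notin> W \<longrightarrow> u i = 0) \<longrightarrow> L2_set u W \<le> b \<longrightarrow>
      (\<exists>a\<in>T. (\<forall>i. i \<notin> W \<longrightarrow> a i = 0) \<and> L2_set (\<lambda>i. u i - a i) W \<le> \<eta>))"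
proof -
  define s where "s = \<eta> / sqrt (real d)"
  have s: "0 < s" using eta d by (simp add: s_def)
  define R where "R = b / \<eta> + 1"
  have R: "0 < R" using b eta by (simp add: R_def add_nonneg_pos)
  define Z where "Z = {z \<in> PiE W (\<lambda>_. UNIV). (\<Sum>i\<in>W. \<bar>real_of_int (z i)\<bar>) \<le> R * real d}"
  define T where "T = (\<lambda>z i. if i \<in> W then s * real_of_int (z i) else 0) ` Z"
  have Z: "finite Z" "real (card Z) \<le> (2 * exp 1 * (R + 1)) ^ d"
    unfolding Z_def by (rule card_int_vectors_le[OF W R])+
  have "card T \<le> card Z" unfolding T_def by (rule card_image_le[OF Z(1)])
  then have "real (card T) \<le> (2 * exp 1 * (b / \<eta> + 2)) ^ d"
    using Z(2) by (simp add: R_def add.assoc)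
  moreover have "\<exists>a\<in>T. (\<forall>i. i \<notin> W \<longrightarrow> a i = 0) \<and> L2_set (\<lambda>i. u i - a i) W \<le> \<eta>"
    if u: "\<forall>i. i \<notin> W \<longrightarrow> u i = 0" "L2_set u W \<le> b" for u
  proof -
    define z where "z = (\<lambda>i\<in>W. \<lfloor>u i / s\<rfloor>)"
    define a where "a = (\<lambda>i. if i \<in> W then s * real_of_int (z i) else 0)"
    have near: "\<bar>u i - a i\<bar> \<le> s" if "i \<in> W" for i
    proof -
      have "u i - a i = s * (u i / s - real_of_int \<lfloor>u i / s\<rfloor>)"
        using that s by (simp add: a_def z_def field_simps)
      also have "\<bar>\<dots>\<bar> \<le> s * 1"
        unfolding abs_mult using s by (intro mult_mono) linarith+
      finally show ?thesis by simp
    qed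
    have diff: "L2_set (\<lambda>i. u i - a i) W \<le> \<eta>"
    proof -
      have "L2_set (\<lambda>i. u i - a i) W = L2_set (\<lambda>i. \<bar>u i - a i\<bar>) W" by (simp add: L2_set_def)
      also have "\<dots> \<le> L2_set (\<lambda>i. s) W" using near by (intro L2_set_mono) auto
      also have "\<dots> = sqrt (real (card W)) * s" using s by (simp add: L2_set_def real_sqrt_mult)
      also have "\<dots> \<le> sqrt (real d) * s" using s W(2) by (intro mult_right_mono) auto
      also have "\<dots> = \<eta>" using d by (simp add: s_def)
      finally show ?thesis .
    qed
    have "L2_set a W = L2_set (\<lambda>i. u i + (- (u i - a i))) W" by simp
    also have "\<dots> \<le> L2_set u W + L2_set (\<lambda>i. - (u i - a i)) W" by (rule L2_set_triangle_ineq)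
    also have "L2_set (\<lambda>i. - (u i - a i)) W = L2_set (\<lambda>i. u i - a i) W"
      by (simp add: L2_set_def power2_commute)
    finally have aW: "L2_set a W \<le> b + \<eta>" using u(2) diff by linarith
    have "s * (\<Sum>i\<in>W. \<bar>real_of_int (z i)\<bar>) = (\<Sum>i\<in>W. \<bar>a i\<bar>)"
      unfolding sum_distrib_left using s by (intro sum.cong) (auto simp: a_def abs_mult)
    also have "\<dots> \<le> sqrt (real (card W)) * L2_set a W" by (rule L2_set_sum_abs_le[OF W(1)])
    also have "\<dots> \<le> sqrt (real d) * (b + \<eta>)"
      using aW W(2) b eta by (intro mult_mono) (auto simp: L2_set_nonneg)
    finally have "(\<Sum>i\<in>W. \<bar>real_of_int (z i)\<bar>) \<le> sqrt (real d) * (b + \<eta>) / s"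
      using s by (simp add: field_simps)
    also have "\<dots> = (sqrt (real d) * sqrt (real d)) * ((b + \<eta>) / \<eta>)" by (simp add: s_def)
    also have "\<dots> = R * real d" using eta by (simp add: R_def field_simps)
    finally have "z \<in> Z" by (simp add: Z_def z_def)
    then have "a \<in> T" unfolding T_def a_def by blast
    moreover have "\<forall>i. i \<notin> W \<longrightarrow> a i = 0" by (simp add: a_def)
    ultimately show ?thesis using diff by blast
  qed
  moreover have "finite T" using Z by (simp add: T_def)
  ultimately show ?thesis by (intro exI[of _ T] conjI allI impI)
qed

text \<open>
  A vector and its net point have a common supporting set, so that the difference is again a sparse
  direction; the uniform second moment bound is applied to that difference.
\<close>

definition supported_net ::
    "'i set set \<Rightarrow> 'i set \<Rightarrow> real \<Rightarrow> real \<Rightarrow> ('i \<Rightarrow> real) set \<Rightarrow> bool" where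
  "supported_net V I b \<eta> T \<longleftrightarrow> finite T \<and> (\<forall>u\<in>supported V. L2_set u I \<le> b \<longrightarrow>
    (\<exists>a\<in>T. (\<lambda>i. u i - a i) \<in> supported V \<and> L2_set (\<lambda>i. u i - a i) I \<le> \<eta>))"

lemma net_family:
  fixes V :: "'i set set" and \<eta> b :: real
  assumes I: "finite I" and V: "finite V" "\<And>W. W \<in> V \<Longrightarrow> W \<subseteq> I" "\<And>W. W \<in> V \<Longrightarrow> card W \<le> d"
    and d: "1 \<le> d" and eta: "0 < \<eta>" and b: "0 \<le> b"
  shows "\<exists>T. supported_net V I b \<eta> T \<and> real (card T) \<le> real (card V) * (2 * exp 1 * (b / \<eta> + 2)) ^ d"
proof -
  have L2: "L2_set u I = L2_set u W" if "W \<in> V" "\<forall>i. i \<notin> W \<longrightarrow> u i = 0" for u W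
    unfolding L2_set_def using V(2)[OF that(1)] that(2) I
    by (intro arg_cong[where f = sqrt] sum.mono_neutral_right) auto
  have "\<forall>W\<in>V. \<exists>T. finite T \<and> real (card T) \<le> (2 * exp 1 * (b / \<eta> + 2)) ^ d \<and>
    (\<forall>u. (\<forall>i. i \<notin> W \<longrightarrow> u i = 0) \<longrightarrow> L2_set u W \<le> b \<longrightarrow>
      (\<exists>a\<in>T. (\<forall>i. i \<notin> W \<longrightarrow> a i = 0) \<and> L2_set (\<lambda>i. u i - a i) W \<le> \<eta>))"
    using V I d eta b by (intro ballI net_single) (auto intro: finite_subset)
  then obtain T where T': "\<forall>W\<in>V. finite (T W) \<and> real (card (T W)) \<le> (2 * exp 1 * (b / \<eta> + 2)) ^ d \<and>
    (\<forall>u. (\<forall>i. i \<notin> W \<longrightarrow> u i = 0) \<longrightarrow> L2_set u W \<le> b \<longrightarrow>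
      (\<exists>a\<in>T W. (\<forall>i. i \<notin> W \<longrightarrow> a i = 0) \<and> L2_set (\<lambda>i. u i - a i) W \<le> \<eta>))"
    by (rule bchoice[THEN exE])
  have T: "\<And>W. W \<in> V \<Longrightarrow> finite (T W)"
    "\<And>W. W \<in> V \<Longrightarrow> real (card (T W)) \<le> (2 * exp 1 * (b / \<eta> + 2)) ^ d"
    "\<And>W u. W \<in> V \<Longrightarrow> \<forall>i. i \<notin> W \<longrightarrow> u i = 0 \<Longrightarrow> L2_set u W \<le> b \<Longrightarrow>
      \<exists>a\<in>T W. (\<forall>i. i \<notin> W \<longrightarrow> a i = 0) \<and> L2_set (\<lambda>i. u i - a i) W \<le> \<eta>"
    by (rule bspec[OF T', THEN conjunct1], assumption,
      rule bspec[OF T', THEN conjunct2, THEN conjunct1], assumption,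
      rule bspec[OF T', THEN conjunct2, THEN conjunct2, rule_format], assumption, blast, assumption)
  have "real (card (\<Union>W\<in>V. T W)) \<le> real (\<Sum>W\<in>V. card (T W))"
    using card_UN_le[OF V(1), of T] by linarith
  also have "\<dots> \<le> (\<Sum>W\<in>V. (2 * exp 1 * (b / \<eta> + 2)) ^ d)"
    unfolding of_nat_sum by (intro sum_mono T)
  finally have "real (card (\<Union>W\<in>V. T W)) \<le> real (card V) * (2 * exp 1 * (b / \<eta> + 2)) ^ d" by simp
  moreover have "\<exists>a\<in>(\<Union>W\<in>V. T W). (\<lambda>i. u i - a i) \<in> supported V \<and> L2_set (\<lambda>i. u i - a i) I \<le> \<eta>"
    if u: "u \<in> supported V" "L2_set u I \<le> b" for u
  proof -
    obtain W where W: "W \<in> V" "\<forall>i. i \<notin> W \<longrightarrow> u i = 0" using u(1) by (auto simp: supported_def)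
    then obtain a where a: "a \<in> T W" "\<forall>i. i \<notin> W \<longrightarrow> a i = 0" "L2_set (\<lambda>i. u i - a i) W \<le> \<eta>"
      using T(3)[OF W] L2[OF W] u(2) by auto
    have "(\<lambda>i. u i - a i) \<in> supported V"
      unfolding supported_def using W a(2) by (intro CollectI bexI[of _ W]) auto
    moreover have "L2_set (\<lambda>i. u i - a i) I \<le> \<eta>"
      using a W L2[OF W(1), of "\<lambda>i. u i - a i"] by simp
    ultimately show ?thesis using a(1) W(1) by blast
  qed
  moreover have "finite (\<Union>W\<in>V. T W)" using V(1) T(1) by blast
  ultimately show ?thesis unfolding supported_net_def by (intro exI[of _ "\<Union>W\<in>V. T W"] conjI ballI impI)
qed

section \<open>Weighted projections and their second moments\<close>

text \<open>
  The data that the empirical process argument uses: a weight \<open>w\<close> that makes the linear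
  functionals of the observation sub-Gaussian at scale \<open>\<surd>\<Lambda>\<close> (\<open>expo\<close>), a family \<open>V\<close> of
  coordinate sets of size at most \<open>d\<close>, and a set \<open>D\<close> of \<open>V\<close>-sparse directions along which the weighted
  law has no concentration in thin slabs (\<open>slab\<close>). The number \<open>L\<close> bounds the entropy \<open>ln |V| + d\<close>
  and is also the exponent of the failure probabilities.
\<close>

locale weighted_projections = prob_space M for M :: "'a measure" +
  fixes w :: "'a \<Rightarrow> real" and X :: "nat \<Rightarrow> 'a \<Rightarrow> real" and I :: "nat set"
    and V :: "nat set set" and d :: nat and \<Lambda> b L :: real and D :: "(nat \<Rightarrow> real) set"
  assumes w_meas [measurable]: "w \<in> borel_measurable M"
    and w0: "\<And>x. x \<in> space M \<Longrightarrow> 0 \<le> w x" and w1: "\<And>x. x \<in> space M \<Longrightarrow> w x \<le> 1"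
    and X_meas [measurable]: "\<And>i. i \<in> I \<Longrightarrow> X i \<in> borel_measurable M"
    and I: "finite I"
    and V: "finite V" "\<And>W. W \<in> V \<Longrightarrow> W \<subseteq> I" "\<And>W. W \<in> V \<Longrightarrow> card W \<le> d"
    and V_ne: "V \<noteq> {}" and d: "1 \<le> d"
    and \<Lambda>: "0 < \<Lambda>" and b: "0 \<le> b"
    and L: "ln (real (card V)) + real d \<le> L"
    and expo: "\<And>a. L2_set a I \<le> 1 \<Longrightarrow>
      (\<integral>\<^sup>+x. ennreal (exp (w x * (\<Sum>i\<in>I. a i * X i x)\<^sup>2 / (4 * \<Lambda>))) \<partial>M) \<le> ennreal (exp (1/2))"
    and D: "D \<subseteq> supported V" "\<And>u. u \<in> D \<Longrightarrow> L2_set u I \<le> b"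
    and slab: "\<And>u c t. u \<in> D \<Longrightarrow> 0 \<le> t \<Longrightarrow>
      expectation (\<lambda>x. w x * of_bool (\<bar>\<bar>\<Sum>i\<in>I. u i * X i x\<bar> - c\<bar> \<le> t)) \<le> 2 * t"
begin

definition lin :: "(nat \<Rightarrow> real) \<Rightarrow> 'a \<Rightarrow> real" where
  "lin a x = (\<Sum>i\<in>I. a i * X i x)"

definition below :: "(nat \<Rightarrow> real) \<Rightarrow> real \<Rightarrow> 'a \<Rightarrow> real" where
  "below a c x = w x * of_bool (\<bar>lin a x\<bar> \<le> c)"

lemma lin_meas [measurable]: "lin a \<in> borel_measurable M"
  unfolding lin_def by (intro borel_measurable_sum) measurable

lemma below_meas [measurable]: "below a c \<in> borel_measurable M"
  unfolding below_def by measurable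

lemma below_bounds: "x \<in> space M \<Longrightarrow> 0 \<le> below a c x" "x \<in> space M \<Longrightarrow> below a c x \<le> 1"
  using w0 w1 by (auto simp: below_def)

lemma integrable_bounded:
  "f \<in> borel_measurable M \<Longrightarrow> (\<And>x. x \<in> space M \<Longrightarrow> \<bar>f x\<bar> \<le> K) \<Longrightarrow> integrable M f" for f :: "'a \<Rightarrow> real"
  by (rule integrable_const_bound[of _ K]) auto

lemma below_integrable: "integrable M (below a c)"
  by (rule integrable_bounded[of _ 1]) (use below_bounds in \<open>auto simp: abs_le_iff intro: order_trans\<close>)

lemma lin_diff: "lin (\<lambda>i. u i - a i) x = lin u x - lin a x"
  by (simp add: lin_def sum_subtractf left_diff_distrib)

lemma supported_scale:
  assumes "u \<in> supported V" shows "(\<lambda>i. r * u i) \<in> supported V"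
proof -
  obtain W where "W \<in> V" "\<forall>i. i \<notin> W \<longrightarrow> u i = 0" using assms by (auto simp: supported_def)
  then show ?thesis unfolding supported_def by (intro CollectI bexI[of _ W]) auto
qed

lemma L_ge_1: "1 \<le> L"
proof -
  have "1 \<le> card V" using V(1) V_ne by (simp add: Suc_le_eq card_gt_0_iff)
  then have "0 \<le> ln (real (card V))" by simp
  then show ?thesis using L d by linarith
qed

lemma card_net_le:
  assumes "1 \<le> \<kappa>" "0 \<le> y" "y \<le> exp \<kappa>"
  shows "real (card V) * y ^ d \<le> exp (\<kappa> * L)"
proof -
  have c: "1 \<le> real (card V)" using V(1) V_ne by (simp add: Suc_le_eq card_gt_0_iff)
  have "real (card V) = exp (1 * ln (real (card V)))" using c by simp
  also have "\<dots> \<le> exp (\<kappa> * ln (real (card V)))"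
    using assms(1) c by (subst exp_le_cancel_iff, intro mult_right_mono) auto
  finally have 1: "real (card V) \<le> exp (\<kappa> * ln (real (card V)))" .
  have "y ^ d \<le> exp \<kappa> ^ d" using assms by (intro power_mono) auto
  also have "\<dots> = exp (\<kappa> * real d)" by (simp add: exp_of_nat_mult[symmetric] mult.commute)
  finally have "real (card V) * y ^ d \<le> exp (\<kappa> * ln (real (card V))) * exp (\<kappa> * real d)"
    using 1 assms by (intro mult_mono) auto
  also have "\<dots> = exp (\<kappa> * (ln (real (card V)) + real d))"
    by (simp add: exp_add[symmetric] distrib_left)
  also have "\<dots> \<le> exp (\<kappa> * L)" using L assms(1) by (subst exp_le_cancel_iff, intro mult_left_mono) auto
  finally show ?thesis .
qed

text \<open>
  From \<open>1 + t \<le> exp t\<close> and \<open>exp (1/2) \<le> 2\<close>, after normalizing \<open>a\<close>.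
\<close>

lemma second_moment:
  "integrable M (\<lambda>x. w x * (lin a x)\<^sup>2)"
  "expectation (\<lambda>x. w x * (lin a x)\<^sup>2) \<le> 4 * \<Lambda> * (L2_set a I)\<^sup>2"
proof -
  define r where "r = L2_set a I"
  have r0: "0 \<le> r" by (simp add: r_def L2_set_nonneg)
  have "(\<integral>\<^sup>+x. ennreal (w x * (lin a x)\<^sup>2) \<partial>M) \<le> ennreal (4 * \<Lambda> * r\<^sup>2)"
  proof (cases "r = 0")
    case True
    then have "\<forall>i\<in>I. a i = 0" using I by (simp add: r_def L2_set_def sum_nonneg_eq_0_iff sum_nonneg)
    then have "lin a x = 0" for x by (simp add: lin_def)
    then show ?thesis by simp
  next
    case False
    then have r: "0 < r" using r0 by simp
    have "L2_set (\<lambda>i. (1 / r) * a i) I = 1"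
      using r by (subst L2_set_right_distrib[symmetric]) (auto simp: r_def)
    then have e: "(\<integral>\<^sup>+x. ennreal (exp (w x * (\<Sum>i\<in>I. (1 / r) * a i * X i x)\<^sup>2 / (4 * \<Lambda>))) \<partial>M) \<le> ennreal (exp (1/2))"
      by (intro expo) simp
    have s: "(\<Sum>i\<in>I. (1 / r) * a i * X i x) = lin a x / r" for x
      by (simp add: lin_def sum_divide_distrib)
    define K where "K = 1 / (4 * \<Lambda> * r\<^sup>2)"
    have K: "0 < K" using r \<Lambda> by (simp add: K_def)
    have "exp (1/2 :: real) \<le> 2"
      using exp_bound[of "1/2::real"] by (simp add: power2_eq_square)
    have "(\<integral>\<^sup>+x. ennreal (1 + K * (w x * (lin a x)\<^sup>2)) \<partial>M) \<le>
        (\<integral>\<^sup>+x. ennreal (exp (w x * (\<Sum>i\<in>I. (1 / r) * a i * X i x)\<^sup>2 / (4 * \<Lambda>))) \<partial>M)"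
    proof (intro nn_integral_mono ennreal_leI)
      fix x
      have "K * (w x * (lin a x)\<^sup>2) = w x * (\<Sum>i\<in>I. (1 / r) * a i * X i x)\<^sup>2 / (4 * \<Lambda>)"
        unfolding s by (simp add: K_def power_divide)
      then show "1 + K * (w x * (lin a x)\<^sup>2) \<le> exp (w x * (\<Sum>i\<in>I. (1 / r) * a i * X i x)\<^sup>2 / (4 * \<Lambda>))"
        using exp_ge_add_one_self by simp
    qed
    also have "\<dots> \<le> ennreal 2" using e \<open>exp (1/2) \<le> 2\<close> by (meson ennreal_leI order_trans)
    finally have "(\<integral>\<^sup>+x. ennreal (1 + K * (w x * (lin a x)\<^sup>2)) \<partial>M) \<le> ennreal 2" .
    also have "(\<integral>\<^sup>+x. ennreal (1 + K * (w x * (lin a x)\<^sup>2)) \<partial>M) =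
        (\<integral>\<^sup>+x. 1 + ennreal K * ennreal (w x * (lin a x)\<^sup>2) \<partial>M)"
      using K w0 by (intro nn_integral_cong) (simp add: ennreal_mult)
    also have "\<dots> = 1 + ennreal K * (\<integral>\<^sup>+x. ennreal (w x * (lin a x)\<^sup>2) \<partial>M)"
      by (simp add: nn_integral_add nn_integral_cmult emeasure_space_1)
    finally have *: "1 + ennreal K * (\<integral>\<^sup>+x. ennreal (w x * (lin a x)\<^sup>2) \<partial>M) \<le> 1 + 1" by simp
    then have "ennreal K * (\<integral>\<^sup>+x. ennreal (w x * (lin a x)\<^sup>2) \<partial>M) \<le> 1"
      by (subst (asm) ennreal_add_left_cancel_le) auto
    then have "ennreal (1 / K) * (ennreal K * (\<integral>\<^sup>+x. ennreal (w x * (lin a x)\<^sup>2) \<partial>M)) \<le> ennreal (1 / K) * 1"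
      by (intro mult_left_mono) auto
    then show ?thesis using K r \<Lambda> by (simp add: mult.assoc[symmetric] ennreal_mult[symmetric] K_def)
  qed
  then have *: "(\<integral>\<^sup>+x. ennreal (w x * (lin a x)\<^sup>2) \<partial>M) \<le> ennreal (4 * \<Lambda> * r\<^sup>2)" .
  show i: "integrable M (\<lambda>x. w x * (lin a x)\<^sup>2)"
    using * w0 by (intro integrableI_nonneg) (auto simp: top_unique less_top intro: le_less_trans)
  have "ennreal (expectation (\<lambda>x. w x * (lin a x)\<^sup>2)) = (\<integral>\<^sup>+x. ennreal (w x * (lin a x)\<^sup>2) \<partial>M)"
    using w0 by (intro nn_integral_eq_integral[symmetric] i) auto
  then show "expectation (\<lambda>x. w x * (lin a x)\<^sup>2) \<le> 4 * \<Lambda> * (L2_set a I)\<^sup>2"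
    using * \<Lambda> unfolding r_def by (subst ennreal_le_iff[symmetric]) auto
qed

lemma weighted_exceedance_le:
  assumes "0 < t" "x \<in> space M"
  shows "w x * of_bool (t < \<bar>lin a x\<bar>) \<le> w x * (lin a x)\<^sup>2 / t\<^sup>2"
proof (cases "t < \<bar>lin a x\<bar>")
  case True
  then have "t\<^sup>2 \<le> (lin a x)\<^sup>2" using assms(1) by (intro abs_le_square_iff[THEN iffD1]) auto
  then have "w x * 1 \<le> w x * ((lin a x)\<^sup>2 / t\<^sup>2)"
    using assms w0[of x] by (intro mult_left_mono) (auto simp: field_simps)
  then show ?thesis using True by simp
next
  case False
  then show ?thesis using assms w0[of x] by simp
qed

text \<open>
  If exactly one of \<open>|lin u| \<le> c\<close> and \<open>|lin a| \<le> c\<close> holds, then \<open>|lin u|\<close> is within \<open>t\<close> of \<open>c\<close> or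
  \<open>|lin (u - a)|\<close> exceeds \<open>t\<close>. Only \<open>u\<close> has to satisfy the slab condition, so net points need no
  normalization.
\<close>

lemma below_close:
  assumes u: "u \<in> D" and t: "0 < t" and eta: "L2_set (\<lambda>i. u i - a i) I \<le> \<eta>"
  shows "expectation (\<lambda>x. \<bar>below u c x - below a c x\<bar>) \<le> 2 * t + 4 * \<Lambda> * \<eta>\<^sup>2 / t\<^sup>2"
proof -
  let ?g = "\<lambda>x. w x * of_bool (\<bar>\<bar>lin u x\<bar> - c\<bar> \<le> t)"
  let ?h = "\<lambda>x. w x * (lin (\<lambda>i. u i - a i) x)\<^sup>2"
  have g: "integrable M ?g"
    by (rule integrable_bounded[of _ 1]) (use w0 w1 in auto)
  have "expectation (\<lambda>x. \<bar>below u c x - below a c x\<bar>) \<le> expectation (\<lambda>x. ?g x + ?h x / t\<^sup>2)"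
  proof (rule integral_mono)
    fix x assume x: "x \<in> space M"
    have "\<bar>below u c x - below a c x\<bar> = w x * \<bar>of_bool (\<bar>lin u x\<bar> \<le> c) - of_bool (\<bar>lin a x\<bar> \<le> c)\<bar>"
      using w0[OF x] by (simp add: below_def right_diff_distrib[symmetric] abs_mult)
    also have "\<dots> \<le> w x * (of_bool (\<bar>\<bar>lin u x\<bar> - c\<bar> \<le> t) + of_bool (t < \<bar>lin (\<lambda>i. u i - a i) x\<bar>))"
      using w0[OF x] by (intro mult_left_mono) (auto simp: lin_diff)
    also have "\<dots> \<le> ?g x + ?h x / t\<^sup>2"
      using weighted_exceedance_le[OF t x, of "\<lambda>i. u i - a i"] by (simp only: distrib_left)
    finally show "\<bar>below u c x - below a c x\<bar> \<le> ?g x + ?h x / t\<^sup>2" .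
  qed (use below_integrable g second_moment(1) in auto)
  also have "\<dots> = expectation ?g + expectation ?h / t\<^sup>2"
    using g second_moment(1)[of "\<lambda>i. u i - a i"] by simp
  also have "\<dots> \<le> 2 * t + 4 * \<Lambda> * \<eta>\<^sup>2 / t\<^sup>2"
  proof (intro add_mono divide_right_mono)
    show "expectation ?g \<le> 2 * t" unfolding lin_def using slab[OF u, of t c] t by simp
    have "4 * \<Lambda> * (L2_set (\<lambda>i. u i - a i) I)\<^sup>2 \<le> 4 * \<Lambda> * \<eta>\<^sup>2"
      using eta \<Lambda> by (intro mult_left_mono power_mono) (auto simp: L2_set_nonneg)
    then show "expectation ?h \<le> 4 * \<Lambda> * \<eta>\<^sup>2"
      using second_moment(2)[of "\<lambda>i. u i - a i"] by linarith
  qed simp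
  finally show ?thesis .
qed

lemma below_shift:
  assumes u: "u \<in> D"
  shows "\<bar>expectation (below u c') - expectation (below u c)\<bar> \<le> \<bar>c' - c\<bar>"
proof -
  let ?g = "\<lambda>x. w x * of_bool (\<bar>\<bar>lin u x\<bar> - (c + c') / 2\<bar> \<le> \<bar>c' - c\<bar> / 2)"
  have g: "integrable M ?g"
    by (rule integrable_bounded[of _ 1]) (use w0 w1 in auto)
  have "\<bar>expectation (below u c') - expectation (below u c)\<bar> = \<bar>expectation (\<lambda>x. below u c' x - below u c x)\<bar>"
    using below_integrable by simp
  also have "\<dots> \<le> expectation (\<lambda>x. \<bar>below u c' x - below u c x\<bar>)" by (rule integral_abs_bound)
  also have "\<dots> \<le> expectation ?g"
  proof (rule integral_mono)
    fix x assume x: "x \<in> space M"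
    have "\<bar>below u c' x - below u c x\<bar> = w x * \<bar>of_bool (\<bar>lin u x\<bar> \<le> c') - of_bool (\<bar>lin u x\<bar> \<le> c)\<bar>"
      using w0[OF x] by (simp add: below_def right_diff_distrib[symmetric] abs_mult)
    also have "\<dots> \<le> ?g x"
      using w0[OF x] by (intro mult_left_mono) (auto simp: of_bool_def, (simp add: abs_if field_simps split: if_splits)+)
    finally show "\<bar>below u c' x - below u c x\<bar> \<le> ?g x" .
  qed (use below_integrable g in auto)
  also have "\<dots> \<le> 2 * (\<bar>c' - c\<bar> / 2)" unfolding lin_def by (rule slab[OF u]) simp
  finally show ?thesis by simp
qed

text \<open>
  The empirical second moment is the square of a seminorm \<open>N\<close>. With high probability \<open>N\<close> is bounded on
  a net of radius \<open>1/2\<close>, and its supremum \<open>s\<close> over the unit ball then satisfies \<open>s \<le> Q + s / 2\<close>.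
\<close>

lemma whp_uniform_second_moment:
  assumes n: "0 < n" "L \<le> real n"
  shows "whp (PiM {..<n} (\<lambda>_. M)) (exp (- L)) (\<lambda>x. \<forall>a\<in>supported V.
    (\<Sum>i<n. w (x i) * (lin a (x i))\<^sup>2) / real n \<le> 200 * \<Lambda> * (L2_set a I)\<^sup>2)"
proof -
  have "\<exists>T. supported_net V I 1 (1/2) T \<and> real (card T) \<le> real (card V) * (2 * exp 1 * (1 / (1/2) + 2)) ^ d"
    by (intro net_family I V d) auto
  then obtain T where T: "supported_net V I 1 (1/2) T"
    "real (card T) \<le> real (card V) * (2 * exp 1 * (1 / (1/2) + 2)) ^ d"
    by blast
  have fT: "finite T" using T(1) by (simp add: supported_net_def)
  have Tnet: "\<exists>a\<in>T. (\<lambda>i. u i - a i) \<in> supported V \<and> L2_set (\<lambda>i. u i - a i) I \<le> 1/2"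
    if "u \<in> supported V" "L2_set u I \<le> 1" for u
    using T(1) that unfolding supported_net_def by blast
  have "real (card V) * (2 * exp 1 * (1 / (1/2) + 2)) ^ d \<le> exp (4 * L)"
  proof (rule card_net_le)
    have "2 \<le> exp (1::real)" using exp_ge_add_one_self[of 1] by simp
    then have "2 ^ 3 \<le> exp (1::real) ^ 3" by (intro power_mono) auto
    then have "(8::real) * exp 1 \<le> exp 1 ^ 3 * exp 1" by (intro mult_right_mono) auto
    also have "\<dots> = exp (4::real)" by (simp add: exp_of_nat_mult[symmetric] exp_add[symmetric])
    finally show "2 * exp 1 * (1 / (1/2) + 2) \<le> exp (4::real)" by simp
  qed auto
  then have cT: "real (card T) \<le> exp (4 * L)" using T(2) by linarith
  let ?P = "PiM {..<n} (\<lambda>_. M)"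
  interpret PP: product_prob_space "\<lambda>_::nat. M" "{..<n}" by unfold_locales
  \<comment> \<open>Net points within 1/2 of the unit ball; their dilation by 2/3 lies in the unit ball.\<close>
  define T' where "T' = {a \<in> T. L2_set a I \<le> 3/2}"
  have T': "finite T'" "card T' \<le> card T" using fT by (auto simp: T'_def intro: card_mono)
  have one: "whp ?P (exp (- (5 * L))) (\<lambda>x. (\<Sum>i<n. w (x i) * (lin a (x i))\<^sup>2) / real n \<le> 50 * \<Lambda>)"
    if a: "a \<in> T'" for a
  proof -
    let ?a = "\<lambda>i. (2/3) * a i"
    have "L2_set ?a I = (2/3) * L2_set a I" by (subst L2_set_right_distrib[symmetric]) auto
    then have "L2_set ?a I \<le> 1" using a by (simp add: T'_def)
    then have "(\<integral>\<^sup>+x. ennreal (exp (w x * (lin ?a x)\<^sup>2 / (4 * \<Lambda>))) \<partial>M) \<le> ennreal (exp (1/2))"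
      unfolding lin_def by (rule expo)
    then have "whp ?P (exp (- (5 * L))) (\<lambda>x. (\<Sum>i<n. w (x i) * (lin ?a (x i))\<^sup>2 / (4 * \<Lambda>)) \<le> real n * (1/2) + 5 * L)"
      by (intro whp_chernoff) measurable
    then show ?thesis
    proof (rule whp_mono)
      fix x assume h: "(\<Sum>i<n. w (x i) * (lin ?a (x i))\<^sup>2 / (4 * \<Lambda>)) \<le> real n * (1/2) + 5 * L"
      have e: "lin ?a y = (2/3) * lin a y" for y
        by (simp add: lin_def sum_distrib_left mult.assoc)
      have "(\<Sum>i<n. w (x i) * (lin ?a (x i))\<^sup>2 / (4 * \<Lambda>)) = (\<Sum>i<n. w (x i) * (lin a (x i))\<^sup>2) * (1 / (9 * \<Lambda>))"
        unfolding e power_mult_distrib sum_distrib_right by (intro sum.cong) (auto simp: power2_eq_square)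
      then have "(\<Sum>i<n. w (x i) * (lin a (x i))\<^sup>2) * (1 / (9 * \<Lambda>)) \<le> real n * (11/2)"
        using h n by linarith
      then have "(\<Sum>i<n. w (x i) * (lin a (x i))\<^sup>2) \<le> real n * (11/2) * (9 * \<Lambda>)"
        using \<Lambda> by (simp add: field_simps)
      also have "\<dots> \<le> real n * (50 * \<Lambda>)" using \<Lambda> by simp
      finally show "(\<Sum>i<n. w (x i) * (lin a (x i))\<^sup>2) / real n \<le> 50 * \<Lambda>"
        using n by (simp add: field_simps)
    qed simp
  qed
  have "whp ?P (real (card T') * exp (- (5 * L)))
     (\<lambda>x. \<forall>a\<in>T'. (\<Sum>i<n. w (x i) * (lin a (x i))\<^sup>2) / real n \<le> 50 * \<Lambda>)"
    by (rule PP.P.whp_ball_card[OF T'(1) one])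
  then show ?thesis
  proof (rule whp_mono)
    have "real (card T') * exp (- (5 * L)) \<le> exp (4 * L) * exp (- (5 * L))"
      using cT T'(2) by (intro mult_right_mono) auto
    then show "real (card T') * exp (- (5 * L)) \<le> exp (- L)" by (simp add: exp_add[symmetric])
  next
    fix x assume x: "x \<in> space ?P"
      and h: "\<forall>a\<in>T'. (\<Sum>i<n. w (x i) * (lin a (x i))\<^sup>2) / real n \<le> 50 * \<Lambda>"
    have xi: "x i \<in> space M" if "i < n" for i using x that by (auto simp: space_PiM)
    define N where "N = (\<lambda>a. L2_set (\<lambda>i. sqrt (w (x i)) * lin a (x i)) {..<n})"
    have N2: "(N a)\<^sup>2 = (\<Sum>i<n. w (x i) * (lin a (x i))\<^sup>2)" for a
    proof -
      have "(N a)\<^sup>2 = (\<Sum>i<n. (sqrt (w (x i)) * lin a (x i))\<^sup>2)"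
        unfolding N_def L2_set_def by (rule real_sqrt_pow2) (intro sum_nonneg, simp)
      also have "\<dots> = (\<Sum>i<n. w (x i) * (lin a (x i))\<^sup>2)"
        using w0 xi by (intro sum.cong) (auto simp: power_mult_distrib)
      finally show ?thesis .
    qed
    have N0: "0 \<le> N a" for a by (simp add: N_def L2_set_nonneg)
    have Ntri: "N (\<lambda>i. a i + c i) \<le> N a + N c" for a c
    proof -
      have "N (\<lambda>i. a i + c i) = L2_set (\<lambda>i. sqrt (w (x i)) * lin a (x i) + sqrt (w (x i)) * lin c (x i)) {..<n}"
        unfolding N_def by (simp add: lin_def sum.distrib distrib_right distrib_left)
      also have "\<dots> \<le> N a + N c" unfolding N_def by (rule L2_set_triangle_ineq)
      finally show ?thesis .
    qed
    have Nscale: "N (\<lambda>i. r * a i) = r * N a" if "0 \<le> r" for r a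
    proof -
      have "lin (\<lambda>i. r * a i) y = r * lin a y" for y
        by (simp add: lin_def sum_distrib_left mult.assoc)
      then show ?thesis using that unfolding N_def by (simp add: L2_set_right_distrib mult.left_commute)
    qed
    define Q where "Q = sqrt (real n * (50 * \<Lambda>))"
    have NQ: "N a \<le> Q" if "a \<in> T'" for a
    proof -
      have "(N a)\<^sup>2 \<le> real n * (50 * \<Lambda>)" unfolding N2 using h that n by (simp add: field_simps)
      then show ?thesis unfolding Q_def by (rule real_le_rsqrt)
    qed
    define S where "S = {u \<in> supported V. L2_set u I \<le> 1}"
    have bdd: "bdd_above (N ` S)"
    proof (rule bdd_aboveI2)
      fix u assume u: "u \<in> S"
      have "\<bar>lin u y\<bar> \<le> L2_set (\<lambda>i. X i y) I" for y
      proof -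
        have "\<bar>lin u y\<bar> \<le> (\<Sum>i\<in>I. \<bar>u i\<bar> * \<bar>X i y\<bar>)"
          unfolding lin_def by (rule order_trans[OF sum_abs]) (simp add: abs_mult)
        also have "\<dots> \<le> L2_set u I * L2_set (\<lambda>i. X i y) I" by (rule L2_set_mult_ineq)
        also have "\<dots> \<le> 1 * L2_set (\<lambda>i. X i y) I"
          using u by (intro mult_right_mono) (auto simp: S_def L2_set_nonneg)
        finally show ?thesis by simp
      qed
      then have "L2_set (\<lambda>i. \<bar>sqrt (w (x i)) * lin u (x i)\<bar>) {..<n}
         \<le> L2_set (\<lambda>i. sqrt (w (x i)) * L2_set (\<lambda>k. X k (x i)) I) {..<n}"
        using w0 xi by (intro L2_set_mono) (auto simp: abs_mult intro!: mult_left_mono)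
      then show "N u \<le> L2_set (\<lambda>i. sqrt (w (x i)) * L2_set (\<lambda>k. X k (x i)) I) {..<n}"
        by (simp add: N_def L2_set_def)
    qed
    have Sne: "S \<noteq> {}"
    proof -
      have "(\<lambda>_. 0) \<in> S" using V_ne by (auto simp: S_def supported_def L2_set_def)
      then show ?thesis by blast
    qed
    define s where "s = Sup (N ` S)"
    have Ns: "N u \<le> s" if "u \<in> S" for u
      unfolding s_def using that bdd by (intro cSUP_upper)
    have "N u \<le> Q + s / 2" if u: "u \<in> S" for u
    proof -
      obtain a where a: "a \<in> T" "(\<lambda>i. u i - a i) \<in> supported V" "L2_set (\<lambda>i. u i - a i) I \<le> 1/2"
        using Tnet[of u] u by (auto simp: S_def)
      have "L2_set a I = L2_set (\<lambda>i. u i + (- (u i - a i))) I" by simp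
      also have "\<dots> \<le> L2_set u I + L2_set (\<lambda>i. - (u i - a i)) I" by (rule L2_set_triangle_ineq)
      also have "L2_set (\<lambda>i. - (u i - a i)) I = L2_set (\<lambda>i. u i - a i) I"
        by (simp add: L2_set_def power2_commute)
      finally have "a \<in> T'" using a u by (simp add: T'_def S_def)
      define v where "v = (\<lambda>i. 2 * (u i - a i))"
      have "v \<in> S"
      proof -
        have "L2_set v I \<le> 1" using a(3) unfolding v_def by (subst L2_set_right_distrib[symmetric]) auto
        moreover have "v \<in> supported V" using supported_scale[OF a(2), of 2] by (simp add: v_def)
        ultimately show ?thesis by (simp add: S_def)
      qed
      have "u = (\<lambda>i. a i + (1/2) * v i)" by (intro ext) (simp add: v_def diff_divide_distrib)
      then have "N u = N (\<lambda>i. a i + (1/2) * v i)" by simp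
      also have "\<dots> \<le> N a + N (\<lambda>i. (1/2) * v i)" by (rule Ntri)
      also have "N (\<lambda>i. (1/2) * v i) = (1/2) * N v" by (rule Nscale) simp
      finally show ?thesis using NQ[OF \<open>a \<in> T'\<close>] Ns[OF \<open>v \<in> S\<close>] by linarith
    qed
    then have "s \<le> Q + s / 2" unfolding s_def using Sne by (intro cSUP_least) (auto simp: s_def)
    then have s: "s \<le> 2 * Q" by linarith
    show "\<forall>a\<in>supported V. (\<Sum>i<n. w (x i) * (lin a (x i))\<^sup>2) / real n \<le> 200 * \<Lambda> * (L2_set a I)\<^sup>2"
    proof
      fix a assume a: "a \<in> supported V"
      define r where "r = L2_set a I"
      have r0: "0 \<le> r" by (simp add: r_def L2_set_nonneg)
      have "N a \<le> r * (2 * Q)"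
      proof (cases "r = 0")
        case True
        then have "\<forall>i\<in>I. a i = 0" using I by (simp add: r_def L2_set_def sum_nonneg_eq_0_iff sum_nonneg)
        then have "lin a y = 0" for y by (simp add: lin_def)
        then show ?thesis using True by (simp add: N_def L2_set_def)
      next
        case False
        then have r: "0 < r" using r0 by simp
        have "L2_set (\<lambda>i. (1 / r) * a i) I = 1"
          using r by (subst L2_set_right_distrib[symmetric]) (auto simp: r_def)
        moreover have "(\<lambda>i. (1 / r) * a i) \<in> supported V" using a by (rule supported_scale)
        ultimately have "(\<lambda>i. (1 / r) * a i) \<in> S" by (simp add: S_def)
        then have "N (\<lambda>i. (1 / r) * a i) \<le> 2 * Q" using Ns s by (meson order_trans)
        then have "(1 / r) * N a \<le> 2 * Q" using Nscale[of "1 / r" a] r by simp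
        then show ?thesis using r by (simp add: field_simps)
      qed
      then have "(N a)\<^sup>2 \<le> (r * (2 * Q))\<^sup>2" using N0 by (intro power_mono)
      also have "\<dots> = real n * (200 * \<Lambda> * r\<^sup>2)"
        using \<Lambda> by (simp add: Q_def power_mult_distrib)
      finally show "(\<Sum>i<n. w (x i) * (lin a (x i))\<^sup>2) / real n \<le> 200 * \<Lambda> * (L2_set a I)\<^sup>2"
        unfolding N2 r_def using n by (simp add: field_simps)
    qed
  qed
qed

end

section \<open>Chaining for frequencies of slabs\<close>

lemma sum_dyadic_linear_le:
  fixes A B :: real
  assumes "0 \<le> A" "0 \<le> B"
  shows "(\<Sum>j<J. (1/2) ^ j * (A + B * real j)) \<le> 2 * A + 2 * B"
proof -
  have "(\<Sum>j<J. (1/2) ^ j * (A + B * real j)) = 2 * A + 2 * B - (1/2) ^ J * (2 * A + 2 * B + 2 * B * real J)"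
  proof (induction J)
    case (Suc J)
    define h where "h = (1/2::real) ^ J"
    have "(2 * A + 2 * B - h * (2 * A + 2 * B + 2 * B * real J)) + h * (A + B * real J)
        = 2 * A + 2 * B - (1/2 * h) * (2 * A + 2 * B + 2 * B * real (Suc J))"
      by (simp add: algebra_simps)
    then show ?case unfolding sum.lessThan_Suc Suc power_Suc h_def .
  qed simp
  then show ?thesis using assms by simp
qed

lemma exists_dyadic_level:
  fixes \<rho> :: real
  assumes "0 < \<rho>" "\<rho> \<le> 1"
  shows "\<exists>J::nat. 2 ^ J * \<rho> \<le> 1 \<and> 1 < 2 ^ Suc J * \<rho>"
proof -
  obtain m :: nat where m: "1 / \<rho> < 2 ^ m" using real_arch_pow[of 2 "1 / \<rho>"] by auto
  define k where "k = (LEAST m::nat. 1 / \<rho> < 2 ^ m)"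
  have k: "1 / \<rho> < 2 ^ k" unfolding k_def using m by (rule LeastI)
  have "k \<noteq> 0"
  proof
    assume "k = 0"
    then have "1 / \<rho> < 1" using k by simp
    then show False using assms by (simp add: field_simps)
  qed
  then obtain J where J: "k = Suc J" using not0_implies_Suc by blast
  have "\<not> 1 / \<rho> < 2 ^ J"
    using not_less_Least[of J "\<lambda>m. 1 / \<rho> < 2 ^ m"] J by (simp add: k_def)
  then have "2 ^ J * \<rho> \<le> 1" using assms by (simp add: field_simps not_less)
  moreover have "1 < 2 ^ Suc J * \<rho>" using k J assms by (simp add: field_simps)
  ultimately show ?thesis by blast
qed

context weighted_projections
begin

definition emp :: "nat \<Rightarrow> ('a \<Rightarrow> real) \<Rightarrow> (nat \<Rightarrow> 'a) \<Rightarrow> real" where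
  "emp n f x = (\<Sum>i<n. f (x i)) / real n"

definition fluct :: "nat \<Rightarrow> ('a \<Rightarrow> real) \<Rightarrow> (nat \<Rightarrow> 'a) \<Rightarrow> real" where
  "fluct n f x = emp n f x - expectation f"

lemma whp_deviation:
  assumes f: "f \<in> borel_measurable M" "\<And>x. x \<in> space M \<Longrightarrow> \<bar>f x\<bar> \<le> 1"
    and q: "expectation (\<lambda>x. \<bar>f x\<bar>) \<le> q" and s: "s = 1 \<or> s = -1"
    and l: "0 < l" "l \<le> 1/2" and n: "0 < n"
  shows "whp (PiM {..<n} (\<lambda>_. M)) (exp (- K))
    (\<lambda>x. s * fluct n f x \<le> l * q + K / (l * real n))"
proof -
  have [measurable]: "f \<in> borel_measurable M" by (rule f)
  have s': "\<bar>s\<bar> = 1" "s * s = 1" using s by auto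
  have ptw: "(s * f x)\<^sup>2 \<le> \<bar>f x\<bar>" if x: "x \<in> space M" for x
  proof -
    have "(s * f x)\<^sup>2 = s * s * (f x * f x)" by (simp add: power2_eq_square)
    also have "\<dots> = \<bar>f x\<bar> * \<bar>f x\<bar>" unfolding s'(2) by simp
    also have "\<dots> \<le> \<bar>f x\<bar> * 1" using f(2)[OF x] by (intro mult_left_mono) auto
    finally show "(s * f x)\<^sup>2 \<le> \<bar>f x\<bar>" by simp
  qed
  have "expectation (\<lambda>x. (s * f x)\<^sup>2) \<le> expectation (\<lambda>x. \<bar>f x\<bar>)"
  proof (rule integral_mono[OF _ _ ptw])
    show "integrable M (\<lambda>x. (s * f x)\<^sup>2)"
      by (rule integrable_bounded[of _ 1]) (measurable, use ptw f(2) in fastforce)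
    show "integrable M (\<lambda>x. \<bar>f x\<bar>)"
      by (rule integrable_bounded[of _ 1]) (use f(2) in auto)
  qed
  then have "expectation (\<lambda>x. (s * f x)\<^sup>2) \<le> q" using q by linarith
  moreover have "\<bar>s * f x\<bar> \<le> 1" if "x \<in> space M" for x using f(2)[OF that] s' by (simp add: abs_mult)
  ultimately have "whp (PiM {..<n} (\<lambda>_. M)) (exp (- K))
    (\<lambda>x. (\<Sum>i<n. s * f (x i)) / real n \<le> expectation (\<lambda>x. s * f x) + l * q + K / (l * real n))"
    by (intro whp_bernstein l n) measurable
  then show ?thesis
    by (rule whp_mono) (simp_all add: fluct_def emp_def sum_distrib_left[symmetric] right_diff_distrib)
qed

text \<open>
  At level \<open>j\<close> the net has radius \<open>8\<^sup>-\<^sup>j\<close> and entropy \<open>O(L (1 + j))\<close>, and \<open>below_close\<close> with \<open>t = 4\<^sup>-\<^sup>j\<close>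
  bounds the expected difference of consecutive indicators by \<open>O(4\<^sup>-\<^sup>j)\<close>. With the Bernstein parameter
  \<open>\<rho> 2\<^sup>j\<close> the deviation of level \<open>j\<close> is \<open>O(\<rho> (1 + j) 2\<^sup>-\<^sup>j)\<close>, which is summable. The parameter must
  not exceed \<open>1/2\<close>, and this is what limits the number \<open>J\<close> of levels. The sign \<open>s\<close> treats upper and
  lower deviations at once.
\<close>

lemma whp_chain:
  fixes c \<rho> s :: real and n J :: nat
  assumes n: "0 < n" and rho: "0 < \<rho>" "\<rho> \<le> 1/2" "\<rho>\<^sup>2 = L / real n" and s: "s = 1 \<or> s = -1"
    and J: "2 ^ J * \<rho> \<le> 1"
  shows "whp (PiM {..<n} (\<lambda>_. M)) (3 * exp (- L)) (\<lambda>x. \<forall>u\<in>D. \<exists>a.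
      (\<lambda>i. u i - a i) \<in> supported V \<and> L2_set (\<lambda>i. u i - a i) I \<le> (1/8) ^ J \<and>
      s * fluct n (below a c) x \<le> (50 + 16 * \<Lambda> + 5 * ln (b + 2)) * \<rho>)"
proof -
  define \<kappa> where "\<kappa> = 2 + ln (b + 2)"
  have "0 \<le> ln (b + 2)" using b by simp
  then have kap: "2 \<le> \<kappa>" by (simp add: \<kappa>_def)
  have "\<forall>j. \<exists>T. supported_net V I b ((1/8)^j) T \<and>
      real (card T) \<le> real (card V) * (2 * exp 1 * (b / (1/8)^j + 2)) ^ d"
    by (intro allI net_family I V d b) auto
  then obtain T where T: "\<forall>j. supported_net V I b ((1/8)^j) (T j) \<and>
      real (card (T j)) \<le> real (card V) * (2 * exp 1 * (b / (1/8)^j + 2)) ^ d"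
    by (rule choice[THEN exE])
  have fT: "finite (T j)" for j using T by (simp add: supported_net_def)
  have Tnet: "\<exists>a\<in>T j. (\<lambda>i. u i - a i) \<in> supported V \<and> L2_set (\<lambda>i. u i - a i) I \<le> (1/8)^j"
    if "u \<in> D" for u j using T D that unfolding supported_net_def by blast
  have cT: "real (card (T j)) \<le> exp ((\<kappa> + 3 * real j) * L)" for j
  proof -
    have "real (card V) * (2 * exp 1 * (b / (1/8)^j + 2)) ^ d \<le> exp ((\<kappa> + 3 * real j) * L)"
    proof (rule card_net_le)
      have e2: "2 \<le> exp (1::real)" using exp_ge_add_one_self[of 1] by simp
      have "b / (1/8)^j + 2 = b * 8^j + 2" by (simp add: power_divide)
      also have "\<dots> \<le> (b + 2) * 8 ^ j" by (simp add: distrib_right)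
      also have "\<dots> \<le> (b + 2) * exp 3 ^ j"
      proof -
        have "(2::real) ^ 3 \<le> exp 1 ^ 3" using e2 by (intro power_mono) auto
        then have "(8::real) \<le> exp 3" by (simp add: exp_of_nat_mult[symmetric])
        then show ?thesis using b by (intro mult_left_mono power_mono) auto
      qed
      finally have 1: "b / (1/8)^j + 2 \<le> (b + 2) * exp 3 ^ j" .
      have "2 * exp 1 * (b / (1/8)^j + 2) \<le> exp 1 * exp 1 * ((b + 2) * exp 3 ^ j)"
        using e2 1 b by (intro mult_mono) auto
      also have "exp (3::real) ^ j = exp (3 * real j)" by (simp add: exp_of_nat_mult[symmetric] mult.commute)
      also have "b + 2 = exp (ln (b + 2))" using b by simp
      also have "exp 1 * exp 1 * (exp (ln (b + 2)) * exp (3 * real j)) = exp (\<kappa> + 3 * real j)"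
        by (simp add: \<kappa>_def exp_add[symmetric])
      finally show "2 * exp 1 * (b / (1/8)^j + 2) \<le> exp (\<kappa> + 3 * real j)" .
    qed (use kap b in auto)
    then show ?thesis using T[rule_format, of j] by linarith
  qed
  let ?P = "PiM {..<n} (\<lambda>_. M)"
  interpret PP: product_prob_space "\<lambda>_::nat. M" "{..<n}" by unfold_locales
  define q where "q = 4 + 8 * \<Lambda>"
  have q0: "0 \<le> q" using \<Lambda> by (simp add: q_def)
  define diff where "diff = (\<lambda>e::(nat \<Rightarrow> real) \<times> (nat \<Rightarrow> real). \<lambda>x. below (snd e) c x - below (fst e) c x)"
  have diff_meas: "diff e \<in> borel_measurable M" for e unfolding diff_def by measurable
  have diff_bd: "\<bar>diff e x\<bar> \<le> 1" if "x \<in> space M" for e x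
    using below_bounds[OF that] unfolding diff_def by (smt (verit))
  \<comment> \<open>Only pairs with small expected difference are controlled; the two roundings of any direction in D form such a pair.\<close>
  define Pr where "Pr = (\<lambda>j. {e \<in> T j \<times> T (Suc j). expectation (\<lambda>x. \<bar>diff e x\<bar>) \<le> q * (1/4)^j})"
  define dev where "dev = (\<lambda>j::nat. \<rho> * ((1/2)^j * ((q + 2 * \<kappa> + 4) + 7 * real j)))"
  have Ln: "L / real n = \<rho> * \<rho>" using rho by (simp add: power2_eq_square)
  have pair: "whp ?P (exp (- L) * (1/2)^j) (\<lambda>x. \<forall>e\<in>Pr j. s * fluct n (diff e) x \<le> dev j)"
    if j: "j < J" for j
  proof -
    define K where "K = (2 * \<kappa> + 7 * real j + 4) * L"
    have fP: "finite (Pr j)" unfolding Pr_def using fT by auto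
    have lj: "0 < \<rho> * 2^j" "\<rho> * 2^j \<le> 1/2"
    proof -
      have "\<rho> * 2 ^ Suc j \<le> \<rho> * 2 ^ J" using j rho by (intro mult_left_mono power_increasing) auto
      then show "\<rho> * 2^j \<le> 1/2" using J by (simp add: mult.commute)
    qed (use rho in simp)
    have devj: "(\<rho> * 2^j) * (q * (1/4)^j) + K / ((\<rho> * 2^j) * real n) = dev j"
    proof -
      have "2^j * (1/4::real)^j = (1/2)^j" by (simp flip: power_mult_distrib)
      then have 1: "(\<rho> * 2^j) * (q * (1/4)^j) = \<rho> * (1/2)^j * q"
        by (metis mult.assoc mult.commute)
      have "K / ((\<rho> * 2^j) * real n) = (2 * \<kappa> + 7 * real j + 4) * (L / real n) / (\<rho> * 2^j)"
        by (simp add: K_def)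
      also have "\<dots> = \<rho> * (1/2)^j * (2 * \<kappa> + 7 * real j + 4)"
        unfolding Ln using rho(1) by (simp add: power_divide)
      finally show ?thesis unfolding 1 by (simp add: dev_def distrib_left distrib_right)
    qed
    have "whp ?P (real (card (Pr j)) * exp (- K)) (\<lambda>x. \<forall>e\<in>Pr j. s * fluct n (diff e) x \<le> dev j)"
    proof (rule PP.P.whp_ball_card[OF fP])
      fix e assume e: "e \<in> Pr j"
      have "whp ?P (exp (- K)) (\<lambda>x. s * fluct n (diff e) x \<le> (\<rho> * 2^j) * (q * (1/4)^j) + K / ((\<rho> * 2^j) * real n))"
        by (rule whp_deviation[OF diff_meas diff_bd _ s lj n]) (use e in \<open>auto simp: Pr_def\<close>)
      then show "whp ?P (exp (- K)) (\<lambda>x. s * fluct n (diff e) x \<le> dev j)"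
        unfolding devj .
    qed
    then show ?thesis
    proof (rule whp_mono)
      have "card (Pr j) \<le> card (T j \<times> T (Suc j))"
        unfolding Pr_def using fT by (intro card_mono) auto
      then have "real (card (Pr j)) \<le> real (card (T j)) * real (card (T (Suc j)))"
        by (simp add: card_cartesian_product flip: of_nat_mult)
      also have "\<dots> \<le> exp ((\<kappa> + 3 * real j) * L) * exp ((\<kappa> + 3 * real (Suc j)) * L)"
        by (intro mult_mono cT) auto
      finally have "real (card (Pr j)) * exp (- K) \<le> exp ((\<kappa> + 3 * real j) * L) * exp ((\<kappa> + 3 * real (Suc j)) * L) * exp (- K)"
        by (intro mult_right_mono) auto
      also have "\<dots> = exp (- L) * exp (- L) ^ j"
        by (simp add: K_def exp_of_nat_mult[symmetric] exp_add[symmetric] algebra_simps)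
      also have "\<dots> \<le> exp (- L) * (1/2)^j"
      proof (intro mult_left_mono power_mono)
        have "2 \<le> exp L" using exp_ge_add_one_self[of L] L_ge_1 by linarith
        then show "exp (- L) \<le> 1/2" by (simp add: exp_minus field_simps)
      qed auto
      finally show "real (card (Pr j)) * exp (- K) \<le> exp (- L) * (1/2)^j" .
    qed
  qed
  have root: "whp ?P (exp (- L)) (\<lambda>x. \<forall>a\<in>T 0. s * fluct n (below a c) x \<le> (\<kappa> + 2) * \<rho>)"
  proof -
    define K where "K = (\<kappa> + 1) * L"
    have "K / (\<rho> * real n) = (\<kappa> + 1) * (L / real n) / \<rho>" by (simp add: K_def)
    also have "\<dots> = (\<kappa> + 1) * \<rho>" unfolding Ln using rho(1) by simp
    finally have devr: "\<rho> * 1 + K / (\<rho> * real n) = (\<kappa> + 2) * \<rho>" by (simp add: algebra_simps)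
    have "whp ?P (real (card (T 0)) * exp (- K)) (\<lambda>x. \<forall>a\<in>T 0. s * fluct n (below a c) x \<le> (\<kappa> + 2) * \<rho>)"
    proof (rule PP.P.whp_ball_card[OF fT])
      fix a
      have bd: "\<bar>below a c x\<bar> \<le> 1" if "x \<in> space M" for x using below_bounds[OF that, of a c] by simp
      have "expectation (\<lambda>x. \<bar>below a c x\<bar>) \<le> expectation (\<lambda>x. 1)"
        using bd below_integrable by (intro integral_mono) auto
      then have "expectation (\<lambda>x. \<bar>below a c x\<bar>) \<le> 1" by (simp add: prob_space)
      then have "whp ?P (exp (- K)) (\<lambda>x. s * fluct n (below a c) x \<le> \<rho> * 1 + K / (\<rho> * real n))"
        by (intro whp_deviation bd s rho n below_meas)
      then show "whp ?P (exp (- K)) (\<lambda>x. s * fluct n (below a c) x \<le> (\<kappa> + 2) * \<rho>)"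
        unfolding devr .
    qed
    then show ?thesis
    proof (rule whp_mono)
      have "real (card (T 0)) * exp (- K) \<le> exp (\<kappa> * L) * exp (- K)"
        using cT[of 0] by (intro mult_right_mono) auto
      then show "real (card (T 0)) * exp (- K) \<le> exp (- L)"
        by (simp add: K_def exp_add[symmetric] algebra_simps)
    qed
  qed
  have "whp ?P (\<Sum>j<J. exp (- L) * (1/2)^j) (\<lambda>x. \<forall>j\<in>{..<J}. \<forall>e\<in>Pr j. s * fluct n (diff e) x \<le> dev j)"
    by (rule PP.P.whp_ball) (use pair in auto)
  from PP.P.whp_conj[OF root this] show ?thesis
  proof (rule whp_mono)
    have "(\<Sum>j<J. exp (- L) * (1/2)^j) = exp (- L) * (\<Sum>j<J. (1/2)^j * (1 + 0 * real j))"
      by (simp add: sum_distrib_left)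
    also have "\<dots> \<le> exp (- L) * (2 * 1 + 2 * 0)"
      by (intro mult_left_mono sum_dyadic_linear_le) auto
    finally show "exp (- L) + (\<Sum>j<J. exp (- L) * (1/2)^j) \<le> 3 * exp (- L)" by simp
  next
    fix x assume x: "x \<in> space ?P"
      and h: "(\<forall>a\<in>T 0. s * fluct n (below a c) x \<le> (\<kappa> + 2) * \<rho>) \<and>
        (\<forall>j\<in>{..<J}. \<forall>e\<in>Pr j. s * fluct n (diff e) x \<le> dev j)"
    show "\<forall>u\<in>D. \<exists>a. (\<lambda>i. u i - a i) \<in> supported V \<and> L2_set (\<lambda>i. u i - a i) I \<le> (1/8) ^ J \<and>
      s * fluct n (below a c) x \<le> (50 + 16 * \<Lambda> + 5 * ln (b + 2)) * \<rho>"
    proof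
      fix u assume u: "u \<in> D"
      have "\<forall>j. \<exists>a. a \<in> T j \<and> (\<lambda>i. u i - a i) \<in> supported V \<and> L2_set (\<lambda>i. u i - a i) I \<le> (1/8)^j"
        using Tnet[OF u] by blast
      then obtain a where a: "\<forall>j. a j \<in> T j \<and> (\<lambda>i. u i - a j i) \<in> supported V \<and> L2_set (\<lambda>i. u i - a j i) I \<le> (1/8)^j"
        by (rule choice[THEN exE])
      define \<Delta> where "\<Delta> = (\<lambda>j. s * fluct n (below (a j) c) x)"
      have step: "\<Delta> (Suc j) - \<Delta> j \<le> dev j" if j: "j < J" for j
      proof -
        define e where "e = (a j, a (Suc j))"
        have near: "expectation (\<lambda>x. \<bar>below u c x - below (a i) c x\<bar>) \<le> (2 + 4 * \<Lambda>) * (1/4)^i" for i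
        proof -
          have "expectation (\<lambda>x. \<bar>below u c x - below (a i) c x\<bar>) \<le> 2 * (1/4)^i + 4 * \<Lambda> * ((1/8)^i)\<^sup>2 / ((1/4)^i)\<^sup>2"
            using a by (intro below_close[OF u]) simp_all
          also have "\<dots> = 2 * (1/4)^i + 4 * \<Lambda> * (((1/8)^i)\<^sup>2 / ((1/4)^i)\<^sup>2)" by simp
          also have "((1/8::real)^i)\<^sup>2 / ((1/4)^i)\<^sup>2 = (1/4)^i"
            by (simp add: power2_eq_square flip: power_mult_distrib power_divide)
          finally show ?thesis by (simp add: distrib_right)
        qed
        have "expectation (\<lambda>x. \<bar>diff e x\<bar>) \<le> expectation (\<lambda>x. \<bar>below u c x - below (a j) c x\<bar> + \<bar>below u c x - below (a (Suc j)) c x\<bar>)"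
          unfolding diff_def e_def using below_integrable by (intro integral_mono) auto
        also have "\<dots> = expectation (\<lambda>x. \<bar>below u c x - below (a j) c x\<bar>) + expectation (\<lambda>x. \<bar>below u c x - below (a (Suc j)) c x\<bar>)"
          using below_integrable by (intro Bochner_Integration.integral_add) auto
        also have "\<dots> \<le> (2 + 4 * \<Lambda>) * (1/4)^j + (2 + 4 * \<Lambda>) * (1/4)^Suc j"
          by (intro add_mono near)
        also have "\<dots> \<le> (2 + 4 * \<Lambda>) * (1/4)^j + (2 + 4 * \<Lambda>) * (1/4)^j"
          using \<Lambda> by (intro add_left_mono mult_left_mono) auto
        also have "\<dots> = q * (1/4)^j" by (simp add: q_def algebra_simps)
        finally have "e \<in> Pr j" using a by (simp add: Pr_def e_def)
        then have "s * fluct n (diff e) x \<le> dev j" using h j by blast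
        moreover have "emp n (diff e) x = emp n (below (a (Suc j)) c) x - emp n (below (a j) c) x"
          by (simp add: emp_def diff_def e_def sum_subtractf diff_divide_distrib)
        moreover have "expectation (diff e) = expectation (below (a (Suc j)) c) - expectation (below (a j) c)"
          unfolding diff_def e_def using below_integrable by simp
        ultimately show ?thesis by (simp add: \<Delta>_def fluct_def algebra_simps)
      qed
      have "\<Delta> J - \<Delta> 0 = (\<Sum>j<J. \<Delta> (Suc j) - \<Delta> j)" by (rule sum_lessThan_telescope[symmetric])
      also have "\<dots> \<le> (\<Sum>j<J. dev j)" using step by (intro sum_mono) auto
      also have "\<dots> = \<rho> * (\<Sum>j<J. (1/2)^j * ((q + 2 * \<kappa> + 4) + 7 * real j))"
        by (simp add: dev_def sum_distrib_left)
      also have "\<dots> \<le> \<rho> * (2 * (q + 2 * \<kappa> + 4) + 2 * 7)"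
        using rho q0 kap by (intro mult_left_mono sum_dyadic_linear_le) auto
      finally have 1: "\<Delta> J - \<Delta> 0 \<le> \<rho> * (2 * (q + 2 * \<kappa> + 4) + 2 * 7)" .
      have 2: "\<Delta> 0 \<le> (\<kappa> + 2) * \<rho>" unfolding \<Delta>_def using h a by blast
      have "\<Delta> J \<le> (2 * (q + 2 * \<kappa> + 4) + 14 + \<kappa> + 2) * \<rho>" using 1 2 by (simp add: algebra_simps)
      also have "\<dots> \<le> (50 + 16 * \<Lambda> + 5 * ln (b + 2)) * \<rho>"
        using rho by (intro mult_right_mono) (auto simp: q_def \<kappa>_def)
      finally show "\<exists>a. (\<lambda>i. u i - a i) \<in> supported V \<and> L2_set (\<lambda>i. u i - a i) I \<le> (1/8) ^ J \<and>
        s * fluct n (below a c) x \<le> (50 + 16 * \<Lambda> + 5 * ln (b + 2)) * \<rho>"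
        using a unfolding \<Delta>_def by (intro exI[of _ "a J"] conjI) simp_all
    qed
  qed
qed

text \<open>
  With \<open>2\<^sup>J\<close> of order \<open>1 / \<rho>\<close> the last net has radius \<open>\<eta> = O(\<rho>\<^sup>3)\<close>. Passing from the net point to \<open>u\<close>
  and from the threshold \<open>c + s \<rho>\<close> to \<open>c\<close>, an indicator can change in the unfavourable direction only
  where \<open>|lin (u - a)| > \<rho>\<close>, and the weighted proportion of such observations is at most
  \<open>O(\<eta>\<^sup>2 / \<rho>\<^sup>2) = O(\<rho>)\<close>.
\<close>

theorem whp_uniform_deviation:
  fixes c \<rho> s :: real and n :: nat
  assumes n: "0 < n" and rho: "0 < \<rho>" "\<rho> \<le> 1/2" "\<rho>\<^sup>2 = L / real n" and s: "s = 1 \<or> s = -1"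
  shows "whp (PiM {..<n} (\<lambda>_. M)) (4 * exp (- L)) (\<lambda>x. \<forall>u\<in>D.
      s * fluct n (below u c) x \<le> (53 + 20000 * \<Lambda> + 5 * ln (b + 2)) * \<rho>)"
proof -
  obtain J :: nat where J: "2 ^ J * \<rho> \<le> 1" "1 < 2 ^ Suc J * \<rho>"
    using exists_dyadic_level[of \<rho>] rho(1,2) by fastforce
  let ?P = "PiM {..<n} (\<lambda>_. M)"
  interpret PP: product_prob_space "\<lambda>_::nat. M" "{..<n}" by unfold_locales
  have "\<rho>\<^sup>2 \<le> 1" using rho(1,2) by (simp add: power_le_one)
  then have "L / real n \<le> 1" using rho(3) by linarith
  then have Ln: "L \<le> real n" using n by (simp add: pos_divide_le_eq)
  define c' where "c' = c + s * \<rho>"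
  define Kc where "Kc = 50 + 16 * \<Lambda> + 5 * ln (b + 2)"
  define \<eta> where "\<eta> = (1/8::real) ^ J"
  have eta: "\<eta>\<^sup>2 / \<rho>\<^sup>2 \<le> 64 * \<rho>"
  proof -
    have "1 \<le> (2 ^ Suc J * \<rho>) ^ 6" using J(2) by (intro one_le_power) auto
    also have "(2 ^ Suc J * \<rho>) ^ 6 = 64 * (64 ^ J * \<rho> ^ 6)"
      by (simp add: power_mult_distrib power_mult[symmetric] mult.commute[of J] flip: power_mult) (simp add: power_mult)
    finally have "(1/64) ^ J \<le> 64 * \<rho> ^ 6" by (simp add: power_divide field_simps)
    moreover have "\<eta>\<^sup>2 = (1/64) ^ J" by (simp add: \<eta>_def power2_eq_square flip: power_mult_distrib)
    ultimately have "\<eta>\<^sup>2 / \<rho>\<^sup>2 \<le> 64 * \<rho> ^ 6 / \<rho>\<^sup>2" by (intro divide_right_mono) auto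
    also have "\<dots> = 64 * \<rho> * \<rho> ^ 3" using rho(1) by (simp add: field_simps eval_nat_numeral)
    also have "\<dots> \<le> 64 * \<rho> * 1" using rho(1,2) by (intro mult_left_mono power_le_one) auto
    finally show ?thesis by simp
  qed
  have "whp ?P (3 * exp (- L) + exp (- L)) (\<lambda>x. (\<forall>u\<in>D. \<exists>a.
      (\<lambda>i. u i - a i) \<in> supported V \<and> L2_set (\<lambda>i. u i - a i) I \<le> \<eta> \<and>
      s * fluct n (below a c') x \<le> Kc * \<rho>) \<and>
      (\<forall>a\<in>supported V. (\<Sum>i<n. w (x i) * (lin a (x i))\<^sup>2) / real n \<le> 200 * \<Lambda> * (L2_set a I)\<^sup>2))"
    unfolding \<eta>_def Kc_def
    by (intro PP.P.whp_conj whp_chain whp_uniform_second_moment n rho s J Ln)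
  then show ?thesis
  proof (rule whp_mono)
    fix x assume x: "x \<in> space ?P" and h: "(\<forall>u\<in>D. \<exists>a.
      (\<lambda>i. u i - a i) \<in> supported V \<and> L2_set (\<lambda>i. u i - a i) I \<le> \<eta> \<and>
      s * fluct n (below a c') x \<le> Kc * \<rho>) \<and>
      (\<forall>a\<in>supported V. (\<Sum>i<n. w (x i) * (lin a (x i))\<^sup>2) / real n \<le> 200 * \<Lambda> * (L2_set a I)\<^sup>2)"
    have xi: "x i \<in> space M" if "i < n" for i using x that by (auto simp: space_PiM)
    show "\<forall>u\<in>D. s * fluct n (below u c) x \<le> (53 + 20000 * \<Lambda> + 5 * ln (b + 2)) * \<rho>"
    proof
      fix u assume u: "u \<in> D"
      obtain a where a: "(\<lambda>i. u i - a i) \<in> supported V" "L2_set (\<lambda>i. u i - a i) I \<le> \<eta>"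
        "s * fluct n (below a c') x \<le> Kc * \<rho>"
        using h u by blast
      let ?v = "\<lambda>i. u i - a i"
      have ptw: "s * (below u c y - below a c' y) \<le> w y * (lin ?v y)\<^sup>2 / \<rho>\<^sup>2" if y: "y \<in> space M" for y
      proof -
        have "s * (below u c y - below a c' y) = w y * (s * (of_bool (\<bar>lin u y\<bar> \<le> c) - of_bool (\<bar>lin a y\<bar> \<le> c')))"
          by (simp add: below_def algebra_simps)
        also have "\<dots> \<le> w y * of_bool (\<rho> < \<bar>lin ?v y\<bar>)"
          using w0[OF y] s by (intro mult_left_mono) (auto simp: lin_diff c'_def)
        also have "\<dots> \<le> w y * (lin ?v y)\<^sup>2 / \<rho>\<^sup>2" by (rule weighted_exceedance_le[OF rho(1) y])
        finally show ?thesis .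
      qed
      have eta2: "\<Lambda> * (\<eta>\<^sup>2 / \<rho>\<^sup>2) \<le> \<Lambda> * (64 * \<rho>)" using eta \<Lambda> by (intro mult_left_mono) auto
      have "s * (emp n (below u c) x - emp n (below a c') x) = (\<Sum>i<n. s * (below u c (x i) - below a c' (x i))) / real n"
        by (simp add: emp_def sum_distrib_left[symmetric] sum_subtractf diff_divide_distrib[symmetric])
      also have "\<dots> \<le> (\<Sum>i<n. w (x i) * (lin ?v (x i))\<^sup>2 / \<rho>\<^sup>2) / real n"
        using ptw xi by (intro divide_right_mono sum_mono) auto
      also have "\<dots> = (\<Sum>i<n. w (x i) * (lin ?v (x i))\<^sup>2) / real n / \<rho>\<^sup>2"
        by (simp add: sum_divide_distrib[symmetric])
      also have "\<dots> \<le> 200 * \<Lambda> * (L2_set ?v I)\<^sup>2 / \<rho>\<^sup>2"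
        using h a(1) by (intro divide_right_mono) auto
      also have "\<dots> \<le> 200 * \<Lambda> * \<eta>\<^sup>2 / \<rho>\<^sup>2"
        using a(2) \<Lambda> by (intro divide_right_mono mult_left_mono power_mono) (auto simp: L2_set_nonneg)
      also have "\<dots> = 200 * (\<Lambda> * (\<eta>\<^sup>2 / \<rho>\<^sup>2))" by simp
      also have "\<dots> \<le> 12800 * \<Lambda> * \<rho>" using eta2 by simp
      finally have 1: "s * (emp n (below u c) x - emp n (below a c') x) \<le> 12800 * \<Lambda> * \<rho>" .
      have "\<bar>expectation (below u c') - expectation (below a c')\<bar> = \<bar>expectation (\<lambda>y. below u c' y - below a c' y)\<bar>"
        using below_integrable by simp
      also have "\<dots> \<le> expectation (\<lambda>y. \<bar>below u c' y - below a c' y\<bar>)" by (rule integral_abs_bound)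
      also have "\<dots> \<le> 2 * \<rho> + 4 * \<Lambda> * \<eta>\<^sup>2 / \<rho>\<^sup>2" by (rule below_close[OF u rho(1) a(2)])
      also have "\<dots> = 2 * \<rho> + 4 * (\<Lambda> * (\<eta>\<^sup>2 / \<rho>\<^sup>2))" by simp
      also have "\<dots> \<le> 2 * \<rho> + 256 * \<Lambda> * \<rho>" using eta2 by simp
      finally have 2: "\<bar>expectation (below u c') - expectation (below a c')\<bar> \<le> 2 * \<rho> + 256 * \<Lambda> * \<rho>" .
      have "\<bar>expectation (below u c') - expectation (below u c)\<bar> \<le> \<bar>c' - c\<bar>" by (rule below_shift[OF u])
      also have "\<bar>c' - c\<bar> = \<rho>" using s rho by (auto simp: c'_def)
      finally have 3: "\<bar>expectation (below u c') - expectation (below u c)\<bar> \<le> \<rho>" .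
      have "s * fluct n (below u c) x =
          s * (emp n (below u c) x - emp n (below a c') x) + s * fluct n (below a c') x
          + s * (expectation (below a c') - expectation (below u c))" by (simp add: fluct_def algebra_simps)
      also have "s * (expectation (below a c') - expectation (below u c)) \<le> 3 * \<rho> + 256 * \<Lambda> * \<rho>"
        using 2 3 s by auto
      finally have "s * fluct n (below u c) x \<le> 12800 * \<Lambda> * \<rho> + Kc * \<rho> + (3 * \<rho> + 256 * \<Lambda> * \<rho>)"
        using 1 a(3) by linarith
      also have "\<dots> = (53 + 13072 * \<Lambda> + 5 * ln (b + 2)) * \<rho>" by (simp add: Kc_def algebra_simps)
      also have "\<dots> \<le> (53 + 20000 * \<Lambda> + 5 * ln (b + 2)) * \<rho>"
        using rho \<Lambda> by (intro mult_right_mono) auto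
      finally show "s * fluct n (below u c) x \<le> (53 + 20000 * \<Lambda> + 5 * ln (b + 2)) * \<rho>" .
    qed
  qed simp
qed

end

section \<open>Gaussian projections and the weight of the clean component\<close>

abbreviation std_normal :: "real measure" where "std_normal \<equiv> std_normal_distribution"

interpretation std_normal: real_distribution std_normal by (rule real_dist_normal_dist)

lemma distr_linear_mv_normal:
  assumes \<Sigma>: "psd p \<Sigma>" and u: "u \<in> carrier_vec p"
  shows "distr (mv_normal p \<Sigma>) borel (\<lambda>x. u \<bullet> Matrix.vec p x) =
    distr std_normal borel (\<lambda>z. sqrt (u \<bullet> (\<Sigma> *\<^sub>v u)) * z)"
proof (rule Levy_uniqueness)
  let ?f = "\<lambda>x. u \<bullet> Matrix.vec p x" and ?s = "sqrt (u \<bullet> (\<Sigma> *\<^sub>v u))"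
  interpret N: prob_space "mv_normal p \<Sigma>" by (rule prob_space_mv_normal[OF \<Sigma>])
  have f: "?f \<in> borel_measurable (mv_normal p \<Sigma>)"
    using u by (simp add: scalar_prod_def atLeast0LessThan measurable_cong_sets[OF sets_mv_normal refl])
  have pos: "0 \<le> u \<bullet> (\<Sigma> *\<^sub>v u)" using \<Sigma> u by (simp add: psd_def)
  have \<Sigma>c: "\<Sigma> \<in> carrier_mat p p" using \<Sigma> by (simp add: psd_def)
  show "real_distribution (distr (mv_normal p \<Sigma>) borel ?f)" by (rule N.real_distribution_distr[OF f])
  show "real_distribution (distr std_normal borel (\<lambda>z. ?s * z))"
    by (rule std_normal.real_distribution_distr) simp
  show "char (distr (mv_normal p \<Sigma>) borel ?f) = char (distr std_normal borel (\<lambda>z. ?s * z))"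
  proof
    fix t :: real
    have tu: "t \<cdot>\<^sub>v u \<in> carrier_vec p" using u by simp
    have "char (distr (mv_normal p \<Sigma>) borel ?f) t = (CLINT x|mv_normal p \<Sigma>. iexp (t * ?f x))"
      unfolding char_def by (rule integral_distr[OF f]) simp
    also have "\<dots> = (CLINT x|mv_normal p \<Sigma>. iexp ((t \<cdot>\<^sub>v u) \<bullet> Matrix.vec p x))"
      using u by (simp add: smult_scalar_prod_distrib[of _ p])
    also have "\<dots> = complex_of_real (exp (- ((t \<cdot>\<^sub>v u) \<bullet> (\<Sigma> *\<^sub>v (t \<cdot>\<^sub>v u))) / 2))"
      by (rule char_mv_normal[OF \<Sigma> tu])
    also have "(t \<cdot>\<^sub>v u) \<bullet> (\<Sigma> *\<^sub>v (t \<cdot>\<^sub>v u)) = t * (t * (u \<bullet> (\<Sigma> *\<^sub>v u)))"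
      using u \<Sigma>c by (simp add: mult_mat_vec[of _ p p] smult_scalar_prod_distrib[of _ p] scalar_prod_smult_distrib[of _ p])
    also have "\<dots> = (t * ?s)\<^sup>2" using pos by (simp add: power2_eq_square)
    also have "complex_of_real (exp (- (t * ?s)\<^sup>2 / 2)) = char std_normal (t * ?s)"
      by (simp add: char_std_normal_distribution)
    also have "\<dots> = (CLINT z|std_normal. iexp (t * (?s * z)))"
      by (simp add: char_def mult.assoc)
    also have "\<dots> = char (distr std_normal borel (\<lambda>z. ?s * z)) t"
      unfolding char_def by (rule integral_distr[symmetric]) simp_all
    finally show "char (distr (mv_normal p \<Sigma>) borel ?f) t = char (distr std_normal borel (\<lambda>z. ?s * z)) t" .
  qed
qed

definition central_prob :: "real \<Rightarrow> real" where
  "central_prob c = measure std_normal {z. \<bar>z\<bar> \<le> c}"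

lemma measure_std_normal_Icc_le:
  assumes "a \<le> b"
  shows "measure std_normal {a..b} \<le> (b - a) / 2"
proof -
  have dens: "std_normal_density z \<le> 1/2" for z
  proof -
    have "sqrt 4 \<le> sqrt (2 * pi)" using pi_ge_two by (intro real_sqrt_le_mono) auto
    then have "1 / sqrt (2 * pi) \<le> 1 / 2" by (intro divide_left_mono) auto
    moreover have "exp (- (z\<^sup>2 / 2)) \<le> 1" by simp
    ultimately have "1 / sqrt (2 * pi) * exp (- (z\<^sup>2 / 2)) \<le> 1/2 * 1" by (intro mult_mono) auto
    then show ?thesis by (simp add: std_normal_density_def)
  qed
  have "emeasure std_normal {a..b} = (\<integral>\<^sup>+z. ennreal (std_normal_density z) * indicator {a..b} z \<partial>lborel)"
    by (simp add: emeasure_density)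
  also have "\<dots> \<le> (\<integral>\<^sup>+z. ennreal (1/2) * indicator {a..b} z \<partial>lborel)"
    by (intro nn_integral_mono mult_right_mono ennreal_leI dens) auto
  also have "\<dots> = ennreal (1/2) * emeasure lborel {a..b}" by (rule nn_integral_cmult_indicator) simp
  also have "\<dots> = ennreal (1/2) * ennreal (b - a)" using assms by simp
  also have "\<dots> = ennreal (1/2 * (b - a))" using assms by (intro ennreal_mult[symmetric]) auto
  finally have "ennreal (measure std_normal {a..b}) \<le> ennreal (1/2 * (b - a))"
    by (simp only: std_normal.emeasure_eq_measure)
  then show ?thesis using assms by (subst (asm) ennreal_le_iff) auto
qed

lemma measure_std_normal_Icc_ge:
  assumes "0 \<le> a" "a \<le> b" "b \<le> c"
  shows "std_normal_density c * (b - a) \<le> measure std_normal {a<..b}"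
proof -
  have dens: "std_normal_density c \<le> std_normal_density z" if "z \<in> {a<..b}" for z
  proof -
    have "z\<^sup>2 \<le> c\<^sup>2" using that assms by (intro power_mono) auto
    then show ?thesis by (simp add: std_normal_density_def divide_right_mono)
  qed
  have "ennreal (std_normal_density c * (b - a)) = (\<integral>\<^sup>+z. ennreal (std_normal_density c) * indicator {a<..b} z \<partial>lborel)"
    using assms by (simp add: nn_integral_cmult_indicator ennreal_mult normal_density_nonneg)
  also have "\<dots> \<le> (\<integral>\<^sup>+z. ennreal (std_normal_density z) * indicator {a<..b} z \<partial>lborel)"
    using dens by (intro nn_integral_mono) (auto simp: indicator_def intro!: ennreal_leI)
  also have "\<dots> = emeasure std_normal {a<..b}" by (simp add: emeasure_density)
  finally show ?thesis by (simp add: std_normal.emeasure_eq_measure)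
qed

lemma std_normal_slab: "0 \<le> t \<Longrightarrow> measure std_normal {z. \<bar>\<bar>z\<bar> - c\<bar> \<le> t} \<le> 2 * t"
proof -
  assume t: "0 \<le> t"
  have "measure std_normal {z. \<bar>\<bar>z\<bar> - c\<bar> \<le> t} \<le> measure std_normal ({c - t..c + t} \<union> {- c - t..- c + t})"
    by (intro std_normal.finite_measure_mono) (auto simp: abs_if split: if_splits)
  also have "\<dots> \<le> measure std_normal {c - t..c + t} + measure std_normal {- c - t..- c + t}"
    by (rule measure_Un_le) auto
  also have "\<dots> \<le> (c + t - (c - t)) / 2 + (- c + t - (- c - t)) / 2"
    using t by (intro add_mono measure_std_normal_Icc_le) auto
  finally show ?thesis by simp
qed

lemma central_prob_le_add: "c \<le> c' \<Longrightarrow> central_prob c' \<le> central_prob c + (c' - c)"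
proof -
  assume c: "c \<le> c'"
  have "central_prob c' \<le> measure std_normal ({z. \<bar>z\<bar> \<le> c} \<union> {z. \<bar>\<bar>z\<bar> - (c + c') / 2\<bar> \<le> (c' - c) / 2})"
    unfolding central_prob_def
    by (intro std_normal.finite_measure_mono) (auto simp: abs_le_iff field_simps)
  also have "\<dots> \<le> central_prob c + measure std_normal {z. \<bar>\<bar>z\<bar> - (c + c') / 2\<bar> \<le> (c' - c) / 2}"
    unfolding central_prob_def by (rule measure_Un_le) auto
  also have "measure std_normal {z. \<bar>\<bar>z\<bar> - (c + c') / 2\<bar> \<le> (c' - c) / 2} \<le> 2 * ((c' - c) / 2)"
    using c by (intro std_normal_slab) auto
  finally show ?thesis by (simp add: diff_divide_distrib)
qed

text \<open>
  The density is decreasing on the positive axis, so \<open>[c, c']\<close> carries at least the density at \<open>K\<close>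
  times its length. This lower bound is what turns closeness of frequencies into closeness of
  quantiles.
\<close>

lemma central_prob_increase:
  assumes "0 \<le> c" "c \<le> c'" "c' \<le> K"
  shows "std_normal_density K * (c' - c) \<le> central_prob c' - central_prob c"
proof -
  have "central_prob c + measure std_normal {c<..c'} = measure std_normal ({z. \<bar>z\<bar> \<le> c} \<union> {c<..c'})"
    unfolding central_prob_def by (rule std_normal.finite_measure_Union[symmetric]) auto
  also have "\<dots> \<le> central_prob c'"
    unfolding central_prob_def using assms by (intro std_normal.finite_measure_mono) auto
  finally show ?thesis using measure_std_normal_Icc_ge[OF assms] by linarith
qed

lemma central_prob_cdf:
  assumes "0 \<le> c"
  shows "central_prob c = 2 * cdf std_normal c - 1"
proof -
  have refl: "distr std_normal borel uminus = std_normal"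
  proof (rule Levy_uniqueness)
    show "real_distribution (distr std_normal borel uminus)"
      by (rule std_normal.real_distribution_distr) simp
    show "char (distr std_normal borel uminus) = char std_normal"
    proof
      fix t :: real
      have "char (distr std_normal borel uminus) t = (CLINT z|std_normal. iexp (t * (- z)))"
        unfolding char_def by (rule integral_distr) simp_all
      also have "\<dots> = char std_normal (- t)" by (simp add: char_def)
      also have "\<dots> = char std_normal t" by (simp add: char_std_normal_distribution)
      finally show "char (distr std_normal borel uminus) t = char std_normal t" .
    qed
  qed (rule std_normal.real_distribution_axioms)
  have "measure std_normal {..<- c} = measure (distr std_normal borel uminus) {..<- c}" by (simp add: refl)
  also have "\<dots> = measure std_normal {c<..}"
    by (subst measure_distr) (auto intro!: arg_cong[where f = "measure std_normal"])
  also have "{c<..} = space std_normal - {..c}" by auto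
  also have "measure std_normal (space std_normal - {..c}) = 1 - cdf std_normal c"
    unfolding cdf_def by (rule std_normal.prob_compl) simp
  finally have neg: "measure std_normal {..<- c} = 1 - cdf std_normal c" .
  have "cdf std_normal c = measure std_normal ({z. \<bar>z\<bar> \<le> c} \<union> {..<- c})"
    unfolding cdf_def using assms by (intro arg_cong[where f = "measure std_normal"]) auto
  also have "\<dots> = central_prob c + measure std_normal {..<- c}"
    unfolding central_prob_def using assms by (intro std_normal.finite_measure_Union) auto
  finally show ?thesis using neg by simp
qed

lemma depth_beta_pos: "0 < depth_beta"
proof (rule ccontr)
  assume "\<not> 0 < depth_beta"
  then have "sqrt depth_beta \<le> 0" by simp
  then have "cdf std_normal (sqrt depth_beta) \<le> cdf std_normal 0" by (rule std_normal.cdf_nondecreasing)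
  moreover have "central_prob 0 = 0"
    using std_normal_slab[of 0 0] unfolding central_prob_def by (simp add: antisym)
  then have "cdf std_normal 0 = 1/2" using central_prob_cdf[of 0] by simp
  ultimately show False using cdf_sqrt_depth_beta by simp
qed

lemma central_prob_sqrt_depth_beta: "central_prob (sqrt depth_beta) = 1/2"
  using depth_beta_pos cdf_sqrt_depth_beta by (simp add: central_prob_cdf)

text \<open>
  The level \<open>7/8 = 1/2 + 3/8\<close> leaves room for the largest shift of frequencies, which is
  \<open>\<epsilon> / (1 - \<epsilon>) < 1/4\<close> plus a small fluctuation.
\<close>

lemma central_prob_large: "\<exists>K>sqrt depth_beta. 7/8 < central_prob K"
proof -
  have "\<forall>\<^sub>F y in at_top. 15/16 < cdf std_normal y"
    by (rule order_tendstoD(1)[OF std_normal.cdf_lim_at_top_prob]) simp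
  then obtain K0 where K0: "\<And>y. K0 \<le> y \<Longrightarrow> 15/16 < cdf std_normal y"
    by (auto simp: eventually_at_top_linorder)
  define K where "K = max K0 (sqrt depth_beta + 1)"
  have "0 \<le> K" using depth_beta_pos by (simp add: K_def le_max_iff_disj)
  then have "7/8 < central_prob K" using K0[of K] by (simp add: central_prob_cdf K_def)
  then show ?thesis by (intro exI[of _ K]) (auto simp: K_def)
qed

lemma std_normal_exp_square:
  "(\<integral>\<^sup>+z. ennreal (exp (z\<^sup>2 / 4)) \<partial>std_normal) = ennreal (sqrt 2)"
proof -
  have "(\<integral>\<^sup>+z. ennreal (exp (z\<^sup>2 / 4)) \<partial>std_normal) =
      (\<integral>\<^sup>+z. ennreal (std_normal_density z) * ennreal (exp (z\<^sup>2 / 4)) \<partial>lborel)"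
    by (rule nn_integral_density) auto
  also have "\<dots> = (\<integral>\<^sup>+z. ennreal (sqrt 2) * ennreal (normal_density 0 (sqrt 2) z) \<partial>lborel)"
  proof (rule nn_integral_cong)
    fix z :: real
    have "exp (- z\<^sup>2 / 2) * exp (z\<^sup>2 / 4) = exp (- z\<^sup>2 / 4)" by (simp add: exp_add[symmetric])
    then have "std_normal_density z * exp (z\<^sup>2 / 4) = sqrt 2 * normal_density 0 (sqrt 2) z"
      by (simp add: std_normal_density_def normal_density_def real_sqrt_mult field_simps)
    then show "ennreal (std_normal_density z) * ennreal (exp (z\<^sup>2 / 4)) =
        ennreal (sqrt 2) * ennreal (normal_density 0 (sqrt 2) z)"
      by (simp add: ennreal_mult'[symmetric] normal_density_nonneg)
  qed
  also have "\<dots> = ennreal (sqrt 2) * (\<integral>\<^sup>+z. ennreal (normal_density 0 (sqrt 2) z) \<partial>lborel)"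
    by (rule nn_integral_cmult) simp
  also have "(\<integral>\<^sup>+z. ennreal (normal_density 0 (sqrt 2) z) \<partial>lborel) = 1"
    by (subst nn_integral_eq_integral) (auto simp: integral_normal_density integrable_normal_density normal_density_nonneg)
  finally show ?thesis by simp
qed

text \<open>
  A density, bounded by one, of the sub-probability measure \<open>(1 - \<epsilon>) N(0, \<Sigma>)\<close> with respect to the
  contaminated law: the conditional probability, given the value of an observation, that it is not
  contaminated.
\<close>

definition clean_weight ::
    "nat \<Rightarrow> real \<Rightarrow> real mat \<Rightarrow> (nat \<Rightarrow> real) measure \<Rightarrow> ((nat \<Rightarrow> real) \<Rightarrow> real) \<Rightarrow> bool" where
  "clean_weight p \<epsilon> \<Sigma> Q w \<longleftrightarrow> w \<in> borel_measurable (contaminated p \<epsilon> \<Sigma> Q) \<and>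
    (\<forall>x. 0 \<le> w x \<and> w x \<le> 1) \<and>
    (\<forall>f\<in>borel_measurable (borel_space p).
      (\<integral>\<^sup>+x. ennreal (w x) * f x \<partial>contaminated p \<epsilon> \<Sigma> Q) = ennreal (1 - \<epsilon>) * (\<integral>\<^sup>+x. f x \<partial>mv_normal p \<Sigma>))"

lemma clean_weightD:
  assumes "clean_weight p \<epsilon> \<Sigma> Q w"
  shows "w \<in> borel_measurable (contaminated p \<epsilon> \<Sigma> Q)" "\<forall>x. 0 \<le> w x \<and> w x \<le> 1"
    "\<forall>f\<in>borel_measurable (borel_space p).
      (\<integral>\<^sup>+x. ennreal (w x) * f x \<partial>contaminated p \<epsilon> \<Sigma> Q) = ennreal (1 - \<epsilon>) * (\<integral>\<^sup>+x. f x \<partial>mv_normal p \<Sigma>)"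
  by (rule assms[unfolded clean_weight_def, THEN conjunct1],
      rule assms[unfolded clean_weight_def, THEN conjunct2, THEN conjunct1],
      rule assms[unfolded clean_weight_def, THEN conjunct2, THEN conjunct2])

text \<open>
  The clean component is dominated by the contaminated law, so a Radon--Nikodym density exists; it
  cannot exceed one on a set of positive measure, because there the component would be larger than
  the law that dominates it.
\<close>

lemma contaminated_weight:
  assumes \<Sigma>: "psd p \<Sigma>" and Q: "prob_space Q" "sets Q = sets (borel_space p)"
    and eps: "0 \<le> \<epsilon>" "\<epsilon> < 1"
  shows "\<exists>w. clean_weight p \<epsilon> \<Sigma> Q w"
proof -
  let ?P = "contaminated p \<epsilon> \<Sigma> Q" and ?N = "mv_normal p \<Sigma>"
  define N' where "N' = scale_measure (ennreal (1 - \<epsilon>)) ?N"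
  interpret P: prob_space ?P using assms by (intro prob_space_contaminated) auto
  interpret N: prob_space ?N by (rule prob_space_mv_normal[OF \<Sigma>])
  have sN': "sets N' = sets ?P" by (simp add: N'_def)
  have le: "emeasure N' A \<le> emeasure ?P A" if "A \<in> sets ?P" for A
  proof -
    have "A \<in> sets (borel_space p)" using that by simp
    then show ?thesis using that
      by (simp add: N'_def emeasure_contaminated[OF Q(2)])
  qed
  have "absolutely_continuous ?P N'"
    unfolding absolutely_continuous_def
  proof
    fix A assume A: "A \<in> null_sets ?P"
    then have A': "A \<in> sets ?P" "emeasure ?P A = 0" by (rule null_setsD2, rule null_setsD1)
    then have "emeasure N' A = 0" using le[OF A'(1)] by simp
    then show "A \<in> null_sets N'" using A'(1) sN' by (intro null_setsI) simp_all
  qed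
  then obtain g where g: "g \<in> borel_measurable ?P" "density ?P g = N'"
    using P.Radon_Nikodym[OF _ sN'] by blast
  have [measurable]: "g \<in> borel_measurable ?P" by (rule g)
  define B where "B = {x \<in> space ?P. 1 < g x}"
  have B: "B \<in> sets ?P" unfolding B_def by measurable
  have "AE x in ?P. g x \<le> 1"
  proof (rule ccontr)
    assume nae: "\<not> (AE x in ?P. g x \<le> 1)"
    have "emeasure ?P B \<noteq> 0"
    proof
      assume "emeasure ?P B = 0"
      then have "AE x in ?P. x \<notin> B" using B by (simp add: AE_iff_null_sets[symmetric] null_sets_def)
      then have "AE x in ?P. g x \<le> 1" by (rule AE_mp) (auto simp: B_def not_less intro!: AE_I2)
      then show False using nae by simp
    qed
    have "(\<integral>\<^sup>+x. indicator B x \<partial>?P) < (\<integral>\<^sup>+x. g x * indicator B x \<partial>?P)"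
    proof (rule nn_integral_less)
      show "(\<integral>\<^sup>+x. indicator B x \<partial>?P) \<noteq> \<infinity>" using B by simp
      show "AE x in ?P. indicator B x \<le> g x * indicator B x"
        by (auto simp: B_def indicator_def)
      show "\<not> (AE x in ?P. g x * indicator B x \<le> indicator B x)"
      proof
        assume "AE x in ?P. g x * indicator B x \<le> indicator B x"
        then have "AE x in ?P. g x \<le> 1"
          by (rule AE_mp) (auto simp: B_def indicator_def intro!: AE_I2 split: if_splits)
        then show False using nae by simp
      qed
    qed (use B in measurable)
    also have "(\<integral>\<^sup>+x. g x * indicator B x \<partial>?P) = emeasure N' B"
      using B by (simp add: g(2)[symmetric] emeasure_density)
    also have "\<dots> \<le> emeasure ?P B" by (rule le[OF B])
    finally show False using B by simp
  qed
  define w where "w = (\<lambda>x. enn2real (min (g x) 1))"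
  have wm: "w \<in> borel_measurable ?P" unfolding w_def by measurable
  have wb: "0 \<le> w x \<and> w x \<le> 1" for x
    unfolding w_def by (auto simp: enn2real_leI min_def)
  have wg: "AE x in ?P. ennreal (w x) = g x"
    using \<open>AE x in ?P. g x \<le> 1\<close>
  proof eventually_elim
    case (elim x)
    then have "g x < \<infinity>" by (rule le_less_trans) simp
    then show ?case using elim by (simp add: w_def min_absorb1)
  qed
  have "(\<integral>\<^sup>+x. ennreal (w x) * f x \<partial>?P) = ennreal (1 - \<epsilon>) * (\<integral>\<^sup>+x. f x \<partial>?N)"
    if f: "f \<in> borel_measurable (borel_space p)" for f
  proof -
    have fP: "f \<in> borel_measurable ?P" "f \<in> borel_measurable ?N"
      using f by (simp_all add: measurable_cong_sets[OF sets_contaminated refl] measurable_cong_sets[OF sets_mv_normal refl])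
    have "(\<integral>\<^sup>+x. ennreal (w x) * f x \<partial>?P) = (\<integral>\<^sup>+x. g x * f x \<partial>?P)"
      using wg by (intro nn_integral_cong_AE) auto
    also have "\<dots> = (\<integral>\<^sup>+x. f x \<partial>N')"
      unfolding g(2)[symmetric] by (rule nn_integral_density[symmetric, OF g(1) fP(1)])
    also have "\<dots> = ennreal (1 - \<epsilon>) * (\<integral>\<^sup>+x. f x \<partial>?N)"
      unfolding N'_def using fP(2) by (rule nn_integral_scale_measure)
    finally show ?thesis .
  qed
  then have "clean_weight p \<epsilon> \<Sigma> Q w"
    unfolding clean_weight_def using wm wb by (intro conjI allI ballI) auto
  then show ?thesis by blast
qed

section \<open>Quadratic forms of symmetric matrices\<close>

definition qform :: "nat \<Rightarrow> (nat \<Rightarrow> nat \<Rightarrow> real) \<Rightarrow> (nat \<Rightarrow> real) \<Rightarrow> real" where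
  "qform p \<sigma> v = (\<Sum>i<p. \<Sum>j<p. \<sigma> i j * (v i * v j))"

lemma abs_qform_le: "\<bar>qform p \<sigma> v\<bar> \<le> (\<Sum>i<p. \<Sum>j<p. \<bar>\<sigma> i j * (v i * v j)\<bar>)"
  unfolding qform_def by (rule order_trans[OF sum_abs sum_mono]) (rule sum_abs)

lemma scalar_prod_sum:
  "v \<in> carrier_vec p \<Longrightarrow> u \<bullet> v = (\<Sum>i<p. u $ i * v $ i :: real)"
  by (simp add: scalar_prod_def atLeast0LessThan)

lemma mult_mat_vec_nth:
  "A \<in> carrier_mat p p \<Longrightarrow> v \<in> carrier_vec p \<Longrightarrow> i < p \<Longrightarrow> (A *\<^sub>v v) $ i = (\<Sum>j<p. A $$ (i, j) * v $ j :: real)"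
  by (simp add: scalar_prod_def atLeast0LessThan)

lemma smult_mat_mult_vec:
  "A \<in> carrier_mat p p \<Longrightarrow> v \<in> carrier_vec p \<Longrightarrow> (c \<cdot>\<^sub>m A) *\<^sub>v v = c \<cdot>\<^sub>v (A *\<^sub>v v :: real Matrix.vec)"
  by (intro eq_vecI) (auto simp: scalar_prod_def sum_distrib_left mult.assoc)

lemma form_eq_qform:
  assumes "A \<in> carrier_mat p p" "v \<in> carrier_vec p"
  shows "v \<bullet> (A *\<^sub>v v) = qform p (\<lambda>i j. A $$ (i, j)) (\<lambda>i. v $ i)"
proof -
  have "v \<bullet> (A *\<^sub>v v) = (\<Sum>i<p. v $ i * (A *\<^sub>v v) $ i)"
    using assms by (intro scalar_prod_sum) auto
  also have "\<dots> = (\<Sum>i<p. v $ i * (\<Sum>j<p. A $$ (i, j) * v $ j))"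
    using assms by (intro sum.cong) (auto simp del: index_mult_mat_vec simp: mult_mat_vec_nth)
  also have "\<dots> = qform p (\<lambda>i j. A $$ (i, j)) (\<lambda>i. v $ i)"
    unfolding qform_def sum_distrib_left by (intro sum.cong) (auto simp: mult_ac)
  finally show ?thesis .
qed

lemma scalar_prod_self: "v \<in> carrier_vec p \<Longrightarrow> v \<bullet> v = (\<Sum>i<p. (v $ i)\<^sup>2 :: real)"
  by (simp add: scalar_prod_sum power2_eq_square)

lemma scalar_prod_self_nonneg: "0 \<le> v \<bullet> (v :: real Matrix.vec)"
  by (simp add: scalar_prod_def sum_nonneg)

lemma enorm_sq: "(enorm v)\<^sup>2 = v \<bullet> v"
  by (simp add: enorm_def scalar_prod_self_nonneg)

lemma unit_sphere_iff: "v \<in> unit_sphere p \<longleftrightarrow> v \<in> carrier_vec p \<and> v \<bullet> v = 1"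
  by (auto simp: unit_sphere_def enorm_def)

lemma unit_sphere_nonempty: "1 \<le> p \<Longrightarrow> unit_sphere p \<noteq> {}"
proof -
  assume p: "1 \<le> p"
  have "unit_vec p 0 \<in> unit_sphere p" using p by (simp add: unit_sphere_iff)
  then show ?thesis by blast
qed

lemma normalize_vec:
  fixes v :: "real Matrix.vec"
  assumes "v \<in> carrier_vec p" "v \<bullet> v \<noteq> 0"
  shows "(1 / enorm v) \<cdot>\<^sub>v v \<in> unit_sphere p"
proof -
  have "(1 / enorm v) * ((1 / enorm v) * (v \<bullet> v)) = 1"
    using assms enorm_sq[of v] by (auto simp: field_simps power2_eq_square)
  then show ?thesis using assms
    by (simp add: unit_sphere_iff smult_scalar_prod_distrib[of _ p] scalar_prod_smult_distrib[of _ p])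
qed

lemma form_smult:
  assumes "A \<in> carrier_mat p p" "v \<in> carrier_vec p"
  shows "(c \<cdot>\<^sub>v v) \<bullet> (A *\<^sub>v (c \<cdot>\<^sub>v v)) = c\<^sup>2 * (v \<bullet> (A *\<^sub>v v) :: real)"
proof -
  have "A *\<^sub>v v \<in> carrier_vec p" using assms by (rule mult_mat_vec_carrier)
  then show ?thesis using assms
    by (simp add: mult_mat_vec[of _ p p] smult_scalar_prod_distrib[of _ p] scalar_prod_smult_distrib[of _ p] power2_eq_square)
qed

lemma form_ge_of_sphere:
  assumes A: "A \<in> carrier_mat p p" and v: "v \<in> carrier_vec p"
    and m: "\<And>u. u \<in> unit_sphere p \<Longrightarrow> m \<le> u \<bullet> (A *\<^sub>v u)"
  shows "m * (v \<bullet> v) \<le> v \<bullet> (A *\<^sub>v v)"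
proof (cases "v \<bullet> v = 0")
  case True
  then have "\<forall>i<p. v $ i = 0" using v by (simp add: scalar_prod_self sum_nonneg_eq_0_iff)
  then have "v = 0\<^sub>v p" using v by (intro eq_vecI) auto
  then show ?thesis using A by simp
next
  case False
  then have pos: "0 < v \<bullet> v" using scalar_prod_self_nonneg[of v] by linarith
  have "m \<le> (1 / enorm v)\<^sup>2 * (v \<bullet> (A *\<^sub>v v))"
    using m[OF normalize_vec[OF v False]] form_smult[OF A v] by simp
  then have "m \<le> (v \<bullet> (A *\<^sub>v v)) / (v \<bullet> v)" by (simp add: power_divide enorm_sq)
  then show ?thesis using pos by (simp add: pos_le_divide_eq)
qed

lemma mult_vec_norm_le:
  assumes C: "C \<in> carrier_mat p p" and v: "v \<in> carrier_vec p"
  shows "(C *\<^sub>v v) \<bullet> (C *\<^sub>v v) \<le> (\<Sum>i<p. \<Sum>j<p. (C $$ (i, j))\<^sup>2) * (v \<bullet> v :: real)"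
proof -
  have "(C *\<^sub>v v) \<bullet> (C *\<^sub>v v) = (\<Sum>i<p. ((C *\<^sub>v v) $ i)\<^sup>2)"
    using C v by (intro scalar_prod_self) auto
  also have "\<dots> = (\<Sum>i<p. (\<Sum>j<p. C $$ (i, j) * v $ j)\<^sup>2)"
    using C v by (intro sum.cong) (auto simp del: index_mult_mat_vec simp: mult_mat_vec_nth)
  also have "\<dots> \<le> (\<Sum>i<p. (\<Sum>j<p. (C $$ (i, j))\<^sup>2) * (\<Sum>j<p. (v $ j)\<^sup>2))"
    by (intro sum_mono Cauchy_Schwarz_ineq_sum)
  finally show ?thesis using v by (simp add: scalar_prod_self sum_distrib_right)
qed

text \<open>
  A nonsingular positive semidefinite matrix \<open>B B\<^sup>T\<close> has \<open>v\<^sup>T B B\<^sup>T v = |B\<^sup>T v|\<^sup>2 \<ge> |v|\<^sup>2 / K\<close>, where \<open>K\<close> is the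
  squared Frobenius norm of the inverse of \<open>B\<^sup>T\<close>. This algebraic argument takes the place of
  compactness of the sphere.
\<close>

lemma psd_degenerate_singular:
  assumes A: "psd p A" and deg: "\<And>e. 0 < e \<Longrightarrow> \<exists>v\<in>unit_sphere p. v \<bullet> (A *\<^sub>v v) < e"
  shows "\<exists>x\<in>carrier_vec p. x \<noteq> 0\<^sub>v p \<and> A *\<^sub>v x = 0\<^sub>v p"
proof (rule ccontr)
  assume no: "\<not> ?thesis"
  have Ac: "A \<in> carrier_mat p p" using A by (simp add: psd_def)
  obtain B where B: "B \<in> carrier_mat p p" "B * transpose_mat B = A"
    using psd_factor_exists[OF A] by blast
  have "det A \<noteq> 0" using no det_0_iff_vec_prod_zero_field[OF Ac] by blast
  moreover have "det A = det B * det (transpose_mat B)"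
    using B by (metis det_mult transpose_carrier_mat)
  ultimately have d: "det (transpose_mat B) \<noteq> 0" by simp
  have Bt: "transpose_mat B \<in> carrier_mat p p" using B by simp
  obtain C where C: "C \<in> carrier_mat p p" "C * transpose_mat B = 1\<^sub>m p"
    using det_non_zero_imp_unit[OF Bt d, of "()"] unfolding Units_def ring_mat_def by auto
  define K where "K = (\<Sum>i<p. \<Sum>j<p. (C $$ (i, j))\<^sup>2)"
  have K0: "0 \<le> K" unfolding K_def by (intro sum_nonneg) auto
  obtain v where v: "v \<in> unit_sphere p" "v \<bullet> (A *\<^sub>v v) < 1 / (K + 1)"
    using deg[of "1 / (K + 1)"] K0 by auto
  have vc: "v \<in> carrier_vec p" and v1: "v \<bullet> v = 1" using v by (auto simp: unit_sphere_iff)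
  define y where "y = transpose_mat B *\<^sub>v v"
  have y: "y \<in> carrier_vec p" unfolding y_def using Bt vc by (rule mult_mat_vec_carrier)
  have "C *\<^sub>v y = (C * transpose_mat B) *\<^sub>v v" unfolding y_def using C(1) Bt vc by (rule assoc_mult_mat_vec[symmetric])
  also have "\<dots> = v" using C(2) vc by simp
  finally have Cy: "C *\<^sub>v y = v" .
  have "v \<bullet> (A *\<^sub>v v) = v \<bullet> (B *\<^sub>v y)"
    unfolding y_def B(2)[symmetric] using B(1) Bt vc by (subst assoc_mult_mat_vec) auto
  also have "\<dots> = y \<bullet> y"
    using transpose_vec_mult_scalar[OF B(1) y vc] by (simp add: y_def)
  finally have "y \<bullet> y < 1 / (K + 1)" using v(2) by simp
  have "1 \<le> K * (y \<bullet> y)" using mult_vec_norm_le[OF C(1) y] v1 unfolding Cy K_def by simp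
  also have "\<dots> \<le> K * (1 / (K + 1))" using \<open>y \<bullet> y < 1 / (K + 1)\<close> K0 by (intro mult_left_mono) auto
  also have "\<dots> < 1" using K0 by simp
  finally show False by simp
qed

text \<open>
  For the infimum \<open>m\<close> of the form over the sphere, \<open>S - m I\<close> is positive semidefinite with values
  arbitrarily close to zero on the sphere, hence singular.
\<close>

lemma minimal_eigenvector:
  assumes S: "S \<in> carrier_mat p p" "transpose_mat S = S" and p: "1 \<le> p"
  shows "\<exists>m::real. (\<forall>v\<in>carrier_vec p. m * (v \<bullet> v) \<le> v \<bullet> (S *\<^sub>v v)) \<and>
    (\<exists>x\<in>carrier_vec p. x \<noteq> 0\<^sub>v p \<and> S *\<^sub>v x = m \<cdot>\<^sub>v x)"
proof -
  define F where "F = (\<lambda>v. v \<bullet> (S *\<^sub>v v)) ` unit_sphere p"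
  have Fne: "F \<noteq> {}" using unit_sphere_nonempty[OF p] by (simp add: F_def)
  have bdd: "bdd_below F"
  proof (rule bdd_belowI)
    fix y assume "y \<in> F"
    then obtain v where v: "v \<in> carrier_vec p" "v \<bullet> v = 1" "y = v \<bullet> (S *\<^sub>v v)"
      by (auto simp: F_def unit_sphere_iff)
    have vi: "\<bar>v $ i\<bar> \<le> 1" if "i < p" for i
    proof -
      have "(v $ i)\<^sup>2 \<le> (\<Sum>i<p. (v $ i)\<^sup>2)" using that by (intro member_le_sum) auto
      then show ?thesis using v scalar_prod_self[OF v(1)] by (simp add: abs_square_le_1)
    qed
    have "- y \<le> \<bar>qform p (\<lambda>i j. S $$ (i, j)) (\<lambda>i. v $ i)\<bar>"
      using v form_eq_qform[OF S(1) v(1)] by simp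
    also have "\<dots> \<le> (\<Sum>i<p. \<Sum>j<p. \<bar>S $$ (i, j) * (v $ i * v $ j)\<bar>)"
      by (rule abs_qform_le)
    also have "\<dots> \<le> (\<Sum>i<p. \<Sum>j<p. \<bar>S $$ (i, j)\<bar> * (1 * 1))"
      unfolding abs_mult using vi by (intro sum_mono mult_left_mono mult_mono) auto
    finally show "- (\<Sum>i<p. \<Sum>j<p. \<bar>S $$ (i, j)\<bar> * (1 * 1)) \<le> y" by linarith
  qed
  define m where "m = Inf F"
  have m: "m \<le> v \<bullet> (S *\<^sub>v v)" if "v \<in> unit_sphere p" for v
    unfolding m_def using that bdd by (intro cInf_lower) (auto simp: F_def)
  define A where "A = S - m \<cdot>\<^sub>m 1\<^sub>m p"
  have A: "A \<in> carrier_mat p p" using S by (auto simp: A_def)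
  have Av: "A *\<^sub>v v = S *\<^sub>v v - m \<cdot>\<^sub>v v" if "v \<in> carrier_vec p" for v
  proof -
    have "(m \<cdot>\<^sub>m 1\<^sub>m p) *\<^sub>v v = m \<cdot>\<^sub>v v"
      using that by (simp add: smult_mat_mult_vec[of _ p])
    then show ?thesis unfolding A_def using S that by (subst minus_mult_distrib_mat_vec[of _ p p]) auto
  qed
  have Aform: "v \<bullet> (A *\<^sub>v v) = v \<bullet> (S *\<^sub>v v) - m * (v \<bullet> v)" if "v \<in> carrier_vec p" for v
    unfolding Av[OF that] using S that
    by (subst scalar_prod_minus_distrib[of _ p]) (auto intro: mult_mat_vec_carrier simp: scalar_prod_smult_distrib[of _ p])
  have ge: "m * (v \<bullet> v) \<le> v \<bullet> (S *\<^sub>v v)" if "v \<in> carrier_vec p" for v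
    using S(1) that m by (rule form_ge_of_sphere)
  have "psd p A" unfolding psd_def
  proof (intro conjI ballI)
    have "S $$ (i, j) = S $$ (j, i)" if "i < p" "j < p" for i j
      using arg_cong[OF S(2), of "\<lambda>A. A $$ (i, j)"] S(1) that by simp
    then show "transpose_mat A = A" using S(1) unfolding A_def by (intro eq_matI) auto
    show "0 \<le> v \<bullet> (A *\<^sub>v v)" if "v \<in> carrier_vec p" for v
      using Aform[OF that] ge[OF that] by simp
  qed (rule A)
  moreover have "\<exists>v\<in>unit_sphere p. v \<bullet> (A *\<^sub>v v) < e" if "0 < e" for e
  proof -
    have "\<exists>y\<in>F. y < m + e" using that Fne bdd by (subst cInf_less_iff[symmetric]) (auto simp: m_def)
    then obtain v where v: "v \<in> unit_sphere p" "v \<bullet> (S *\<^sub>v v) < m + e" by (auto simp: F_def)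
    then show ?thesis using Aform[of v] by (intro bexI[of _ v]) (auto simp: unit_sphere_iff)
  qed
  ultimately obtain x where x: "x \<in> carrier_vec p" "x \<noteq> 0\<^sub>v p" "A *\<^sub>v x = 0\<^sub>v p"
    using psd_degenerate_singular by blast
  have "S *\<^sub>v x = m \<cdot>\<^sub>v x"
  proof (rule eq_vecI)
    fix i assume "i < dim_vec (m \<cdot>\<^sub>v x)"
    then have i: "i < p" using x by simp
    have "(S *\<^sub>v x - m \<cdot>\<^sub>v x) $ i = 0" using x i Av[OF x(1)] by simp
    then show "(S *\<^sub>v x) $ i = (m \<cdot>\<^sub>v x) $ i" using x(1) S(1) i by simp
  qed (use S x in auto)
  then show ?thesis using ge x by blast
qed

lemma eigenvalue_abs_singular_value:
  assumes S: "S \<in> carrier_mat p p" "transpose_mat S = S"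
    and x: "x \<in> carrier_vec p" "x \<noteq> 0\<^sub>v p" "S *\<^sub>v x = m \<cdot>\<^sub>v x"
  shows "finite (singular_values S)" "\<bar>m\<bar> \<in> singular_values S"
proof -
  have SS: "transpose_mat S * S \<in> carrier_mat p p" using S by simp
  show "finite (singular_values S)"
    unfolding singular_values_def using card_finite_spectrum(1)[OF SS] by simp
  have "(transpose_mat S * S) *\<^sub>v x = S *\<^sub>v (S *\<^sub>v x)"
    using S x by (simp add: assoc_mult_mat_vec[of _ p p _ p])
  also have "\<dots> = (m * m) \<cdot>\<^sub>v x"
    unfolding x(3) using S x by (simp add: mult_mat_vec[of _ p p] smult_smult_assoc)
  finally have "eigenvector (transpose_mat S * S) x (m * m)"
    unfolding eigenvector_def using SS x by auto
  then have "m * m \<in> spectrum (transpose_mat S * S)"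
    unfolding spectrum_def eigenvalue_def by blast
  then show "\<bar>m\<bar> \<in> singular_values S"
    unfolding singular_values_def by (intro image_eqI[of _ _ "m * m"]) auto
qed

text \<open>
  The extreme values of the form on the sphere are eigenvalues, by \<open>minimal_eigenvector\<close> for \<open>\<Sigma>\<close> and
  for \<open>-\<Sigma>\<close>, and the absolute value of an eigenvalue of a symmetric matrix is a singular value.
\<close>

lemma psd_form_bounds:
  assumes S: "psd p \<Sigma>" and p: "1 \<le> p" and v: "v \<in> carrier_vec p"
  shows "s_min \<Sigma> * (v \<bullet> v) \<le> v \<bullet> (\<Sigma> *\<^sub>v v)" "v \<bullet> (\<Sigma> *\<^sub>v v) \<le> s_max \<Sigma> * (v \<bullet> v)"
proof -
  have Sc: "\<Sigma> \<in> carrier_mat p p" "transpose_mat \<Sigma> = \<Sigma>" using S by (auto simp: psd_def)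
  obtain m x where m: "\<forall>v\<in>carrier_vec p. m * (v \<bullet> v) \<le> v \<bullet> (\<Sigma> *\<^sub>v v)"
    and x: "x \<in> carrier_vec p" "x \<noteq> 0\<^sub>v p" "\<Sigma> *\<^sub>v x = m \<cdot>\<^sub>v x"
    using minimal_eigenvector[OF Sc p] by blast
  have "0 < x \<bullet> x"
  proof -
    have "\<exists>i<p. x $ i \<noteq> 0"
    proof (rule ccontr)
      assume "\<not> (\<exists>i<p. x $ i \<noteq> 0)"
      then have "x = 0\<^sub>v p" using x(1) by (intro eq_vecI) auto
      then show False using x(2) by simp
    qed
    then have "x \<bullet> x \<noteq> 0" using x(1) by (auto simp: scalar_prod_self sum_nonneg_eq_0_iff)
    then show ?thesis using scalar_prod_self_nonneg[of x] by linarith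
  qed
  moreover have "0 \<le> m * (x \<bullet> x)"
    using S x unfolding psd_def by (metis scalar_prod_smult_distrib)
  ultimately have "0 \<le> m" by (simp add: zero_le_mult_iff)
  then have "m \<in> singular_values \<Sigma>" using eigenvalue_abs_singular_value(2)[OF Sc x] by simp
  then have "s_min \<Sigma> \<le> m"
    unfolding s_min_def using eigenvalue_abs_singular_value(1)[OF Sc x] by (intro Min_le)
  then have "s_min \<Sigma> * (v \<bullet> v) \<le> m * (v \<bullet> v)"
    using scalar_prod_self_nonneg by (intro mult_right_mono)
  then show "s_min \<Sigma> * (v \<bullet> v) \<le> v \<bullet> (\<Sigma> *\<^sub>v v)" using m v by force
  define T where "T = (-1) \<cdot>\<^sub>m \<Sigma>"
  have Tc: "T \<in> carrier_mat p p" "transpose_mat T = T"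
  proof -
    show "T \<in> carrier_mat p p" using Sc by (simp add: T_def)
    have "\<Sigma> $$ (i, j) = \<Sigma> $$ (j, i)" if "i < p" "j < p" for i j
      using arg_cong[OF Sc(2), of "\<lambda>A. A $$ (i, j)"] Sc(1) that by simp
    then show "transpose_mat T = T" unfolding T_def using Sc(1) by (intro eq_matI) auto
  qed
  have Tv: "T *\<^sub>v y = (-1) \<cdot>\<^sub>v (\<Sigma> *\<^sub>v y)" if "y \<in> carrier_vec p" for y
    unfolding T_def using Sc(1) that by (intro eq_vecI) (auto simp: scalar_prod_def sum_negf)
  obtain m' x' where m': "\<forall>v\<in>carrier_vec p. m' * (v \<bullet> v) \<le> v \<bullet> (T *\<^sub>v v)"
    and x': "x' \<in> carrier_vec p" "x' \<noteq> 0\<^sub>v p" "T *\<^sub>v x' = m' \<cdot>\<^sub>v x'"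
    using minimal_eigenvector[OF Tc p] by blast
  have "\<Sigma> *\<^sub>v x' = (- m') \<cdot>\<^sub>v x'"
  proof -
    have "(-1) \<cdot>\<^sub>v ((-1) \<cdot>\<^sub>v (\<Sigma> *\<^sub>v x')) = (-1) \<cdot>\<^sub>v (m' \<cdot>\<^sub>v x')" using x'(3) Tv[OF x'(1)] by simp
    then show ?thesis by (simp add: smult_smult_assoc)
  qed
  then have "\<bar>- m'\<bar> \<in> singular_values \<Sigma>" by (rule eigenvalue_abs_singular_value(2)[OF Sc x'(1,2)])
  then have "\<bar>- m'\<bar> \<le> s_max \<Sigma>"
    unfolding s_max_def using eigenvalue_abs_singular_value(1)[OF Sc x] by (intro Max_ge)
  then have "- m' * (v \<bullet> v) \<le> s_max \<Sigma> * (v \<bullet> v)"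
    using scalar_prod_self_nonneg by (intro mult_right_mono) auto
  moreover have "v \<bullet> (T *\<^sub>v v) = - (v \<bullet> (\<Sigma> *\<^sub>v v))"
    using Tv[OF v] v Sc(1) by (simp add: scalar_prod_smult_distrib[of _ p])
  ultimately show "v \<bullet> (\<Sigma> *\<^sub>v v) \<le> s_max \<Sigma> * (v \<bullet> v)" using m' v by force
qed

text \<open>
  Polarization: with \<open>y = D u\<close> and \<open>r = |y|\<close>, the difference of the form at \<open>y + r u\<close> and \<open>y - r u\<close> is
  \<open>4 r\<^sup>3\<close>, while the parallelogram law bounds it by \<open>4 e r\<^sup>2\<close>.
\<close>

lemma op_norm_le:
  assumes D: "D \<in> carrier_mat p p" "transpose_mat D = D" and p: "1 \<le> p" and e: "0 \<le> e"
    and form: "\<And>v. v \<in> carrier_vec p \<Longrightarrow> \<bar>v \<bullet> (D *\<^sub>v v)\<bar> \<le> e * (v \<bullet> v)"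
  shows "0 \<le> op_norm p D" "op_norm p D \<le> e"
proof -
  have le: "enorm (D *\<^sub>v u) \<le> e" if u: "u \<in> unit_sphere p" for u
  proof -
    have uc: "u \<in> carrier_vec p" and u1: "u \<bullet> u = 1" using u by (auto simp: unit_sphere_iff)
    define y where "y = D *\<^sub>v u"
    have y: "y \<in> carrier_vec p" unfolding y_def using D(1) uc by (rule mult_mat_vec_carrier)
    define r where "r = enorm y"
    have r0: "0 \<le> r" unfolding r_def enorm_def by (intro real_sqrt_ge_zero scalar_prod_self_nonneg)
    have r2: "y \<bullet> y = r\<^sup>2" unfolding r_def enorm_sq ..
    show ?thesis
    proof (cases "r = 0")
      case True
      then show ?thesis using e by (simp add: r_def y_def)
    next
      case False
      then have r: "0 < r" using r0 by simp
      have ru: "r \<cdot>\<^sub>v u \<in> carrier_vec p" using uc by simp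
      have Dy: "D *\<^sub>v y \<in> carrier_vec p" using D(1) y by (rule mult_mat_vec_carrier)
      have sym: "u \<bullet> (D *\<^sub>v y) = y \<bullet> y"
        using transpose_vec_mult_scalar[OF D(1) y uc] unfolding D(2) by (simp add: y_def)
      have Dru: "D *\<^sub>v (r \<cdot>\<^sub>v u) = r \<cdot>\<^sub>v y" unfolding y_def using D(1) uc by (simp add: mult_mat_vec[of _ p p])
      have plus: "(y + r \<cdot>\<^sub>v u) \<bullet> (D *\<^sub>v (y + r \<cdot>\<^sub>v u)) = y \<bullet> (D *\<^sub>v y) + 2 * r * r\<^sup>2 + r\<^sup>2 * (u \<bullet> y)"
      proof -
        have "D *\<^sub>v (y + r \<cdot>\<^sub>v u) = D *\<^sub>v y + r \<cdot>\<^sub>v y"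
          using D(1) y ru by (subst mult_add_distrib_mat_vec[of _ p p]) (auto simp: Dru)
        then show ?thesis using y uc Dy
          by (simp add: add_scalar_prod_distrib[of _ p] scalar_prod_add_distrib[of _ p] sym r2
              smult_scalar_prod_distrib[of _ p] scalar_prod_smult_distrib[of _ p] algebra_simps power2_eq_square)
      qed
      have minus: "(y - r \<cdot>\<^sub>v u) \<bullet> (D *\<^sub>v (y - r \<cdot>\<^sub>v u)) = y \<bullet> (D *\<^sub>v y) - 2 * r * r\<^sup>2 + r\<^sup>2 * (u \<bullet> y)"
      proof -
        have "D *\<^sub>v (y - r \<cdot>\<^sub>v u) = D *\<^sub>v y - r \<cdot>\<^sub>v y"
          using D(1) y ru by (subst mult_minus_distrib_mat_vec[of _ p p]) (auto simp: Dru)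
        then show ?thesis using y uc Dy
          by (simp add: minus_scalar_prod_distrib[of _ p] scalar_prod_minus_distrib[of _ p] sym r2
              smult_scalar_prod_distrib[of _ p] scalar_prod_smult_distrib[of _ p] algebra_simps power2_eq_square)
      qed
      have np: "(y + r \<cdot>\<^sub>v u) \<bullet> (y + r \<cdot>\<^sub>v u) = 2 * r\<^sup>2 + 2 * r * (u \<bullet> y)"
        using y uc comm_scalar_prod[OF y uc]
        by (simp add: add_scalar_prod_distrib[of _ p] scalar_prod_add_distrib[of _ p] r2 u1
              smult_scalar_prod_distrib[of _ p] scalar_prod_smult_distrib[of _ p] algebra_simps power2_eq_square)
      have nm: "(y - r \<cdot>\<^sub>v u) \<bullet> (y - r \<cdot>\<^sub>v u) = 2 * r\<^sup>2 - 2 * r * (u \<bullet> y)"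
        using y uc comm_scalar_prod[OF y uc]
        by (simp add: minus_scalar_prod_distrib[of _ p] scalar_prod_minus_distrib[of _ p] r2 u1
              smult_scalar_prod_distrib[of _ p] scalar_prod_smult_distrib[of _ p] algebra_simps power2_eq_square)
      have "4 * r * r\<^sup>2 = (y + r \<cdot>\<^sub>v u) \<bullet> (D *\<^sub>v (y + r \<cdot>\<^sub>v u)) - (y - r \<cdot>\<^sub>v u) \<bullet> (D *\<^sub>v (y - r \<cdot>\<^sub>v u))"
        unfolding plus minus by simp
      also have "\<dots> \<le> e * (2 * r\<^sup>2 + 2 * r * (u \<bullet> y)) + e * (2 * r\<^sup>2 - 2 * r * (u \<bullet> y))"
        using form[of "y + r \<cdot>\<^sub>v u"] form[of "y - r \<cdot>\<^sub>v u"] y ru unfolding np nm by (simp add: abs_le_iff)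
      also have "\<dots> = 4 * e * r\<^sup>2" by (simp add: algebra_simps)
      finally have "r * (4 * r\<^sup>2) \<le> e * (4 * r\<^sup>2)" by simp
      then have "r \<le> e" using r by (simp add: mult_le_cancel_right)
      then show ?thesis by (simp add: r_def y_def)
    qed
  qed
  obtain u where u: "u \<in> unit_sphere p" using unit_sphere_nonempty[OF p] by blast
  have "0 \<le> enorm (D *\<^sub>v u)" unfolding enorm_def by (intro real_sqrt_ge_zero scalar_prod_self_nonneg)
  also have "\<dots> \<le> op_norm p D"
    unfolding op_norm_def using u le by (intro cSUP_upper bdd_aboveI2) auto
  finally show "0 \<le> op_norm p D" .
  show "op_norm p D \<le> e"
    unfolding op_norm_def using le unit_sphere_nonempty[OF p] by (intro cSUP_least) auto
qed

text \<open>
  Schur's test: \<open>|v\<^sub>i v\<^sub>j| \<le> (v\<^sub>i\<^sup>2 + v\<^sub>j\<^sup>2) / 2\<close>.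
\<close>

lemma qform_abs_le_row_sums:
  assumes sym: "\<And>i j. i < p \<Longrightarrow> j < p \<Longrightarrow> \<sigma> i j = \<sigma> j i"
    and row: "\<And>j. j < p \<Longrightarrow> (\<Sum>i<p. \<bar>\<sigma> i j\<bar>) \<le> r"
  shows "\<bar>qform p \<sigma> v\<bar> \<le> r * (\<Sum>i<p. (v i)\<^sup>2)"
proof -
  have "\<bar>qform p \<sigma> v\<bar> \<le> (\<Sum>i<p. \<Sum>j<p. \<bar>\<sigma> i j * (v i * v j)\<bar>)"
    by (rule abs_qform_le)
  also have "\<dots> \<le> (\<Sum>i<p. \<Sum>j<p. \<bar>\<sigma> i j\<bar> * ((v i)\<^sup>2 / 2) + \<bar>\<sigma> i j\<bar> * ((v j)\<^sup>2 / 2))"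
  proof (intro sum_mono)
    fix i j
    have "\<bar>v i * v j\<bar> \<le> (v i)\<^sup>2 / 2 + (v j)\<^sup>2 / 2"
      using sum_squares_bound[of "\<bar>v i\<bar>" "\<bar>v j\<bar>"] by (simp add: abs_mult)
    then have "\<bar>\<sigma> i j\<bar> * \<bar>v i * v j\<bar> \<le> \<bar>\<sigma> i j\<bar> * ((v i)\<^sup>2 / 2 + (v j)\<^sup>2 / 2)"
      by (intro mult_left_mono) auto
    then show "\<bar>\<sigma> i j * (v i * v j)\<bar> \<le> \<bar>\<sigma> i j\<bar> * ((v i)\<^sup>2 / 2) + \<bar>\<sigma> i j\<bar> * ((v j)\<^sup>2 / 2)"
      by (simp add: abs_mult distrib_left)
  qed
  also have "\<dots> = (\<Sum>i<p. \<Sum>j<p. \<bar>\<sigma> i j\<bar> * ((v i)\<^sup>2 / 2)) + (\<Sum>i<p. \<Sum>j<p. \<bar>\<sigma> i j\<bar> * ((v j)\<^sup>2 / 2))"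
    by (simp only: sum.distrib)
  also have "(\<Sum>i<p. \<Sum>j<p. \<bar>\<sigma> i j\<bar> * ((v i)\<^sup>2 / 2)) = (\<Sum>j<p. \<Sum>i<p. \<bar>\<sigma> i j\<bar> * ((v j)\<^sup>2 / 2))"
    using sym by (intro sum.cong refl) auto
  also have "(\<Sum>i<p. \<Sum>j<p. \<bar>\<sigma> i j\<bar> * ((v j)\<^sup>2 / 2)) = (\<Sum>j<p. \<Sum>i<p. \<bar>\<sigma> i j\<bar> * ((v j)\<^sup>2 / 2))"
    by (rule sum.swap)
  also have "(\<Sum>j<p. \<Sum>i<p. \<bar>\<sigma> i j\<bar> * ((v j)\<^sup>2 / 2)) + (\<Sum>j<p. \<Sum>i<p. \<bar>\<sigma> i j\<bar> * ((v j)\<^sup>2 / 2))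
      = (\<Sum>j<p. (\<Sum>i<p. \<bar>\<sigma> i j\<bar>) * (v j)\<^sup>2)"
    by (simp add: sum_distrib_right[symmetric] sum.distrib[symmetric])
  also have "\<dots> \<le> (\<Sum>j<p. r * (v j)\<^sup>2)"
    using row by (intro sum_mono mult_right_mono) auto
  finally show ?thesis by (simp add: sum_distrib_left)
qed

text \<open>
  Cut the coordinates into blocks of length \<open>k\<close> and let \<open>y\<^sub>a\<close> be the restriction of \<open>v\<close> to block \<open>a\<close>.
  A matrix of bandwidth \<open>k\<close> couples only equal or adjacent blocks, so its form \<open>q\<close> satisfies
  \<open>q v = \<Sum>\<^sub>a (q (y\<^sub>a + y\<^sub>a\<^sub>+\<^sub>1) - q y\<^sub>a\<^sub>+\<^sub>1)\<close>, and every vector on the right lives in a window of length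
  \<open>2k\<close>. Each coordinate occurs in at most three of these vectors, whence the factor three.
\<close>

lemma qform_banded_le:
  fixes \<sigma> :: "nat \<Rightarrow> nat \<Rightarrow> real"
  assumes band: "\<And>i j. i < p \<Longrightarrow> j < p \<Longrightarrow> \<bar>int i - int j\<bar> > int k \<Longrightarrow> \<sigma> i j = 0"
    and k: "1 \<le> k" "2 * k \<le> p" and e: "0 \<le> e"
    and win: "\<And>l v. l \<le> p - 2 * k \<Longrightarrow> (\<And>i. i < p \<Longrightarrow> i \<notin> {l..l + 2 * k - 1} \<Longrightarrow> v i = 0) \<Longrightarrow>
      \<bar>qform p \<sigma> v\<bar> \<le> e * (\<Sum>i<p. (v i)\<^sup>2)"
  shows "\<bar>qform p \<sigma> v\<bar> \<le> 3 * e * (\<Sum>i<p. (v i)\<^sup>2)"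
proof -
  define y where "y = (\<lambda>a i. if i div k = a then v i else 0 :: real)"
  define N where "N = Suc ((p - 1) div k)"
  have blk: "i div k < N" if "i < p" for i
    using that by (auto simp: N_def less_Suc_eq_le intro: div_le_mono)
  have winblk: "\<bar>qform p \<sigma> z\<bar> \<le> e * (\<Sum>i<p. (z i)\<^sup>2)"
    if z: "\<And>i. i div k \<noteq> a \<Longrightarrow> i div k \<noteq> Suc a \<Longrightarrow> z i = 0" for z a
  \<comment> \<open>The minimum moves the window of the last, possibly shorter, blocks back inside the coordinate range.\<close>
  proof (rule win[of "min (a * k) (p - 2 * k)"])
    fix i assume i: "i < p" "i \<notin> {min (a * k) (p - 2 * k)..min (a * k) (p - 2 * k) + 2 * k - 1}"
    have "i div k \<noteq> a \<and> i div k \<noteq> Suc a"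
    proof (rule ccontr)
      assume "\<not> ?thesis"
      then have "a \<le> i div k" "i div k < a + 2" by auto
      then have "a * k \<le> i" "i < (a + 2) * k"
        using k by (auto simp: less_eq_div_iff_mult_less_eq div_less_iff_less_mult)
      then have "a * k \<le> i" "i < a * k + 2 * k" by (auto simp: algebra_simps)
      then show False using i k by (auto simp: min_def split: if_splits)
    qed
    then show "z i = 0" using z by blast
  qed simp
  have pair: "\<sigma> i j * (v i * v j) =
      (\<Sum>a<N. \<sigma> i j * ((y a i + y (Suc a) i) * (y a j + y (Suc a) j)) - \<sigma> i j * (y (Suc a) i * y (Suc a) j))"
    if i: "i < p" and j: "j < p" for i j
  proof (cases "\<bar>int i - int j\<bar> > int k")
    case True
    then have "\<sigma> i j = 0" using band i j by simp
    then show ?thesis by simp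
  next
    case False
    then have ij: "i \<le> j + k" "j \<le> i + k" by auto
    have "i div k \<le> (j + k) div k" "j div k \<le> (i + k) div k" using ij by (auto intro: div_le_mono)
    then have b: "i div k \<le> Suc (j div k)" "j div k \<le> Suc (i div k)" using k by auto
    have "(\<Sum>a<N. (y a i + y (Suc a) i) * (y a j + y (Suc a) j) - y (Suc a) i * y (Suc a) j) =
        (\<Sum>a<N. (if a = i div k then v i * (y a j + y (Suc a) j) else 0) + (if a = j div k then v j * y (Suc a) i else 0))"
      by (intro sum.cong) (auto simp: y_def algebra_simps)
    also have "\<dots> = v i * (y (i div k) j + y (Suc (i div k)) j) + v j * y (Suc (j div k)) i"
      using blk[OF i] blk[OF j] by (simp add: sum.distrib)
    also have "\<dots> = v i * v j" using b by (auto simp: y_def)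
    finally show ?thesis by (simp add: sum_distrib_left[symmetric] right_diff_distrib[symmetric])
  qed
  have "qform p \<sigma> v = (\<Sum>i<p. \<Sum>j<p. \<Sum>a<N. \<sigma> i j * ((y a i + y (Suc a) i) * (y a j + y (Suc a) j)) - \<sigma> i j * (y (Suc a) i * y (Suc a) j))"
    unfolding qform_def using pair by (intro sum.cong) auto
  also have "\<dots> = (\<Sum>a<N. \<Sum>i<p. \<Sum>j<p. \<sigma> i j * ((y a i + y (Suc a) i) * (y a j + y (Suc a) j)) - \<sigma> i j * (y (Suc a) i * y (Suc a) j))"

  proof -
    have "(\<Sum>i<p. \<Sum>j<p. \<Sum>a<N. f i j a) = (\<Sum>a<N. \<Sum>i<p. \<Sum>j<p. f i j a)" for f :: "nat \<Rightarrow> nat \<Rightarrow> nat \<Rightarrow> real"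
    proof -
      have "(\<Sum>i<p. \<Sum>j<p. \<Sum>a<N. f i j a) = (\<Sum>i<p. \<Sum>a<N. \<Sum>j<p. f i j a)"
        by (intro sum.cong refl sum.swap)
      also have "\<dots> = (\<Sum>a<N. \<Sum>i<p. \<Sum>j<p. f i j a)" by (rule sum.swap)
      finally show ?thesis .
    qed
    then show ?thesis .
  qed
  also have "\<dots> = (\<Sum>a<N. qform p \<sigma> (\<lambda>i. y a i + y (Suc a) i) - qform p \<sigma> (y (Suc a)))"
    by (simp add: qform_def sum_subtractf)
  finally have "\<bar>qform p \<sigma> v\<bar> \<le> (\<Sum>a<N. \<bar>qform p \<sigma> (\<lambda>i. y a i + y (Suc a) i) - qform p \<sigma> (y (Suc a))\<bar>)"
    by simp
  also have "\<dots> \<le> (\<Sum>a<N. e * (\<Sum>i<p. (y a i + y (Suc a) i)\<^sup>2) + e * (\<Sum>i<p. (y (Suc a) i)\<^sup>2))"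
  proof (rule sum_mono)
    fix a
    have "\<bar>qform p \<sigma> (\<lambda>i. y a i + y (Suc a) i)\<bar> \<le> e * (\<Sum>i<p. (y a i + y (Suc a) i)\<^sup>2)"
      by (rule winblk[of a]) (simp add: y_def)
    moreover have "\<bar>qform p \<sigma> (y (Suc a))\<bar> \<le> e * (\<Sum>i<p. (y (Suc a) i)\<^sup>2)"
      by (rule winblk[of a]) (simp add: y_def)
    ultimately show "\<bar>qform p \<sigma> (\<lambda>i. y a i + y (Suc a) i) - qform p \<sigma> (y (Suc a))\<bar> \<le>
      e * (\<Sum>i<p. (y a i + y (Suc a) i)\<^sup>2) + e * (\<Sum>i<p. (y (Suc a) i)\<^sup>2)" by linarith
  qed
  also have "\<dots> = (\<Sum>a<N. e * (\<Sum>i<p. (y a i + y (Suc a) i)\<^sup>2 + (y (Suc a) i)\<^sup>2))"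
    by (simp add: sum.distrib distrib_left)
  also have "\<dots> = e * (\<Sum>a<N. \<Sum>i<p. (y a i + y (Suc a) i)\<^sup>2 + (y (Suc a) i)\<^sup>2)"
    by (rule sum_distrib_left[symmetric])
  also have "\<dots> = e * (\<Sum>i<p. \<Sum>a<N. (y a i + y (Suc a) i)\<^sup>2 + (y (Suc a) i)\<^sup>2)"
    by (rule arg_cong[where f = "\<lambda>z. e * z", OF sum.swap])
  also have "\<dots> \<le> e * (\<Sum>i<p. 3 * (v i)\<^sup>2)"
  proof (intro mult_left_mono sum_mono e)
    fix i assume "i \<in> {..<p}"
    then have i: "i < p" by simp
    have "(\<Sum>a<N. (y a i + y (Suc a) i)\<^sup>2 + (y (Suc a) i)\<^sup>2) =
      (\<Sum>a<N. (if a = i div k then (v i)\<^sup>2 else 0) + 2 * (if Suc a = i div k then (v i)\<^sup>2 else 0))"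
      by (intro sum.cong) (auto simp: y_def)
    also have "\<dots> = (v i)\<^sup>2 + 2 * (\<Sum>a<N. if Suc a = i div k then (v i)\<^sup>2 else 0)"
      using blk[OF i] by (simp add: sum.distrib sum_distrib_left)
    also have "(\<Sum>a<N. if Suc a = i div k then (v i)\<^sup>2 else 0) \<le> (v i)\<^sup>2"
    proof (cases "i div k")
      case (Suc b)
      then have "(\<Sum>a<N. if Suc a = i div k then (v i)\<^sup>2 else 0) = (\<Sum>a<N. if a = b then (v i)\<^sup>2 else 0)"
        by (intro sum.cong) auto
      also have "\<dots> \<le> (v i)\<^sup>2" by simp
      finally show ?thesis .
    qed simp
    finally show "(\<Sum>a<N. (y a i + y (Suc a) i)\<^sup>2 + (y (Suc a) i)\<^sup>2) \<le> 3 * (v i)\<^sup>2" by simp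
  qed
  finally show ?thesis by (simp add: sum_distrib_left[symmetric])
qed

section \<open>From depth to quantiles\<close>

lemma matrix_depth_lower:
  assumes "U \<noteq> {}"
    "\<And>u. u \<in> U \<Longrightarrow> t \<le> 1 / real n * (\<Sum>i<n. of_bool (\<bar>u \<bullet> X i\<bar>\<^sup>2 \<le> u \<bullet> (\<Gamma> *\<^sub>v u)))"
    "\<And>u. u \<in> U \<Longrightarrow> t \<le> 1 / real n * (\<Sum>i<n. of_bool (\<bar>u \<bullet> X i\<bar>\<^sup>2 \<ge> u \<bullet> (\<Gamma> *\<^sub>v u)))"
  shows "t \<le> matrix_depth U n X \<Gamma>"
  unfolding matrix_depth_def using assms by (intro cINF_greatest) auto

lemma matrix_depth_upper:
  assumes "u \<in> U"
  shows "matrix_depth U n X \<Gamma> \<le> 1 / real n * (\<Sum>i<n. of_bool (\<bar>u \<bullet> X i\<bar>\<^sup>2 \<le> u \<bullet> (\<Gamma> *\<^sub>v u)))"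
    and "matrix_depth U n X \<Gamma> \<le> 1 / real n * (\<Sum>i<n. of_bool (\<bar>u \<bullet> X i\<bar>\<^sup>2 \<ge> u \<bullet> (\<Gamma> *\<^sub>v u)))"
proof -
  let ?f = "\<lambda>u. min (1 / real n * (\<Sum>i<n. of_bool (\<bar>u \<bullet> X i\<bar>\<^sup>2 \<le> u \<bullet> (\<Gamma> *\<^sub>v u))))
     (1 / real n * (\<Sum>i<n. of_bool (\<bar>u \<bullet> X i\<bar>\<^sup>2 \<ge> u \<bullet> (\<Gamma> *\<^sub>v u))))"
  have "bdd_below (?f ` U)"
    by (rule bdd_belowI2[of _ 0]) (auto intro!: mult_nonneg_nonneg sum_nonneg)
  then have "matrix_depth U n X \<Gamma> \<le> ?f u"
    unfolding matrix_depth_def using assms by (intro cINF_lower)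
  then show "matrix_depth U n X \<Gamma> \<le> 1 / real n * (\<Sum>i<n. of_bool (\<bar>u \<bullet> X i\<bar>\<^sup>2 \<le> u \<bullet> (\<Gamma> *\<^sub>v u)))"
    and "matrix_depth U n X \<Gamma> \<le> 1 / real n * (\<Sum>i<n. of_bool (\<bar>u \<bullet> X i\<bar>\<^sup>2 \<ge> u \<bullet> (\<Gamma> *\<^sub>v u)))"
    by linarith+
qed

lemma abs_le_of_square_le:
  fixes a c :: real
  assumes "\<bar>a\<bar>\<^sup>2 \<le> (c * \<sigma>)\<^sup>2" "0 \<le> c" "0 \<le> \<sigma>"
  shows "\<bar>a\<bar> \<le> c * \<sigma>"
  using power2_le_imp_le[OF assms(1)] assms(2,3) by simp

text \<open>
  A deterministic statement about one sample. The hypothesis \<open>dev\<close> says that the weighted frequencies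
  of \<open>{|u\<^sup>T X| \<le> c \<sigma>(u)}\<close> are close to Gaussian ones at four thresholds: two just below and above the
  median \<open>s = \<surd>\<beta>\<close> of \<open>|N(0,1)|\<close> show that \<open>\<Gamma>\<^sub>0\<close> is deep, the other two, at distance \<open>A \<tau>\<close>, show that a matrix
  outside the asserted range is shallower. Here \<open>\<tau>\<close> is at least the total error budget divided by
  \<open>1 - \<epsilon> > 4/5\<close>, and \<open>A\<close> is chosen so that moving the threshold by \<open>A \<tau>\<close> changes the Gaussian
  probability by at least \<open>2 \<tau>\<close> below \<open>K\<close>. A negative lower threshold is harmless because then
  \<open>\<beta> \<le> s A \<tau>\<close>; an upper threshold beyond \<open>K\<close> is replaced by \<open>K\<close>, whose central
  probability exceeds \<open>7/8 \<ge> 1/2 + \<tau>\<close>.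
\<close>

lemma deepest_scatter_close:
  fixes n :: nat and X :: "nat \<Rightarrow> real Matrix.vec" and U :: "real Matrix.vec set"
    and \<Gamma> \<Gamma>\<^sub>0 :: "real mat" and \<sigma> :: "real Matrix.vec \<Rightarrow> real" and \<omega> :: "nat \<Rightarrow> real"
    and K r y \<epsilon> :: real
  defines "s \<equiv> sqrt depth_beta"
  defines "A \<equiv> 2 / std_normal_density K"
  defines "\<tau> \<equiv> 5/4 * (\<epsilon> + s * y + 4 * r)"
  assumes U: "U \<noteq> {}" and n: "0 < n" and \<sigma>: "\<And>u. u \<in> U \<Longrightarrow> 0 < \<sigma> u"
    and \<omega>: "\<And>i. i < n \<Longrightarrow> 0 \<le> \<omega> i" "\<And>i. i < n \<Longrightarrow> \<omega> i \<le> 1"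
    and eps: "0 \<le> \<epsilon>" "\<epsilon> < 1/5" and r: "0 < r" and y: "0 \<le> y" "y \<le> 1"
    and small: "s * y + 4 * r \<le> 1/10"
    and K: "s < K" "7/8 < central_prob K"
    and mean: "1 - \<epsilon> - r \<le> (\<Sum>i<n. \<omega> i) / real n"
    and dev: "\<And>u c. u \<in> U \<Longrightarrow> c \<in> {s * (1 - y), s * (1 + y), s - A * \<tau>, min (s + A * \<tau>) K} \<Longrightarrow>
      \<bar>(\<Sum>i<n. \<omega> i * of_bool (\<bar>u \<bullet> X i\<bar> \<le> c * \<sigma> u)) / real n - (1 - \<epsilon>) * central_prob c\<bar> \<le> r"
    and \<Gamma>\<^sub>0: "\<And>u. u \<in> U \<Longrightarrow> \<bar>u \<bullet> (\<Gamma>\<^sub>0 *\<^sub>v u) - depth_beta * (\<sigma> u)\<^sup>2\<bar> \<le> depth_beta * y * (\<sigma> u)\<^sup>2"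
    and depth: "matrix_depth U n X \<Gamma>\<^sub>0 \<le> matrix_depth U n X \<Gamma>"
    and \<Gamma>: "\<And>u. u \<in> U \<Longrightarrow> 0 \<le> u \<bullet> (\<Gamma> *\<^sub>v u)"
    and u: "u \<in> U"
  shows "\<bar>u \<bullet> (\<Gamma> *\<^sub>v u) - depth_beta * (\<sigma> u)\<^sup>2\<bar> \<le> (2 * s * A + A\<^sup>2) * \<tau> * (\<sigma> u)\<^sup>2"
proof -
  have s: "0 < s" "s\<^sup>2 = depth_beta" using depth_beta_pos by (auto simp: s_def)
  have G_s: "central_prob s = 1/2" unfolding s_def by (rule central_prob_sqrt_depth_beta)
  have phi: "0 < std_normal_density K" by (simp add: normal_density_pos)
  have A: "0 < A" using phi by (simp add: A_def)
  have sy: "0 \<le> s * y" using s y by simp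
  have tau: "0 < \<tau>" "\<tau> \<le> 3/8" using eps r sy small by (auto simp: \<tau>_def)
  define B where "B = (\<lambda>u c. (\<Sum>i<n. \<omega> i * of_bool (\<bar>u \<bullet> X i\<bar> \<le> c * \<sigma> u)) / real n)"
  define m where "m = (\<Sum>i<n. \<omega> i) / real n"
  have ratio: "(\<Sum>i<n. f i) / real n \<le> (\<Sum>i<n. g i) / real n" if "\<And>i. i < n \<Longrightarrow> f i \<le> g i" for f g :: "nat \<Rightarrow> real"
    using that by (intro divide_right_mono sum_mono) auto
  have rest: "(\<Sum>i<n. 1 - \<omega> i) / real n = 1 - m"
    using n by (simp add: m_def sum_subtractf diff_divide_distrib)
  have d0: "(1 - \<epsilon>) / 2 - s * y - 2 * r \<le> matrix_depth U n X \<Gamma>\<^sub>0"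
  proof (rule matrix_depth_lower[OF U])
    fix v assume v: "v \<in> U"
    have sv: "0 < \<sigma> v" by (rule \<sigma>[OF v])
    have "central_prob s \<le> central_prob (s * (1 - y)) + (s - s * (1 - y))"
      using s y by (intro central_prob_le_add) (auto simp: algebra_simps)
    then have g: "1/2 - s * y \<le> central_prob (s * (1 - y))" using G_s by (simp add: algebra_simps)
    have "(1 - \<epsilon>) * (1/2 - s * y) \<le> (1 - \<epsilon>) * central_prob (s * (1 - y))"
      using g eps by (intro mult_left_mono) auto
    moreover have "(1 - \<epsilon>) * (s * y) \<le> 1 * (s * y)" using eps sy by (intro mult_right_mono) auto
    moreover have "(1 - \<epsilon>) * (1/2 - s * y) = (1 - \<epsilon>) / 2 - (1 - \<epsilon>) * (s * y)" by (simp add: algebra_simps)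
    moreover have "(1 - \<epsilon>) * central_prob (s * (1 - y)) - r \<le> B v (s * (1 - y))"
      using dev[OF v, of "s * (1 - y)"] unfolding B_def by (simp add: abs_le_iff)
    ultimately have "(1 - \<epsilon>) / 2 - s * y - 2 * r \<le> B v (s * (1 - y))" using r by linarith
    also have "\<dots> \<le> (\<Sum>i<n. of_bool (\<bar>v \<bullet> X i\<bar>\<^sup>2 \<le> v \<bullet> (\<Gamma>\<^sub>0 *\<^sub>v v))) / real n"
      unfolding B_def
    proof (rule ratio)
      fix i assume i: "i < n"
      have "\<bar>v \<bullet> X i\<bar>\<^sup>2 \<le> v \<bullet> (\<Gamma>\<^sub>0 *\<^sub>v v)" if "\<bar>v \<bullet> X i\<bar> \<le> s * (1 - y) * \<sigma> v"
      proof -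
        have "\<bar>v \<bullet> X i\<bar>\<^sup>2 \<le> (s * (1 - y) * \<sigma> v)\<^sup>2" using that by (intro power_mono) auto
        also have "\<dots> = depth_beta * (\<sigma> v)\<^sup>2 * (1 - y)\<^sup>2" by (simp add: power_mult_distrib s(2))
        also have "\<dots> \<le> depth_beta * (\<sigma> v)\<^sup>2 * (1 - y)"
        proof (intro mult_left_mono)
          have "(1 - y) * (1 - y) \<le> (1 - y) * 1" using y by (intro mult_left_mono) auto
          then show "(1 - y)\<^sup>2 \<le> 1 - y" by (simp add: power2_eq_square)
        qed (use depth_beta_pos in auto)
        also have "\<dots> \<le> v \<bullet> (\<Gamma>\<^sub>0 *\<^sub>v v)" using \<Gamma>\<^sub>0[OF v] by (simp add: abs_le_iff algebra_simps)
        finally show ?thesis .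
      qed
      then show "\<omega> i * of_bool (\<bar>v \<bullet> X i\<bar> \<le> s * (1 - y) * \<sigma> v) \<le> of_bool (\<bar>v \<bullet> X i\<bar>\<^sup>2 \<le> v \<bullet> (\<Gamma>\<^sub>0 *\<^sub>v v))"
        using \<omega>[OF i] by auto
    qed
    finally show "(1 - \<epsilon>) / 2 - s * y - 2 * r \<le> 1 / real n * (\<Sum>i<n. of_bool (\<bar>v \<bullet> X i\<bar>\<^sup>2 \<le> v \<bullet> (\<Gamma>\<^sub>0 *\<^sub>v v)))" by simp
  next
    fix v assume v: "v \<in> U"
    have sv: "0 < \<sigma> v" by (rule \<sigma>[OF v])
    have "central_prob (s * (1 + y)) \<le> central_prob s + (s * (1 + y) - s)"
      using s y by (intro central_prob_le_add) (auto simp: algebra_simps)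
    then have g: "central_prob (s * (1 + y)) \<le> 1/2 + s * y" using G_s by (simp add: algebra_simps)
    have "(1 - \<epsilon>) * central_prob (s * (1 + y)) \<le> (1 - \<epsilon>) * (1/2 + s * y)"
      using g eps by (intro mult_left_mono) auto
    moreover have "(1 - \<epsilon>) * (s * y) \<le> 1 * (s * y)" using eps sy by (intro mult_right_mono) auto
    moreover have "(1 - \<epsilon>) * (1/2 + s * y) = (1 - \<epsilon>) / 2 + (1 - \<epsilon>) * (s * y)" by (simp add: algebra_simps)
    moreover have "B v (s * (1 + y)) \<le> (1 - \<epsilon>) * central_prob (s * (1 + y)) + r"
      using dev[OF v, of "s * (1 + y)"] unfolding B_def by (simp add: abs_le_iff)
    ultimately have "(1 - \<epsilon>) / 2 - s * y - 2 * r \<le> m - B v (s * (1 + y))"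
      using mean unfolding m_def by (simp add: field_simps)
    also have "\<dots> = (\<Sum>i<n. \<omega> i - \<omega> i * of_bool (\<bar>v \<bullet> X i\<bar> \<le> s * (1 + y) * \<sigma> v)) / real n"
      by (simp add: m_def B_def sum_subtractf diff_divide_distrib)
    also have "\<dots> \<le> (\<Sum>i<n. of_bool (\<bar>v \<bullet> X i\<bar>\<^sup>2 \<ge> v \<bullet> (\<Gamma>\<^sub>0 *\<^sub>v v))) / real n"
    proof (rule ratio)
      fix i assume i: "i < n"
      have "v \<bullet> (\<Gamma>\<^sub>0 *\<^sub>v v) \<le> \<bar>v \<bullet> X i\<bar>\<^sup>2" if "\<not> \<bar>v \<bullet> X i\<bar> \<le> s * (1 + y) * \<sigma> v"
      proof -
        have "v \<bullet> (\<Gamma>\<^sub>0 *\<^sub>v v) \<le> depth_beta * (\<sigma> v)\<^sup>2 * (1 + y)"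
          using \<Gamma>\<^sub>0[OF v] by (simp add: abs_le_iff algebra_simps)
        also have "\<dots> \<le> depth_beta * (\<sigma> v)\<^sup>2 * (1 + y)\<^sup>2"
        proof (intro mult_left_mono)
          have "(1 + y) * 1 \<le> (1 + y) * (1 + y)" using y by (intro mult_left_mono) auto
          then show "1 + y \<le> (1 + y)\<^sup>2" by (simp add: power2_eq_square)
        qed (use depth_beta_pos in auto)
        also have "\<dots> = (s * (1 + y) * \<sigma> v)\<^sup>2" by (simp add: power_mult_distrib s(2))
        also have "\<dots> \<le> \<bar>v \<bullet> X i\<bar>\<^sup>2" using that s y sv by (intro power_mono) auto
        finally show ?thesis .
      qed
      then show "\<omega> i - \<omega> i * of_bool (\<bar>v \<bullet> X i\<bar> \<le> s * (1 + y) * \<sigma> v) \<le> of_bool (\<bar>v \<bullet> X i\<bar>\<^sup>2 \<ge> v \<bullet> (\<Gamma>\<^sub>0 *\<^sub>v v))"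
        using \<omega>[OF i] by auto
    qed
    finally show "(1 - \<epsilon>) / 2 - s * y - 2 * r \<le> 1 / real n * (\<Sum>i<n. of_bool (\<bar>v \<bullet> X i\<bar>\<^sup>2 \<ge> v \<bullet> (\<Gamma>\<^sub>0 *\<^sub>v v)))" by simp
  qed
  define g where "g = u \<bullet> (\<Gamma> *\<^sub>v u)"
  have su: "0 < \<sigma> u" by (rule \<sigma>[OF u])
  have g0: "0 \<le> g" unfolding g_def by (rule \<Gamma>[OF u])
  have budget: "(\<epsilon> + s * y + 4 * r) \<le> (1 - \<epsilon>) * \<tau>"
  proof -
    have "4/5 * \<tau> \<le> (1 - \<epsilon>) * \<tau>" using eps tau by (intro mult_right_mono) auto
    then show ?thesis by (simp add: \<tau>_def)
  qed
  have low: "(s - A * \<tau>)\<^sup>2 * (\<sigma> u)\<^sup>2 \<le> g" if c: "0 \<le> s - A * \<tau>"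
  proof (rule ccontr)
    assume "\<not> ?thesis"
    then have lt: "g < ((s - A * \<tau>) * \<sigma> u)\<^sup>2" by (simp add: power_mult_distrib)
    have "std_normal_density K * (s - (s - A * \<tau>)) \<le> central_prob s - central_prob (s - A * \<tau>)"
      using c A tau K by (intro central_prob_increase) auto
    then have "central_prob (s - A * \<tau>) \<le> 1/2 - 2 * \<tau>" using phi by (simp add: G_s A_def)
    then have "(1 - \<epsilon>) * central_prob (s - A * \<tau>) \<le> (1 - \<epsilon>) * (1/2 - 2 * \<tau>)"
      using eps by (intro mult_left_mono) auto
    also have "\<dots> = (1 - \<epsilon>) / 2 - 2 * ((1 - \<epsilon>) * \<tau>)" by (simp add: algebra_simps)
    also have "\<dots> \<le> (1 - \<epsilon>) / 2 - 2 * (\<epsilon> + s * y + 4 * r)" using budget by (intro diff_left_mono mult_left_mono) auto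
    finally have "(1 - \<epsilon>) * central_prob (s - A * \<tau>) \<le> (1 - \<epsilon>) / 2 - 2 * (\<epsilon> + s * y + 4 * r)" .
    moreover have "B u (s - A * \<tau>) \<le> (1 - \<epsilon>) * central_prob (s - A * \<tau>) + r"
      using dev[OF u, of "s - A * \<tau>"] unfolding B_def by (simp add: abs_le_iff)
    ultimately have 1: "B u (s - A * \<tau>) \<le> (1 - \<epsilon>) / 2 - 2 * (\<epsilon> + s * y + 4 * r) + r"
      by linarith
    have "matrix_depth U n X \<Gamma> \<le> (\<Sum>i<n. of_bool (\<bar>u \<bullet> X i\<bar>\<^sup>2 \<le> g)) / real n"
      using matrix_depth_upper(1)[OF u, of n X \<Gamma>] by (simp add: g_def)
    also have "\<dots> \<le> (\<Sum>i<n. \<omega> i * of_bool (\<bar>u \<bullet> X i\<bar> \<le> (s - A * \<tau>) * \<sigma> u) + (1 - \<omega> i)) / real n"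
    proof (rule ratio)
      fix i assume i: "i < n"
      have "\<bar>u \<bullet> X i\<bar> \<le> (s - A * \<tau>) * \<sigma> u" if "\<bar>u \<bullet> X i\<bar>\<^sup>2 \<le> g"
        using that lt c su by (intro abs_le_of_square_le) auto
      then show "of_bool (\<bar>u \<bullet> X i\<bar>\<^sup>2 \<le> g) \<le> \<omega> i * of_bool (\<bar>u \<bullet> X i\<bar> \<le> (s - A * \<tau>) * \<sigma> u) + (1 - \<omega> i)"
        using \<omega>[OF i] by auto
    qed
    also have "\<dots> = B u (s - A * \<tau>) + (1 - m)"
      unfolding rest[symmetric] B_def by (simp add: sum.distrib add_divide_distrib)
    finally have "matrix_depth U n X \<Gamma> \<le> B u (s - A * \<tau>) + (1 - m)" .
    then show False using d0 depth 1 mean sy eps(1) r unfolding m_def by argo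
  qed
  define c where "c = min (s + A * \<tau>) K"
  have c0: "0 \<le> c" using s A tau K by (simp add: c_def)
  have up: "g \<le> (s + A * \<tau>)\<^sup>2 * (\<sigma> u)\<^sup>2"
  proof -
    have "g \<le> (c * \<sigma> u)\<^sup>2"
    proof (rule ccontr)
      assume "\<not> g \<le> (c * \<sigma> u)\<^sup>2"
      then have lt: "(c * \<sigma> u)\<^sup>2 < g" by simp
      have "1/2 + \<tau> \<le> central_prob c"
      proof (cases "s + A * \<tau> \<le> K")
        case True
        have "std_normal_density K * ((s + A * \<tau>) - s) \<le> central_prob (s + A * \<tau>) - central_prob s"
          using True A tau s by (intro central_prob_increase) auto
        then have "1/2 + 2 * \<tau> \<le> central_prob (s + A * \<tau>)" using phi by (simp add: G_s A_def)
        then show ?thesis using True tau by (simp add: c_def)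
      next
        case False
        then show ?thesis using K(2) tau by (simp add: c_def)
      qed
      then have "(1 - \<epsilon>) * (1/2 + \<tau>) \<le> (1 - \<epsilon>) * central_prob c"
        using eps by (intro mult_left_mono) auto
      moreover have "(1 - \<epsilon>) / 2 + (\<epsilon> + s * y + 4 * r) \<le> (1 - \<epsilon>) * (1/2 + \<tau>)"
        using budget by (simp add: distrib_left)
      moreover have "(1 - \<epsilon>) * central_prob c - r \<le> B u c"
        using dev[OF u, of c] unfolding B_def by (simp add: abs_le_iff c_def)
      ultimately have 1: "(1 - \<epsilon>) / 2 + (\<epsilon> + s * y + 4 * r) - r \<le> B u c" by linarith
      have "matrix_depth U n X \<Gamma> \<le> (\<Sum>i<n. of_bool (g \<le> \<bar>u \<bullet> X i\<bar>\<^sup>2)) / real n"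
        using matrix_depth_upper(2)[OF u, of n X \<Gamma>] by (simp add: g_def)
      also have "\<dots> \<le> (\<Sum>i<n. 1 - \<omega> i * of_bool (\<bar>u \<bullet> X i\<bar> \<le> c * \<sigma> u)) / real n"
      proof (rule ratio)
        fix i assume i: "i < n"
        have "\<not> \<bar>u \<bullet> X i\<bar> \<le> c * \<sigma> u" if "g \<le> \<bar>u \<bullet> X i\<bar>\<^sup>2"
        proof
          assume "\<bar>u \<bullet> X i\<bar> \<le> c * \<sigma> u"
          then have "\<bar>u \<bullet> X i\<bar>\<^sup>2 \<le> (c * \<sigma> u)\<^sup>2" by (intro power_mono) auto
          then show False using that lt by linarith
        qed
        then show "of_bool (g \<le> \<bar>u \<bullet> X i\<bar>\<^sup>2) \<le> 1 - \<omega> i * of_bool (\<bar>u \<bullet> X i\<bar> \<le> c * \<sigma> u)"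
          using \<omega>[OF i] by auto
      qed
      also have "\<dots> = 1 - B u c" using n by (simp add: B_def sum_subtractf diff_divide_distrib)
      finally have "matrix_depth U n X \<Gamma> \<le> 1 - B u c" .
      then show False using d0 depth 1 r by argo
    qed
    also have "\<dots> \<le> ((s + A * \<tau>) * \<sigma> u)\<^sup>2"
      using c0 su by (intro power_mono mult_right_mono) (auto simp: c_def)
    finally show ?thesis by (simp add: power_mult_distrib)
  qed
  have sq: "A\<^sup>2 * \<tau>\<^sup>2 \<le> A\<^sup>2 * \<tau>"
    using tau A by (intro mult_left_mono) (auto simp: power2_eq_square mult_le_cancel_left1)
  have "g - depth_beta * (\<sigma> u)\<^sup>2 \<le> (2 * s * A + A\<^sup>2) * \<tau> * (\<sigma> u)\<^sup>2"
  proof -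
    have "(s + A * \<tau>)\<^sup>2 - s\<^sup>2 \<le> (2 * s * A + A\<^sup>2) * \<tau>"
      using sq by (simp add: power2_sum power_mult_distrib algebra_simps)
    then have "((s + A * \<tau>)\<^sup>2 - s\<^sup>2) * (\<sigma> u)\<^sup>2 \<le> (2 * s * A + A\<^sup>2) * \<tau> * (\<sigma> u)\<^sup>2"
      by (intro mult_right_mono) auto
    then show ?thesis using up by (simp add: s(2) left_diff_distrib)
  qed
  moreover have "depth_beta * (\<sigma> u)\<^sup>2 - g \<le> (2 * s * A + A\<^sup>2) * \<tau> * (\<sigma> u)\<^sup>2"
  proof (cases "0 \<le> s - A * \<tau>")
    case True
    have "s\<^sup>2 - (s - A * \<tau>)\<^sup>2 \<le> (2 * s * A + A\<^sup>2) * \<tau>"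
      using tau(1) by (simp add: power2_diff power_mult_distrib algebra_simps add_increasing2)
    then have "(s\<^sup>2 - (s - A * \<tau>)\<^sup>2) * (\<sigma> u)\<^sup>2 \<le> (2 * s * A + A\<^sup>2) * \<tau> * (\<sigma> u)\<^sup>2"
      by (intro mult_right_mono) auto
    then show ?thesis using low[OF True] by (simp add: s(2) left_diff_distrib)
  next
    case False
    have "s\<^sup>2 \<le> s * (A * \<tau>)" unfolding power2_eq_square using False s by (intro mult_left_mono) auto
    also have "\<dots> \<le> (2 * s * A + A\<^sup>2) * \<tau>"
    proof -
      have "s * A \<le> 2 * s * A + A\<^sup>2" using s A by simp
      then have "s * A * \<tau> \<le> (2 * s * A + A\<^sup>2) * \<tau>" using tau by (intro mult_right_mono) auto
      then show ?thesis by (simp add: mult.assoc)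
    qed
    finally have "s\<^sup>2 * (\<sigma> u)\<^sup>2 \<le> (2 * s * A + A\<^sup>2) * \<tau> * (\<sigma> u)\<^sup>2" by (intro mult_right_mono) auto
    then show ?thesis using g0 by (simp add: s(2))
  qed
  ultimately show ?thesis by (simp add: g_def abs_le_iff)
qed

section \<open>The contaminated model as weighted projections\<close>

lemma coordinate_form_eq:
  assumes "A \<in> carrier_mat p p"
  shows "Matrix.vec p a \<bullet> (A *\<^sub>v Matrix.vec p a) = qform p (\<lambda>i j. A $$ (i, j)) a"
proof -
  have "Matrix.vec p a \<bullet> (A *\<^sub>v Matrix.vec p a) = qform p (\<lambda>i j. A $$ (i, j)) (\<lambda>i. Matrix.vec p a $ i)"
    by (rule form_eq_qform[OF assms]) simp
  also have "\<dots> = qform p (\<lambda>i j. A $$ (i, j)) a" unfolding qform_def by (intro sum.cong) auto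
  finally show ?thesis .
qed

lemma mv_normal_projection_nn_integral:
  assumes \<Sigma>: "psd p \<Sigma>" and f: "f \<in> borel_measurable borel"
  shows "(\<integral>\<^sup>+x. f (\<Sum>i<p. a i * x i) \<partial>mv_normal p \<Sigma>) =
    (\<integral>\<^sup>+z. f (sqrt (qform p (\<lambda>i j. \<Sigma> $$ (i, j)) a) * z) \<partial>std_normal)"
proof -
  let ?u = "Matrix.vec p a"
  have \<Sigma>c: "\<Sigma> \<in> carrier_mat p p" using \<Sigma> by (simp add: psd_def)
  have lin: "?u \<bullet> Matrix.vec p x = (\<Sum>i<p. a i * x i)" for x
    by (simp add: scalar_prod_def atLeast0LessThan)
  have m: "(\<lambda>x. ?u \<bullet> Matrix.vec p x) \<in> borel_measurable (mv_normal p \<Sigma>)"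
    unfolding lin by (simp add: measurable_cong_sets[OF sets_mv_normal refl])
  have "(\<integral>\<^sup>+x. f (\<Sum>i<p. a i * x i) \<partial>mv_normal p \<Sigma>) = (\<integral>\<^sup>+t. f t \<partial>distr (mv_normal p \<Sigma>) borel (\<lambda>x. ?u \<bullet> Matrix.vec p x))"
    using nn_integral_distr[OF m, of f] f by (simp add: lin)
  also have "\<dots> = (\<integral>\<^sup>+t. f t \<partial>distr std_normal borel (\<lambda>z. sqrt (?u \<bullet> (\<Sigma> *\<^sub>v ?u)) * z))"
    by (subst distr_linear_mv_normal[OF \<Sigma>]) auto
  also have "\<dots> = (\<integral>\<^sup>+z. f (sqrt (?u \<bullet> (\<Sigma> *\<^sub>v ?u)) * z) \<partial>std_normal)"
    using f by (intro nn_integral_distr) auto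
  finally show ?thesis unfolding coordinate_form_eq[OF \<Sigma>c] .
qed

lemma weighted_projection_expectation:
  assumes \<Sigma>: "psd p \<Sigma>" and eps: "0 \<le> \<epsilon>" "\<epsilon> < 1"
    and cw: "clean_weight p \<epsilon> \<Sigma> Q w"
    and a: "qform p (\<lambda>i j. \<Sigma> $$ (i, j)) a = 1" and S: "S \<in> sets borel"
  shows "integral\<^sup>L (contaminated p \<epsilon> \<Sigma> Q) (\<lambda>x. w x * of_bool ((\<Sum>i<p. a i * x i) \<in> S)) = (1 - \<epsilon>) * measure std_normal S"
proof -
  note w = clean_weightD[OF cw]
  let ?P = "contaminated p \<epsilon> \<Sigma> Q"
  have ind: "(\<lambda>x. indicator S (\<Sum>i<p. a i * x i) :: ennreal) \<in> borel_measurable (borel_space p)"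
    using S by measurable
  have [measurable]: "(\<lambda>x. indicator S (\<Sum>i<p. a i * x i) :: ennreal) \<in> borel_measurable ?P"
    using ind by (simp add: measurable_cong_sets[OF sets_contaminated refl])
  have "(\<lambda>x. indicator S (\<Sum>i<p. a i * x i) :: real) \<in> borel_measurable (borel_space p)"
    using S by measurable
  then have indr: "(\<lambda>x. indicator S (\<Sum>i<p. a i * x i) :: real) \<in> borel_measurable ?P"
    by (simp add: measurable_cong_sets[OF sets_contaminated refl])
  have eq: "of_bool ((\<Sum>i<p. a i * x i) \<in> S) = (indicator S (\<Sum>i<p. a i * x i) :: real)" for x
    by (simp add: indicator_def)
  have "(\<integral>\<^sup>+x. ennreal (w x * of_bool ((\<Sum>i<p. a i * x i) \<in> S)) \<partial>?P)
      = (\<integral>\<^sup>+x. ennreal (w x) * indicator S (\<Sum>i<p. a i * x i) \<partial>?P)"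
    by (intro nn_integral_cong) (simp add: indicator_def)
  also have "\<dots> = ennreal (1 - \<epsilon>) * (\<integral>\<^sup>+x. indicator S (\<Sum>i<p. a i * x i) \<partial>mv_normal p \<Sigma>)"
    by (rule bspec[OF w(3) ind])
  also have "(\<integral>\<^sup>+x. indicator S (\<Sum>i<p. a i * x i) \<partial>mv_normal p \<Sigma>) = (\<integral>\<^sup>+z. indicator S (1 * z) \<partial>std_normal)"
    using mv_normal_projection_nn_integral[OF \<Sigma>, of "indicator S" a] S a by simp
  also have "\<dots> = ennreal (measure std_normal S)" using S by (simp add: std_normal.emeasure_eq_measure)
  finally have "(\<integral>\<^sup>+x. ennreal (w x * of_bool ((\<Sum>i<p. a i * x i) \<in> S)) \<partial>?P) = ennreal ((1 - \<epsilon>) * measure std_normal S)"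
    using eps by (simp add: ennreal_mult)
  moreover have "(\<lambda>x. w x * of_bool ((\<Sum>i<p. a i * x i) \<in> S)) \<in> borel_measurable ?P"
    unfolding eq using w(1) indr by (intro borel_measurable_times)
  ultimately show ?thesis
    using w(2) eps by (intro integral_eq_nn_integral[THEN trans]) auto
qed

text \<open>
  Convexity of the exponential gives \<open>exp (w t) \<le> 1 + w (exp t - 1)\<close> for \<open>0 \<le> w \<le> 1\<close>. Integrating, the
  weight turns the right-hand side into a Gaussian expectation, so the exponential moment of the
  weighted square is no larger than the one for clean data, \<open>E exp (Z\<^sup>2 / 4) = \<surd>2\<close>.
\<close>

lemma weighted_projections_contaminated:
  assumes \<Sigma>: "psd p \<Sigma>" and Q: "prob_space Q" "sets Q = sets (borel_space p)" and eps: "0 \<le> \<epsilon>" "\<epsilon> < 1"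
    and cw: "clean_weight p \<epsilon> \<Sigma> Q w"
    and M: "0 < M" "\<And>v. v \<in> carrier_vec p \<Longrightarrow> v \<bullet> (\<Sigma> *\<^sub>v v) \<le> M * (v \<bullet> v)"
    and V: "finite V" "\<And>W. W \<in> V \<Longrightarrow> W \<subseteq> {..<p}" "\<And>W. W \<in> V \<Longrightarrow> card W \<le> d" "V \<noteq> {}"
    and d: "1 \<le> d" and b: "0 \<le> b" and L: "ln (real (card V)) + real d \<le> L"
    and D: "D \<subseteq> supported V" "\<And>u. u \<in> D \<Longrightarrow> L2_set u {..<p} \<le> b"
      "\<And>u. u \<in> D \<Longrightarrow> qform p (\<lambda>i j. \<Sigma> $$ (i, j)) u = 1"
  shows "weighted_projections (contaminated p \<epsilon> \<Sigma> Q) w (\<lambda>i x. x i) {..<p} V d M b L D"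
proof -
  note w = clean_weightD[OF cw]
  let ?P = "contaminated p \<epsilon> \<Sigma> Q"
  interpret P: prob_space ?P using assms by (intro prob_space_contaminated) auto
  interpret N: prob_space "mv_normal p \<Sigma>" by (rule prob_space_mv_normal[OF \<Sigma>])
  have \<Sigma>c: "\<Sigma> \<in> carrier_mat p p" using \<Sigma> by (simp add: psd_def)
  show ?thesis
  proof (unfold_locales)
    show "(\<lambda>x. x i) \<in> borel_measurable ?P" if "i \<in> {..<p}" for i
      using that by (simp add: measurable_cong_sets[OF sets_contaminated refl])
  next
    fix a assume a: "L2_set a {..<p} \<le> 1"
    let ?y = "\<lambda>x. \<Sum>i<p. a i * x i" and ?\<tau> = "qform p (\<lambda>i j. \<Sigma> $$ (i, j)) a"
    have tau0: "0 \<le> ?\<tau>" using \<Sigma> unfolding coordinate_form_eq[OF \<Sigma>c, symmetric] by (simp add: psd_def)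
    have "(L2_set a {..<p})\<^sup>2 \<le> 1" using a by (intro power_le_one) (auto simp: L2_set_nonneg)
    then have "(\<Sum>i<p. (a i)\<^sup>2) \<le> 1" by (simp add: L2_set_def sum_nonneg)
    moreover have "?\<tau> \<le> M * (\<Sum>i<p. (a i)\<^sup>2)"
      using M(2)[of "Matrix.vec p a"] unfolding coordinate_form_eq[OF \<Sigma>c]
      by (simp add: scalar_prod_self[of _ p])
    ultimately have tauM: "?\<tau> \<le> M" using M(1) by (smt (verit) mult_le_cancel_left2)
    define h where "h = (\<lambda>x. ennreal (exp ((?y x)\<^sup>2 / (4 * M)) - 1))"
    have hm: "h \<in> borel_measurable (borel_space p)" unfolding h_def by measurable
    have hmN: "h \<in> borel_measurable (mv_normal p \<Sigma>)" and hmP: "h \<in> borel_measurable ?P"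
      using hm by (simp_all add: measurable_cong_sets[OF sets_contaminated refl] measurable_cong_sets[OF sets_mv_normal refl])
    have h1: "h x + 1 = ennreal (exp ((?y x)\<^sup>2 / (4 * M)))" for x
    proof -
      have "1 \<le> exp ((?y x)\<^sup>2 / (4 * M))" using M(1) by simp
      then show ?thesis unfolding h_def by (simp add: ennreal_plus[symmetric] flip: ennreal_1 del: ennreal_plus)
    qed
    have "(\<integral>\<^sup>+x. h x \<partial>mv_normal p \<Sigma>) + 1 = (\<integral>\<^sup>+x. h x + 1 \<partial>mv_normal p \<Sigma>)"
      using hmN by (simp add: nn_integral_add N.emeasure_space_1)
    also have "\<dots> = (\<integral>\<^sup>+z. ennreal (exp ((sqrt ?\<tau> * z)\<^sup>2 / (4 * M))) \<partial>std_normal)"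
      unfolding h1 by (rule mv_normal_projection_nn_integral[OF \<Sigma>]) measurable
    also have "\<dots> \<le> (\<integral>\<^sup>+z. ennreal (exp (z\<^sup>2 / 4)) \<partial>std_normal)"
    proof (intro nn_integral_mono ennreal_leI)
      fix z :: real
      have "?\<tau> * z\<^sup>2 \<le> M * z\<^sup>2" using tauM by (intro mult_right_mono) auto
      then have "(sqrt ?\<tau> * z)\<^sup>2 / (4 * M) \<le> z\<^sup>2 / 4"
        using M(1) tau0 by (simp add: power_mult_distrib field_simps)
      then show "exp ((sqrt ?\<tau> * z)\<^sup>2 / (4 * M)) \<le> exp (z\<^sup>2 / 4)" by simp
    qed
    also have "\<dots> = ennreal (sqrt 2)" by (rule std_normal_exp_square)
    finally have hN: "(\<integral>\<^sup>+x. h x \<partial>mv_normal p \<Sigma>) + 1 \<le> ennreal (sqrt 2)" .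
    have "(\<integral>\<^sup>+x. ennreal (exp (w x * (?y x)\<^sup>2 / (4 * M))) \<partial>?P) \<le> (\<integral>\<^sup>+x. 1 + ennreal (w x) * h x \<partial>?P)"
    proof (rule nn_integral_mono)
      fix x
      let ?t = "(?y x)\<^sup>2 / (4 * M)"
      have t0: "0 \<le> ?t" using M(1) by simp
      have wx: "0 \<le> w x" "w x \<le> 1" using w(2) by auto
      have "exp ((1 - w x) *\<^sub>R 0 + w x *\<^sub>R ?t) \<le> (1 - w x) * exp 0 + w x * exp ?t"
        using convex_onD[OF convex_on_exp[of 1], of "w x" 0 ?t] wx by simp
      then have "exp (w x * (?y x)\<^sup>2 / (4 * M)) \<le> 1 + w x * (exp ?t - 1)" by (simp add: algebra_simps)
      then have "ennreal (exp (w x * (?y x)\<^sup>2 / (4 * M))) \<le> ennreal (1 + w x * (exp ?t - 1))" by (rule ennreal_leI)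
      also have "\<dots> = 1 + ennreal (w x) * h x"
        using wx t0 by (simp add: h_def ennreal_mult)
      finally show "ennreal (exp (w x * (?y x)\<^sup>2 / (4 * M))) \<le> 1 + ennreal (w x) * h x" .
    qed
    also have "\<dots> = 1 + ennreal (1 - \<epsilon>) * (\<integral>\<^sup>+x. h x \<partial>mv_normal p \<Sigma>)"
      using w(1,3) hm hmP by (simp add: nn_integral_add P.emeasure_space_1)
    also have "\<dots> \<le> 1 + 1 * (\<integral>\<^sup>+x. h x \<partial>mv_normal p \<Sigma>)"
      using eps by (intro add_left_mono mult_right_mono) auto
    also have "\<dots> \<le> ennreal (sqrt 2)" using hN by (simp add: add.commute)
    also have "\<dots> \<le> ennreal (exp (1/2))"
    proof (rule ennreal_leI)
      have "2 \<le> exp (1::real)" using exp_ge_add_one_self[of 1] by simp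
      also have "exp (1::real) = (exp (1/2))\<^sup>2" by (simp add: power2_eq_square exp_add[symmetric])
      finally have "sqrt 2 \<le> sqrt ((exp (1/2))\<^sup>2)" by (rule real_sqrt_le_mono)
      then show "sqrt 2 \<le> exp (1/2)" by simp
    qed
    finally show "(\<integral>\<^sup>+x. ennreal (exp (w x * (?y x)\<^sup>2 / (4 * M))) \<partial>?P) \<le> ennreal (exp (1/2))" .
  next
    fix u c t :: "_" assume u: "u \<in> D" and t: "0 \<le> (t::real)"
    let ?S = "{z. \<bar>\<bar>z\<bar> - c\<bar> \<le> t}"
    have "P.expectation (\<lambda>x. w x * of_bool (\<bar>\<bar>\<Sum>i<p. u i * x i\<bar> - c\<bar> \<le> t)) = (1 - \<epsilon>) * measure std_normal ?S"
      using weighted_projection_expectation[OF \<Sigma> eps cw D(3)[OF u], of ?S] by simp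
    also have "\<dots> \<le> 1 * (2 * t)" using eps t by (intro mult_mono std_normal_slab) auto
    finally show "P.expectation (\<lambda>x. w x * of_bool (\<bar>\<bar>\<Sum>i<p. u i * x i\<bar> - c\<bar> \<le> t)) \<le> 2 * t" by simp
  qed (use w V d b L D M in auto)
qed

lemma sets_sample_law:
  "sets (sample_law n p \<epsilon> \<Sigma> Q) = sets (PiM {..<n} (\<lambda>_. borel_space p))"
  unfolding sample_law_def by (intro sets_PiM_cong) simp_all

lemma space_sample_law: "space (sample_law n p \<epsilon> \<Sigma> Q) = sample_space n p"
  unfolding sample_space_def by (rule sets_eq_imp_space_eq[OF sets_sample_law])

text \<open>
  A union bound over at most four thresholds and two signs, each failing with probability at most
  \<open>4 exp (- L)\<close>, together with the deviation of the mean weight: \<open>33 = 1 + 4 \<cdot> 2 \<cdot> 4\<close>.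
\<close>

lemma whp_direction_frequencies:
  assumes \<Sigma>: "psd p \<Sigma>" and Q: "prob_space Q" "sets Q = sets (borel_space p)" and eps: "0 \<le> \<epsilon>" "\<epsilon> < 1"
    and cw: "clean_weight p \<epsilon> \<Sigma> Q w"
    and M: "0 < M" "\<And>v. v \<in> carrier_vec p \<Longrightarrow> v \<bullet> (\<Sigma> *\<^sub>v v) \<le> M * (v \<bullet> v)"
    and V: "finite V" "\<And>W. W \<in> V \<Longrightarrow> W \<subseteq> {..<p}" "\<And>W. W \<in> V \<Longrightarrow> card W \<le> d" "V \<noteq> {}"
    and d: "1 \<le> d" and b: "0 \<le> b" and L: "ln (real (card V)) + real d \<le> L"
    and D: "D \<subseteq> supported V" "\<And>u. u \<in> D \<Longrightarrow> L2_set u {..<p} \<le> b"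
      "\<And>u. u \<in> D \<Longrightarrow> qform p (\<lambda>i j. \<Sigma> $$ (i, j)) u = 1"
    and n: "0 < n" and rho: "0 < \<rho>" "\<rho> \<le> 1/2" "\<rho>\<^sup>2 = L / real n"
    and Cs: "finite Cs" "card Cs \<le> 4"
  shows "whp (sample_law n p \<epsilon> \<Sigma> Q) (33 * exp (- L)) (\<lambda>x.
    1 - \<epsilon> - 2 * \<rho> \<le> (\<Sum>i<n. w (x i)) / real n \<and>
    (\<forall>c\<in>Cs. \<forall>u\<in>D. \<bar>(\<Sum>i<n. w (x i) * of_bool (\<bar>\<Sum>j<p. u j * x i j\<bar> \<le> c)) / real n
       - (1 - \<epsilon>) * central_prob c\<bar> \<le> (53 + 20000 * M + 5 * ln (b + 2)) * \<rho>))"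
proof -
  note w = clean_weightD[OF cw]
  let ?P = "contaminated p \<epsilon> \<Sigma> Q" and ?K = "53 + 20000 * M + 5 * ln (b + 2)"
  interpret W: weighted_projections ?P w "\<lambda>i x. x i" "{..<p}" V d M b L D
    by (rule weighted_projections_contaminated[OF \<Sigma> Q eps cw M V d b L D])
  interpret N: prob_space "mv_normal p \<Sigma>" by (rule prob_space_mv_normal[OF \<Sigma>])
  let ?S = "PiM {..<n} (\<lambda>_. ?P)"
  interpret PP: product_prob_space "\<lambda>_::nat. ?P" "{..<n}" by unfold_locales
  have Ew: "W.expectation w = 1 - \<epsilon>"
  proof -
    have "(\<integral>\<^sup>+x. ennreal (w x) * 1 \<partial>?P) = ennreal (1 - \<epsilon>) * (\<integral>\<^sup>+x. 1 \<partial>mv_normal p \<Sigma>)"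
      by (rule bspec[OF w(3)]) simp
    then have "(\<integral>\<^sup>+x. ennreal (w x) \<partial>?P) = ennreal (1 - \<epsilon>)" by (simp add: N.emeasure_space_1)
    then show ?thesis
      using w(1,2) eps by (intro integral_eq_nn_integral[THEN trans]) auto
  qed
  have Eb: "W.expectation (W.below u c) = (1 - \<epsilon>) * central_prob c" if "u \<in> D" for u c
    unfolding W.below_def W.lin_def central_prob_def
    using weighted_projection_expectation[OF \<Sigma> eps cw D(3)[OF that], of "{z. \<bar>z\<bar> \<le> c}"] by simp
  have emp: "W.emp n (W.below u c) x = (\<Sum>i<n. w (x i) * of_bool (\<bar>\<Sum>j<p. u j * x i j\<bar> \<le> c)) / real n" for u c x
    by (simp add: W.emp_def W.below_def W.lin_def)
  have wbd: "\<bar>w x\<bar> \<le> 1" for x using w(2) by simp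
  have "whp ?S (exp (- L)) (\<lambda>x. (-1) * W.fluct n w x \<le> \<rho> * 1 + L / (\<rho> * real n))"
  proof (rule W.whp_deviation[OF w(1) wbd _ _ rho(1,2) n])
    have "W.expectation (\<lambda>x. \<bar>w x\<bar>) = W.expectation w" using w(2) by simp
    then show "W.expectation (\<lambda>x. \<bar>w x\<bar>) \<le> 1" using Ew eps by simp
  qed simp
  moreover have "L / (\<rho> * real n) = \<rho>"
  proof -
    have "L / (\<rho> * real n) = (L / real n) / \<rho>" by simp
    also have "\<dots> = \<rho>\<^sup>2 / \<rho>" unfolding rho(3) ..
    finally show ?thesis using rho(1) by (simp add: power2_eq_square)
  qed
  ultimately have mean: "whp ?S (exp (- L)) (\<lambda>x. (-1) * (W.emp n w x - (1 - \<epsilon>)) \<le> 2 * \<rho>)" by (simp add: W.fluct_def Ew)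
  have "whp ?S (real (card (Cs \<times> {1, -1::real})) * (4 * exp (- L)))
    (\<lambda>x. \<forall>e\<in>Cs \<times> {1, -1}. \<forall>u\<in>D. snd e * W.fluct n (W.below u (fst e)) x \<le> ?K * \<rho>)"
  proof (rule PP.P.whp_ball_card)
    fix e :: "real \<times> real" assume "e \<in> Cs \<times> {1, -1}"
    then have "snd e = 1 \<or> snd e = -1" by auto
    then show "whp ?S (4 * exp (- L))
      (\<lambda>x. \<forall>u\<in>D. snd e * W.fluct n (W.below u (fst e)) x \<le> ?K * \<rho>)"
      by (rule W.whp_uniform_deviation[OF n rho])
  qed (use Cs in simp)
  from PP.P.whp_conj[OF mean this] show ?thesis
    unfolding sample_law_def
  proof (rule whp_mono)
    have "real (card (Cs \<times> {1, -1::real})) \<le> 8" using Cs by (simp add: card_cartesian_product)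
    then have "real (card (Cs \<times> {1, -1::real})) * (4 * exp (- L)) \<le> 8 * (4 * exp (- L))"
      by (intro mult_right_mono) auto
    then show "exp (- L) + real (card (Cs \<times> {1, -1::real})) * (4 * exp (- L)) \<le> 33 * exp (- L)" by simp
  next
    fix x
    assume h: "(-1) * (W.emp n w x - (1 - \<epsilon>)) \<le> 2 * \<rho> \<and>
      (\<forall>e\<in>Cs \<times> {1, -1}. \<forall>u\<in>D. snd e * W.fluct n (W.below u (fst e)) x \<le> ?K * \<rho>)"
    have "1 - \<epsilon> - 2 * \<rho> \<le> (\<Sum>i<n. w (x i)) / real n" using h by (simp add: W.emp_def)
    moreover have "\<bar>(\<Sum>i<n. w (x i) * of_bool (\<bar>\<Sum>j<p. u j * x i j\<bar> \<le> c)) / real n - (1 - \<epsilon>) * central_prob c\<bar> \<le> ?K * \<rho>"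
      if c: "c \<in> Cs" and u: "u \<in> D" for c u
    proof -
      have "1 * W.fluct n (W.below u c) x \<le> ?K * \<rho>"
        "(-1) * W.fluct n (W.below u c) x \<le> ?K * \<rho>"
        using bspec[OF conjunct2[OF h], of "(c, 1)"] bspec[OF conjunct2[OF h], of "(c, -1)"] c u by auto
      then show ?thesis unfolding W.fluct_def Eb[OF u] emp by (simp only: abs_le_iff) simp
    qed
    ultimately show "1 - \<epsilon> - 2 * \<rho> \<le> (\<Sum>i<n. w (x i)) / real n \<and>
      (\<forall>c\<in>Cs. \<forall>u\<in>D. \<bar>(\<Sum>i<n. w (x i) * of_bool (\<bar>\<Sum>j<p. u j * x i j\<bar> \<le> c)) / real n
         - (1 - \<epsilon>) * central_prob c\<bar> \<le> ?K * \<rho>)" by blast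
  qed
qed

section \<open>Windows, banding and the rate of convergence\<close>

definition windows :: "nat \<Rightarrow> nat \<Rightarrow> nat set set" where
  "windows p k = (if 2 * k \<le> p then (\<lambda>l. {l..l + 2 * k - 1}) ` {0..p - 2 * k} else {{..<p}})"

lemma finite_windows: "finite (windows p k)"
  and windows_nonempty: "windows p k \<noteq> {}"
  by (simp_all add: windows_def)

lemma windows_subset: "1 \<le> k \<Longrightarrow> W \<in> windows p k \<Longrightarrow> W \<subseteq> {..<p}"
  by (auto simp: windows_def split: if_splits)

lemma card_window: "1 \<le> k \<Longrightarrow> W \<in> windows p k \<Longrightarrow> card W \<le> min (2 * k) p"
  by (auto simp: windows_def split: if_splits)

lemma card_windows_le: "1 \<le> p \<Longrightarrow> 1 \<le> k \<Longrightarrow> card (windows p k) \<le> (if 2 * k \<le> p then p else 1)"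
proof -
  assume "1 \<le> p" "1 \<le> k"
  moreover have "card ((\<lambda>l. {l..l + 2 * k - 1}) ` {0..p - 2 * k}) \<le> card {0..p - 2 * k}"
    by (rule card_image_le) simp
  ultimately show ?thesis by (auto simp: windows_def)
qed

lemma local_dirs_subset: "local_dirs p k \<subseteq> unit_sphere p"
  by (auto simp: local_dirs_def supported_dirs_def)

lemma local_dirs_nonempty:
  assumes "1 \<le> p" "1 \<le> k"
  shows "local_dirs p k \<noteq> {}"
proof -
  have "unit_vec p 0 \<in> unit_sphere p" using assms by (simp add: unit_sphere_iff)
  then have "unit_vec p 0 \<in> local_dirs p k"
    using assms unfolding local_dirs_def supported_dirs_def by (auto intro!: bexI[of _ 0])
  then show ?thesis by blast
qed

lemma local_dirs_supported:
  assumes "u \<in> local_dirs p k"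
  shows "(\<lambda>i. if i < p then t * (u $ i) else 0) \<in> supported (windows p k)"
proof (cases "2 * k \<le> p")
  case True
  then obtain l where l: "l \<le> p - 2 * k" "\<forall>i<p. i \<notin> {l..l + 2 * k - 1} \<longrightarrow> u $ i = 0"
    using assms by (auto simp: local_dirs_def supported_dirs_def)
  then show ?thesis using True unfolding supported_def windows_def
    by (intro CollectI bexI[of _ "{l..l + 2 * k - 1}"]) auto
next
  case False
  then show ?thesis unfolding supported_def windows_def by auto
qed

definition band :: "nat \<Rightarrow> nat \<Rightarrow> real mat \<Rightarrow> real mat" where
  "band p k \<Sigma> = mat p p (\<lambda>(i, j). if \<bar>int i - int j\<bar> > int k then 0 else \<Sigma> $$ (i, j))"

lemma band_carrier: "band p k \<Sigma> \<in> carrier_mat p p"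
  by (simp add: band_def)

lemma symmetric_entry:
  "transpose_mat A = A \<Longrightarrow> A \<in> carrier_mat p p \<Longrightarrow> i < p \<Longrightarrow> j < p \<Longrightarrow> A $$ (i, j) = A $$ (j, i)"
  by (metis carrier_matD index_transpose_mat(1))

lemma band_bias:
  assumes S: "\<Sigma> \<in> bandable_class p \<alpha> M M\<^sub>0 M_min" and k: "1 \<le> k" and v: "v \<in> carrier_vec p"
  shows "\<bar>v \<bullet> (\<Sigma> *\<^sub>v v) - v \<bullet> (band p k \<Sigma> *\<^sub>v v)\<bar> \<le> (if k < p then M\<^sub>0 * real k powr (- \<alpha>) else 0) * (v \<bullet> v)"
proof -
  have psd: "psd p \<Sigma>" using S by (simp add: bandable_class_def bounded_class_def)
  then have \<Sigma>: "\<Sigma> \<in> carrier_mat p p" "transpose_mat \<Sigma> = \<Sigma>" by (auto simp: psd_def)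
  define \<sigma> where "\<sigma> = (\<lambda>i j. if \<bar>int i - int j\<bar> > int k then \<Sigma> $$ (i, j) else 0)"
  have "v \<bullet> (\<Sigma> *\<^sub>v v) - v \<bullet> (band p k \<Sigma> *\<^sub>v v) = qform p \<sigma> (\<lambda>i. v $ i)"
    unfolding form_eq_qform[OF \<Sigma>(1) v] form_eq_qform[OF band_carrier v] qform_def sum_subtractf[symmetric]
    by (intro sum.cong) (auto simp: band_def \<sigma>_def)
  also have "\<bar>\<dots>\<bar> \<le> (if k < p then M\<^sub>0 * real k powr (- \<alpha>) else 0) * (\<Sum>i<p. (v $ i)\<^sup>2)"
  proof (rule qform_abs_le_row_sums)
    show "\<sigma> i j = \<sigma> j i" if "i < p" "j < p" for i j
      using symmetric_entry[OF \<Sigma>(2,1) that] by (auto simp: \<sigma>_def)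
    fix j assume j: "j < p"
    have "(\<Sum>i<p. \<bar>\<sigma> i j\<bar>) = (\<Sum>i<p. if \<bar>int i - int j\<bar> > int k then \<bar>\<Sigma> $$ (i, j)\<bar> else 0)"
      by (intro sum.cong) (auto simp: \<sigma>_def)
    also have "\<dots> = (\<Sum>i | i < p \<and> \<bar>int i - int j\<bar> > int k. \<bar>\<Sigma> $$ (i, j)\<bar>)"
      by (subst sum.inter_filter[symmetric]) (auto intro: sum.cong)
    finally have row: "(\<Sum>i<p. \<bar>\<sigma> i j\<bar>) = (\<Sum>i | i < p \<and> \<bar>int i - int j\<bar> > int k. \<bar>\<Sigma> $$ (i, j)\<bar>)" .
    show "(\<Sum>i<p. \<bar>\<sigma> i j\<bar>) \<le> (if k < p then M\<^sub>0 * real k powr (- \<alpha>) else 0)"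
    proof (cases "k < p")
      case True
      have "(\<Sum>i<p. \<bar>\<sigma> i j\<bar>) \<le> (MAX j\<in>{..<p}. \<Sum>i | i < p \<and> \<bar>int i - int j\<bar> > int k. \<bar>\<Sigma> $$ (i, j)\<bar>)"
        unfolding row using j by (intro Max_ge) auto
      also have "\<dots> \<le> M\<^sub>0 * real k powr (- \<alpha>)" using S k by (simp add: bandable_class_def)
      finally show ?thesis using True by simp
    next
      case False
      then have none: "{i. i < p \<and> \<bar>int i - int j\<bar> > int k} = {}" using j by auto
      show ?thesis unfolding row none using False by simp
    qed
  qed
  finally show ?thesis using v by (simp add: scalar_prod_self)
qed

lemma scaled_band_class:
  assumes \<Sigma>: "psd p \<Sigma>" and s: "0 \<le> s"
    and pos: "\<And>v. v \<in> carrier_vec p \<Longrightarrow> 0 \<le> v \<bullet> (band p k \<Sigma> *\<^sub>v v)"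
  shows "s \<cdot>\<^sub>m band p k \<Sigma> \<in> banded_class p k"
proof -
  have \<Sigma>c: "\<Sigma> \<in> carrier_mat p p" "transpose_mat \<Sigma> = \<Sigma>" using \<Sigma> by (auto simp: psd_def)
  have "psd p (s \<cdot>\<^sub>m band p k \<Sigma>)" unfolding psd_def
  proof (intro conjI ballI)
    show "transpose_mat (s \<cdot>\<^sub>m band p k \<Sigma>) = s \<cdot>\<^sub>m band p k \<Sigma>"
      using symmetric_entry[OF \<Sigma>c(2,1)] by (intro eq_matI) (auto simp: band_def)
    show "0 \<le> v \<bullet> ((s \<cdot>\<^sub>m band p k \<Sigma>) *\<^sub>v v)" if "v \<in> carrier_vec p" for v
      using pos[OF that] s that band_carrier[of p k \<Sigma>]
      by (simp add: smult_mat_mult_vec[OF band_carrier] scalar_prod_smult_distrib[of _ p] mult_mat_vec_carrier[OF band_carrier])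
  qed (simp add: band_carrier)
  then show ?thesis unfolding banded_class_def by (auto simp: band_def)
qed

text \<open>
  The matrix \<open>c \<Gamma> - \<Sigma>\<close> itself is not banded; subtracting the band of \<open>\<Sigma>\<close> instead of \<open>\<Sigma>\<close> makes
  \<open>qform_banded_le\<close> applicable at the cost of the bias \<open>b\<close>, once on the windows and once globally.
\<close>

lemma op_norm_le_local_forms:
  fixes e b :: real
  assumes \<Sigma>: "\<Sigma> \<in> carrier_mat p p" "transpose_mat \<Sigma> = \<Sigma>" and \<Gamma>: "\<Gamma> \<in> banded_class p k"
    and p: "1 \<le> p" and k: "1 \<le> k" and e: "0 \<le> e" and b: "0 \<le> b"
    and bias: "\<And>v. v \<in> carrier_vec p \<Longrightarrow> \<bar>v \<bullet> (\<Sigma> *\<^sub>v v) - v \<bullet> (band p k \<Sigma> *\<^sub>v v)\<bar> \<le> b * (v \<bullet> v)"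
    and loc: "\<And>u. u \<in> local_dirs p k \<Longrightarrow> \<bar>c * (u \<bullet> (\<Gamma> *\<^sub>v u)) - u \<bullet> (\<Sigma> *\<^sub>v u)\<bar> \<le> e"
  shows "0 \<le> op_norm p (c \<cdot>\<^sub>m \<Gamma> - \<Sigma>)" "op_norm p (c \<cdot>\<^sub>m \<Gamma> - \<Sigma>) \<le> 3 * e + 4 * b"
proof -
  have \<Gamma>c: "\<Gamma> \<in> carrier_mat p p" "transpose_mat \<Gamma> = \<Gamma>"
    and \<Gamma>b: "\<And>i j. i < p \<Longrightarrow> j < p \<Longrightarrow> \<bar>int i - int j\<bar> > int k \<Longrightarrow> \<Gamma> $$ (i, j) = 0"
    using \<Gamma> by (auto simp: banded_class_def psd_def)
  define \<Delta> where "\<Delta> = (\<lambda>i j. c * \<Gamma> $$ (i, j) - band p k \<Sigma> $$ (i, j))"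
  have \<Delta>form: "qform p \<Delta> (\<lambda>i. v $ i) = c * (v \<bullet> (\<Gamma> *\<^sub>v v)) - v \<bullet> (band p k \<Sigma> *\<^sub>v v)" if "v \<in> carrier_vec p" for v
    unfolding form_eq_qform[OF \<Gamma>c(1) that] form_eq_qform[OF band_carrier that] qform_def \<Delta>_def
      sum_subtractf[symmetric] sum_distrib_left left_diff_distrib mult.assoc ..
  have unit: "\<bar>qform p \<Delta> (\<lambda>i. u $ i)\<bar> \<le> e + b" if u: "u \<in> local_dirs p k" for u
  proof -
    have "u \<in> unit_sphere p" using local_dirs_subset u by (rule subsetD)
    then have uc: "u \<in> carrier_vec p" "u \<bullet> u = 1" by (simp_all add: unit_sphere_iff)
    show ?thesis using loc[OF u] bias[OF uc(1)] uc(2) unfolding \<Delta>form[OF uc(1)] by simp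
  qed
  have cone: "\<bar>qform p \<Delta> z\<bar> \<le> (e + b) * (\<Sum>i<p. (z i)\<^sup>2)"
    if z: "(\<Sum>i<p. (z i)\<^sup>2) \<noteq> 0 \<Longrightarrow> (1 / enorm (Matrix.vec p z)) \<cdot>\<^sub>v Matrix.vec p z \<in> local_dirs p k" for z
  proof (cases "(\<Sum>i<p. (z i)\<^sup>2) = 0")
    case True
    then have "\<forall>i<p. z i = 0" by (simp add: sum_nonneg_eq_0_iff)
    then have "qform p \<Delta> z = 0" unfolding qform_def by (intro sum.neutral ballI) auto
    then show ?thesis using True by simp
  next
    case False
    let ?v = "Matrix.vec p z" and ?t = "1 / enorm (Matrix.vec p z)"
    have nv: "?v \<bullet> ?v = (\<Sum>i<p. (z i)\<^sup>2)" by (simp add: scalar_prod_self[of _ p])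
    then have pos: "0 < ?v \<bullet> ?v" using False by (metis less_eq_real_def scalar_prod_self_nonneg)
    have "\<bar>qform p \<Delta> (\<lambda>i. (?t \<cdot>\<^sub>v ?v) $ i)\<bar> \<le> e + b" by (rule unit[OF z[OF False]])
    also have "qform p \<Delta> (\<lambda>i. (?t \<cdot>\<^sub>v ?v) $ i) = ?t\<^sup>2 * qform p \<Delta> z"
      unfolding qform_def sum_distrib_left by (intro sum.cong) (auto simp: power2_eq_square)
    finally have "\<bar>qform p \<Delta> z\<bar> / (?v \<bullet> ?v) \<le> e + b"
      by (simp add: power_divide enorm_sq abs_mult scalar_prod_self_nonneg)
    then show ?thesis using pos unfolding nv by (simp add: pos_divide_le_eq)
  qed
  have banded: "\<bar>qform p \<Delta> z\<bar> \<le> 3 * (e + b) * (\<Sum>i<p. (z i)\<^sup>2)" for z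
  proof (cases "2 * k \<le> p")
    case True
    show ?thesis
    proof (rule qform_banded_le)
      show "\<Delta> i j = 0" if "i < p" "j < p" "\<bar>int i - int j\<bar> > int k" for i j
        using \<Gamma>b[OF that] that by (simp add: \<Delta>_def band_def)
      fix l and v :: "nat \<Rightarrow> real" assume l: "l \<le> p - 2 * k" and v: "\<And>i. i < p \<Longrightarrow> i \<notin> {l..l + 2 * k - 1} \<Longrightarrow> v i = 0"
      show "\<bar>qform p \<Delta> v\<bar> \<le> (e + b) * (\<Sum>i<p. (v i)\<^sup>2)"
      proof (rule cone)
        assume nz: "(\<Sum>i<p. (v i)\<^sup>2) \<noteq> 0"
        have "(1 / enorm (Matrix.vec p v)) \<cdot>\<^sub>v Matrix.vec p v \<in> unit_sphere p"
          by (rule normalize_vec) (use nz in \<open>auto simp: scalar_prod_self[of _ p]\<close>)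
        then have "(1 / enorm (Matrix.vec p v)) \<cdot>\<^sub>v Matrix.vec p v \<in> supported_dirs p l (l + 2 * k - 1)"
          unfolding supported_dirs_def using v by auto
        then show "(1 / enorm (Matrix.vec p v)) \<cdot>\<^sub>v Matrix.vec p v \<in> local_dirs p k"
          unfolding local_dirs_def using True l by auto
      qed
    qed (use k True e b in auto)
  next
    case False
    have "\<bar>qform p \<Delta> z\<bar> \<le> (e + b) * (\<Sum>i<p. (z i)\<^sup>2)"
    proof (rule cone)
      assume nz: "(\<Sum>i<p. (z i)\<^sup>2) \<noteq> 0"
      have "(1 / enorm (Matrix.vec p z)) \<cdot>\<^sub>v Matrix.vec p z \<in> unit_sphere p"
        by (rule normalize_vec) (use nz in \<open>auto simp: scalar_prod_self[of _ p]\<close>)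
      then show "(1 / enorm (Matrix.vec p z)) \<cdot>\<^sub>v Matrix.vec p z \<in> local_dirs p k"
        using False by (simp add: local_dirs_def)
    qed
    also have "\<dots> \<le> 3 * (e + b) * (\<Sum>i<p. (z i)\<^sup>2)"
      using e b by (intro mult_right_mono sum_nonneg) auto
    finally show ?thesis .
  qed
  have dc: "c \<cdot>\<^sub>m \<Gamma> - \<Sigma> \<in> carrier_mat p p" using \<Gamma>c \<Sigma> by auto
  have ds: "transpose_mat (c \<cdot>\<^sub>m \<Gamma> - \<Sigma>) = c \<cdot>\<^sub>m \<Gamma> - \<Sigma>"
    using \<Gamma>c \<Sigma> symmetric_entry[OF \<Gamma>c(2,1)] symmetric_entry[OF \<Sigma>(2,1)] by (intro eq_matI) auto
  have form: "\<bar>v \<bullet> ((c \<cdot>\<^sub>m \<Gamma> - \<Sigma>) *\<^sub>v v)\<bar> \<le> (3 * e + 4 * b) * (v \<bullet> v)" if v: "v \<in> carrier_vec p" for v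
  proof -
    have "v \<bullet> ((c \<cdot>\<^sub>m \<Gamma> - \<Sigma>) *\<^sub>v v) = qform p (\<lambda>i j. (c \<cdot>\<^sub>m \<Gamma> - \<Sigma>) $$ (i, j)) (\<lambda>i. v $ i)"
      by (rule form_eq_qform[OF dc v])
    also have "\<dots> = qform p (\<lambda>i j. c * \<Gamma> $$ (i, j) - \<Sigma> $$ (i, j)) (\<lambda>i. v $ i)"
      unfolding qform_def using \<Gamma>c \<Sigma> by (intro sum.cong) auto
    also have "\<dots> = c * (v \<bullet> (\<Gamma> *\<^sub>v v)) - v \<bullet> (\<Sigma> *\<^sub>v v)"
      unfolding form_eq_qform[OF \<Gamma>c(1) v] form_eq_qform[OF \<Sigma>(1) v] qform_def
        sum_subtractf[symmetric] sum_distrib_left left_diff_distrib mult.assoc ..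
    finally have f: "v \<bullet> ((c \<cdot>\<^sub>m \<Gamma> - \<Sigma>) *\<^sub>v v) = c * (v \<bullet> (\<Gamma> *\<^sub>v v)) - v \<bullet> (\<Sigma> *\<^sub>v v)" .
    have "\<bar>c * (v \<bullet> (\<Gamma> *\<^sub>v v)) - v \<bullet> (band p k \<Sigma> *\<^sub>v v)\<bar> \<le> 3 * (e + b) * (v \<bullet> v)"
      using banded[of "\<lambda>i. v $ i"] unfolding \<Delta>form[OF v] scalar_prod_self[OF v] .
    then show ?thesis using bias[OF v] unfolding f by (simp add: algebra_simps abs_le_iff)
  qed
  show "0 \<le> op_norm p (c \<cdot>\<^sub>m \<Gamma> - \<Sigma>)" "op_norm p (c \<cdot>\<^sub>m \<Gamma> - \<Sigma>) \<le> 3 * e + 4 * b"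
    using op_norm_le[OF dc ds p _ form] e b by auto
qed

lemma bandwidth_facts:
  fixes \<alpha> :: real and n p k :: nat
  defines "a \<equiv> 1 / (2 * \<alpha> + 1)"
  assumes \<alpha>: "0 < \<alpha>" and n: "1 \<le> n" and p: "1 \<le> p"
    and k: "k = min (nat \<lceil>real n powr a\<rceil>) p"
  shows "1 \<le> k" "k \<le> p" "real k \<le> 2 * real n powr a" "k < p \<Longrightarrow> real n powr a \<le> real k"
proof -
  define m where "m = nat \<lceil>real n powr a\<rceil>"
  have a1: "1 \<le> real n powr a" using n \<alpha> by (intro ge_one_powr_ge_zero) (auto simp: a_def)
  have m1: "real n powr a \<le> real m" unfolding m_def by (rule real_nat_ceiling_ge)
  have "0 \<le> \<lceil>real n powr a\<rceil>" using a1 by linarith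
  then have "real m \<le> real n powr a + 1"
    using of_int_ceiling_le_add_one[of "real n powr a"] by (simp add: m_def)
  then have m2: "real m \<le> 2 * real n powr a" using a1 by linarith
  have m0: "1 \<le> m" using a1 m1 by linarith
  have km: "k = min m p" unfolding k m_def ..
  show "1 \<le> k" "k \<le> p" using m0 p by (auto simp: km)
  show "real k \<le> 2 * real n powr a" using m2 by (simp add: km min_def)
  show "real n powr a \<le> real k" if "k < p" using m1 that by (auto simp: km min_def split: if_splits)
qed

text \<open>
  There are two regimes. If \<open>2k \<le> p\<close> there are at most \<open>p\<close> windows of size \<open>2k\<close>; otherwise the only
  window has size \<open>p < 2k \<le> 4 n\<^sup>a\<close>.
\<close>

lemma window_complexity:
  fixes \<alpha> :: real and n p k :: nat
  defines "a \<equiv> 1 / (2 * \<alpha> + 1)"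
  assumes \<alpha>: "0 < \<alpha>" and n: "1 \<le> n" and p: "1 \<le> p"
    and k: "k = min (nat \<lceil>real n powr a\<rceil>) p"
  shows "ln (real (card (windows p k))) + real (min (2 * k) p) \<le> 4 * min (real n powr a + ln (real p)) (real p)"
proof -
  have kf: "1 \<le> k" "k \<le> p" "real k \<le> 2 * real n powr a"
    using bandwidth_facts(1-3)[OF \<alpha> n p] k unfolding a_def by auto
  have lnp: "0 \<le> ln (real p)" "ln (real p) \<le> real p" using p ln_le_minus_one[of "real p"] by auto
  have N: "0 < card (windows p k)" by (simp add: card_gt_0_iff finite_windows windows_nonempty)
  have cw: "card (windows p k) \<le> (if 2 * k \<le> p then p else 1)" by (rule card_windows_le[OF p kf(1)])
  show ?thesis
  proof (cases "2 * k \<le> p")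
    case True
    then have "ln (real (card (windows p k))) \<le> ln (real p)" using cw N p by simp
    then have "ln (real (card (windows p k))) + real (min (2 * k) p) \<le> ln (real p) + 2 * real k" using True by simp
    moreover have "ln (real p) + 2 * real k \<le> 4 * (real n powr a + ln (real p))"
      using kf(3) lnp unfolding distrib_left by linarith
    moreover have "ln (real p) + 2 * real k \<le> 4 * real p" using lnp True by linarith
    ultimately show ?thesis by (simp add: min_def)
  next
    case False
    then have "card (windows p k) = 1" by (simp add: windows_def)
    then have "ln (real (card (windows p k))) + real (min (2 * k) p) = real p" using False by simp
    moreover have "real p \<le> 4 * (real n powr a + ln (real p))"
      using kf(3) lnp False unfolding distrib_left by linarith
    ultimately show ?thesis by (simp add: min_def)
  qed
qed

text \<open>
  Since \<open>a (2 \<alpha> + 1) = 1\<close>, the squared bias \<open>k\<^sup>-\<^sup>2\<^sup>\<alpha> \<le> n\<^sup>-\<^sup>2\<^sup>a\<^sup>\<alpha>\<close> equals \<open>n\<^sup>a / n\<close>, the contribution of the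
  window size to the squared fluctuation. If \<open>k = p\<close> nothing is cut off, which matters when the rate
  is \<open>p / n\<close>.
\<close>

lemma bandwidth_bias_rate:
  fixes \<alpha> M\<^sub>0 t :: real and n p k :: nat
  defines "a \<equiv> 1 / (2 * \<alpha> + 1)"
  assumes \<alpha>: "0 < \<alpha>" and n: "1 \<le> n" and p: "1 \<le> p" and M0: "0 < M\<^sub>0"
    and k: "k = min (nat \<lceil>real n powr a\<rceil>) p"
    and t: "min (real n powr a + ln (real p)) (real p) / real n \<le> t"
  shows "(if k < p then M\<^sub>0 * real k powr (- \<alpha>) else 0) \<le> M\<^sub>0 * sqrt t"
proof (cases "k < p")
  case True
  have kn: "real n powr a \<le> real k" using bandwidth_facts(4)[OF \<alpha> n p] k True unfolding a_def by auto
  have n0: "0 < real n powr a" using n by simp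
  have R: "real n powr a \<le> min (real n powr a + ln (real p)) (real p)"
    using kn True p by simp
  have "(real k powr (- \<alpha>))\<^sup>2 \<le> ((real n powr a) powr (- \<alpha>))\<^sup>2"
    using kn n0 \<alpha> by (intro power_mono powr_mono2') auto
  also have "\<dots> = real n powr (a * (- \<alpha>) + a * (- \<alpha>))" by (simp only: power2_eq_square powr_powr powr_add)
  also have "a * (- \<alpha>) + a * (- \<alpha>) = a - 1"
  proof -
    have "a * (2 * \<alpha> + 1) = 1" using \<alpha> by (simp add: a_def)
    then show ?thesis by (simp add: algebra_simps)
  qed
  also have "real n powr (a - 1) = real n powr a / real n" using n by (simp add: powr_diff)
  also have "\<dots> \<le> min (real n powr a + ln (real p)) (real p) / real n" using R by (intro divide_right_mono) auto
  also have "\<dots> \<le> t" by (rule t)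
  finally have "real k powr (- \<alpha>) \<le> sqrt t" by (rule real_le_rsqrt)
  then show ?thesis using True M0 by simp
next
  case False
  have "0 \<le> min (real n powr a + ln (real p)) (real p) / real n" using p by simp
  then show ?thesis using False M0 t by simp
qed

text \<open>
  The factor six is the least integer exponent for which \<open>33 \<delta>\<^sup>6 \<le> 2 \<delta>\<close> on all of \<open>(0, 1/2)\<close>.
\<close>

lemma tail_budget:
  fixes \<delta> :: real
  assumes \<delta>: "0 < \<delta>" "\<delta> < 1/2" and L: "6 * ln (1 / \<delta>) \<le> L"
  shows "33 * exp (- L) \<le> 2 * \<delta>"
proof -
  have "exp (- L) \<le> exp (6 * ln \<delta>)" using L \<delta> by (simp add: ln_div)
  also have "\<dots> = \<delta> ^ 6" using \<delta> exp_of_nat_mult[of 6 "ln \<delta>"] by simp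
  also have "\<dots> = \<delta> ^ 5 * \<delta>" by (simp add: eval_nat_numeral)
  also have "\<dots> \<le> (1/2) ^ 5 * \<delta>" using \<delta> by (intro mult_right_mono power_mono) auto
  finally show ?thesis using \<delta> by (simp add: power_divide)
qed

text \<open>
  With \<open>T = (R + ln (1/\<delta>)) / n\<close>, where \<open>R / n\<close> is the asserted rate, both the bias \<open>b\<close> and the
  fluctuation \<open>\<rho>\<close> are \<open>O(\<surd>T)\<close>. The constant \<open>H\<close> collects the factors, and the hypothesis
  \<open>100 H\<^sup>2 T < 1\<close> makes bias and fluctuation small enough for \<open>deepest_scatter_close\<close> and for the band
  of \<open>\<Sigma>\<close> to be positive semidefinite.
\<close>

theorem theorem3p4:
  fixes \<alpha> M M\<^sub>0 M_min :: real
  assumes "\<alpha> > 0" and "M\<^sub>0 > 0" and "0 < M_min" and "M_min < M"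
  shows "\<exists>C C\<^sub>1 :: real. C > 0 \<and> C\<^sub>1 > 0 \<and>
    (\<forall>(n::nat) (p::nat) (\<epsilon>::real) (k::nat) (\<Gamma>hat :: (nat \<Rightarrow> nat \<Rightarrow> real) \<Rightarrow> real mat) (\<delta>::real).
      n \<ge> 1 \<longrightarrow> p \<ge> 1 \<longrightarrow> 0 \<le> \<epsilon> \<longrightarrow> \<epsilon> < 1 / 5 \<longrightarrow>
      k = min (nat \<lceil>real n powr (1 / (2 * \<alpha> + 1))\<rceil>) p \<longrightarrow>
      (\<forall>x\<in>sample_space n p. depth_maximizer p k n (sample_vectors p x) (\<Gamma>hat x)) \<longrightarrow>
      0 < \<delta> \<longrightarrow> \<delta> < 1 / 2 \<longrightarrow>
      C\<^sub>1 * ((min (real n powr (1 / (2 * \<alpha> + 1)) + ln (real p)) (real p) + ln (1 / \<delta>)) / real n) < 1 \<longrightarrow>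
      (\<forall>\<Sigma> Q. \<Sigma> \<in> bandable_class p \<alpha> M M\<^sub>0 M_min \<longrightarrow>
        prob_space Q \<longrightarrow> sets Q = sets (borel_space p) \<longrightarrow>
        (\<exists>E\<in>sets (sample_law n p \<epsilon> \<Sigma> Q).
          E \<subseteq> {x \<in> sample_space n p.
            (op_norm p ((1 / depth_beta) \<cdot>\<^sub>m \<Gamma>hat x - \<Sigma>))\<^sup>2
              \<le> C * (max (min (real n powr (- (2 * \<alpha>) / (2 * \<alpha> + 1)) + ln (real p) / real n)
                            (real p / real n))
                       (\<epsilon>\<^sup>2)
                    + ln (1 / \<delta>) / real n)} \<and>
          measure (sample_law n p \<epsilon> \<Sigma> Q) E \<ge> 1 - 2 * \<delta>)))"
proof -
  note \<alpha> = assms(1) and M0 = assms(2) and Mmin = assms(3)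
  have M: "0 < M" using assms by linarith
  define s where "s = sqrt depth_beta"
  have s: "0 < s" using depth_beta_pos by (simp add: s_def)
  obtain K where K: "s < K" "7/8 < central_prob K" using central_prob_large unfolding s_def by blast
  define A where "A = 2 / std_normal_density K"
  have A: "0 < A" by (simp add: A_def normal_density_pos)
  define A' where "A' = 2 * s * A + A\<^sup>2"
  have A': "0 < A'" using s A by (simp add: A'_def add_pos_pos)
  define b0 where "b0 = 1 / sqrt M_min"
  have b0: "0 < b0" using Mmin by (simp add: b0_def)
  define Kd where "Kd = 53 + 20000 * M + 5 * ln (b0 + 2)"
  have "0 \<le> ln (b0 + 2)" using b0 by simp
  then have Kd: "53 \<le> Kd" using M by (simp add: Kd_def)
  define H where "H = s * (M\<^sub>0 / M_min) + 12 * Kd + M\<^sub>0 / M_min"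
  have q0: "0 < M\<^sub>0 / M_min" using M0 Mmin by simp
  have sq0: "0 < s * (M\<^sub>0 / M_min)" by (rule mult_pos_pos[OF s q0])
  have H: "636 \<le> H" "M\<^sub>0 / M_min \<le> H" "s * (M\<^sub>0 / M_min) + 12 * Kd \<le> H"
    using q0 sq0 Kd unfolding H_def by linarith+
  define C3 where "C3 = 15/4 * (A' * M * H / depth_beta) + 4 * M\<^sub>0"
  have C3: "0 < C3" using A' M H M0 depth_beta_pos by (simp add: C3_def add_pos_pos)
  show ?thesis
  proof (rule exI[of _ "4 * C3\<^sup>2"], rule exI[of _ "100 * H\<^sup>2"], intro conjI allI impI)
    show "0 < 4 * C3\<^sup>2" "0 < 100 * H\<^sup>2" using C3 H by simp_all
    fix n p :: nat and \<epsilon> \<delta> :: real and k :: nat and \<Gamma>hat :: "(nat \<Rightarrow> nat \<Rightarrow> real) \<Rightarrow> real mat" and \<Sigma> Q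
    define a where "a = 1 / (2 * \<alpha> + 1)"
    define R where "R = min (real n powr a + ln (real p)) (real p)"
    define T where "T = (R + ln (1 / \<delta>)) / real n"
    assume n: "1 \<le> n" and p: "1 \<le> p" and eps: "0 \<le> \<epsilon>" "\<epsilon> < 1 / 5"
      and k: "k = min (nat \<lceil>real n powr (1 / (2 * \<alpha> + 1))\<rceil>) p"
      and max: "\<forall>x\<in>sample_space n p. depth_maximizer p k n (sample_vectors p x) (\<Gamma>hat x)"
      and \<delta>: "0 < \<delta>" "\<delta> < 1 / 2"
      and small: "100 * H\<^sup>2 * ((min (real n powr (1 / (2 * \<alpha> + 1)) + ln (real p)) (real p) + ln (1 / \<delta>)) / real n) < 1"
      and S: "\<Sigma> \<in> bandable_class p \<alpha> M M\<^sub>0 M_min" and Q: "prob_space Q" "sets Q = sets (borel_space p)"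
    have n0: "0 < n" using n by simp
    have small': "100 * H\<^sup>2 * T < 1" using small unfolding T_def R_def a_def .
    have kf: "1 \<le> k" "k \<le> p" using bandwidth_facts(1,2)[OF \<alpha> n p k] by auto
    have l\<delta>: "0 < ln (1 / \<delta>)" using \<delta> by simp
    have R0: "0 \<le> R" using p by (simp add: R_def)
    have T: "0 < T" "R / real n \<le> T" using R0 l\<delta> n0 by (auto simp: T_def divide_right_mono add_nonneg_pos)
    have HT: "H * sqrt T < 1/10"
    proof -
      have "(10 * (H * sqrt T))\<^sup>2 = 100 * H\<^sup>2 * T" using T by (simp add: power_mult_distrib)
      then have "(10 * (H * sqrt T))\<^sup>2 < 1\<^sup>2" using small' by simp
      then have "10 * (H * sqrt T) < 1" by (rule power2_less_imp_less) simp
      then show ?thesis by simp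
    qed
    have sT: "0 < sqrt T" using T by simp

    have psd: "psd p \<Sigma>" and smax: "s_max \<Sigma> \<le> M" and smin: "M_min < s_min \<Sigma>"
      using S by (auto simp: bandable_class_def bounded_class_def)
    have \<Sigma>c: "\<Sigma> \<in> carrier_mat p p" "transpose_mat \<Sigma> = \<Sigma>" using psd by (auto simp: psd_def)
    have upper: "v \<bullet> (\<Sigma> *\<^sub>v v) \<le> M * (v \<bullet> v)" if "v \<in> carrier_vec p" for v
      using psd_form_bounds(2)[OF psd p that] mult_right_mono[OF smax scalar_prod_self_nonneg[of v]] by linarith
    have lower: "M_min * (v \<bullet> v) \<le> v \<bullet> (\<Sigma> *\<^sub>v v)" if "v \<in> carrier_vec p" for v
      using psd_form_bounds(1)[OF psd p that] mult_right_mono[OF less_imp_le[OF smin] scalar_prod_self_nonneg[of v]] by linarith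

    define b where "b = (if k < p then M\<^sub>0 * real k powr (- \<alpha>) else 0)"
    have bias: "\<bar>v \<bullet> (\<Sigma> *\<^sub>v v) - v \<bullet> (band p k \<Sigma> *\<^sub>v v)\<bar> \<le> b * (v \<bullet> v)" if "v \<in> carrier_vec p" for v
      unfolding b_def by (rule band_bias[OF S kf(1) that])
    have b: "0 \<le> b" using M0 by (simp add: b_def)
    have bT: "b \<le> M\<^sub>0 * sqrt T"
      unfolding b_def by (rule bandwidth_bias_rate[OF \<alpha> n p M0 k]) (use T in \<open>simp add: R_def a_def\<close>)
    define y where "y = b / M_min"
    have y0: "0 \<le> y" using b Mmin by (simp add: y_def)
    have yT: "y \<le> M\<^sub>0 / M_min * sqrt T" using bT Mmin by (simp add: y_def divide_right_mono)
    also have "\<dots> \<le> H * sqrt T" using H sT by (intro mult_right_mono) auto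
    finally have y1: "y \<le> 1" using HT by linarith

    define V where "V = windows p k"
    define d where "d = min (2 * k) p"
    define L where "L = ln (real (card V)) + real d + 6 * ln (1 / \<delta>)"
    have Vf: "finite V" "V \<noteq> {}" unfolding V_def by (rule finite_windows, rule windows_nonempty)
    have Vs: "\<And>W. W \<in> V \<Longrightarrow> W \<subseteq> {..<p}" unfolding V_def by (rule windows_subset[OF kf(1)])
    have Vd: "\<And>W. W \<in> V \<Longrightarrow> card W \<le> d" unfolding V_def d_def by (rule card_window[OF kf(1)])
    have d: "1 \<le> d" using kf p by (simp add: d_def)
    have "ln (real (card V)) + real d \<le> 4 * R"
      using window_complexity[OF \<alpha> n p k] unfolding V_def d_def R_def a_def .
    then have LT: "L \<le> 6 * (R + ln (1 / \<delta>))"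
      using R0 unfolding L_def distrib_left by linarith
    have cV: "1 \<le> card V" using Vf by (simp add: Suc_le_eq card_gt_0_iff)
    have L0: "0 < L" using cV d l\<delta> by (simp add: L_def add_nonneg_pos add_pos_pos)
    define \<rho> where "\<rho> = sqrt (L / real n)"
    have rho0: "0 < \<rho>" using L0 n0 by (simp add: \<rho>_def)
    have rho2: "\<rho>\<^sup>2 = L / real n" using L0 n0 by (simp add: \<rho>_def)
    have rhoT: "\<rho> \<le> 3 * sqrt T"
    proof -
      have "L / real n \<le> 6 * (R + ln (1 / \<delta>)) / real n" using LT by (intro divide_right_mono) auto
      also have "\<dots> = 6 * T" by (simp add: T_def)
      also have "\<dots> \<le> 9 * T" using T by simp
      finally have "\<rho> \<le> sqrt (9 * T)" unfolding \<rho>_def by (rule real_sqrt_le_mono)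
      then show ?thesis by (simp add: real_sqrt_mult)
    qed
    have rho1: "\<rho> \<le> 1/2"
    proof -
      have "3 * sqrt T \<le> H * sqrt T" using H sT by (intro mult_right_mono) auto
      then show ?thesis using rhoT HT by linarith
    qed
    define r where "r = Kd * \<rho>"
    have r0: "0 < r" using Kd rho0 by (simp add: r_def)
    have r2: "2 * \<rho> \<le> r" unfolding r_def using Kd rho0 by (intro mult_right_mono) auto
    have budget: "s * y + 4 * r \<le> H * sqrt T"
    proof -
      have "s * y \<le> s * (M\<^sub>0 / M_min * sqrt T)" using yT s by (intro mult_left_mono) auto
      moreover have "Kd * \<rho> \<le> Kd * (3 * sqrt T)" using rhoT Kd by (intro mult_left_mono) auto
      ultimately have "s * y + 4 * r \<le> (s * (M\<^sub>0 / M_min) + 12 * Kd) * sqrt T"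
        by (simp add: r_def algebra_simps)
      also have "\<dots> \<le> H * sqrt T" using H sT by (intro mult_right_mono) auto
      finally show ?thesis .
    qed
    define \<tau> where "\<tau> = 5/4 * (\<epsilon> + s * y + 4 * r)"
    define Cs where "Cs = {s * (1 - y), s * (1 + y), s - A * \<tau>, min (s + A * \<tau>) K}"
    have "Cs = set [s * (1 - y), s * (1 + y), s - A * \<tau>, min (s + A * \<tau>) K]" by (simp add: Cs_def)
    then have Cs: "finite Cs" "card Cs \<le> 4"
      using card_length[of "[s * (1 - y), s * (1 + y), s - A * \<tau>, min (s + A * \<tau>) K]"] by simp_all

    \<comment> \<open>Directions are rescaled to unit variance, so that one threshold serves all of them.\<close>
    define D where "D = {u \<in> supported V. L2_set u {..<p} \<le> b0 \<and> qform p (\<lambda>i j. \<Sigma> $$ (i, j)) u = 1}"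
    have D: "D \<subseteq> supported V" "\<And>u. u \<in> D \<Longrightarrow> L2_set u {..<p} \<le> b0"
      "\<And>u. u \<in> D \<Longrightarrow> qform p (\<lambda>i j. \<Sigma> $$ (i, j)) u = 1" by (auto simp: D_def)
    define \<sigma> where "\<sigma> = (\<lambda>u. sqrt (u \<bullet> (\<Sigma> *\<^sub>v u)))"
    have dir: "u \<in> carrier_vec p" "u \<bullet> u = 1" "M_min \<le> (\<sigma> u)\<^sup>2" "(\<sigma> u)\<^sup>2 \<le> M" "0 < \<sigma> u" "(\<sigma> u)\<^sup>2 = u \<bullet> (\<Sigma> *\<^sub>v u)"
      if "u \<in> local_dirs p k" for u
    proof -
      have "u \<in> unit_sphere p" using local_dirs_subset that by (rule subsetD)
      then show uc: "u \<in> carrier_vec p" and u1: "u \<bullet> u = 1" by (simp_all add: unit_sphere_iff)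
      have f: "M_min \<le> u \<bullet> (\<Sigma> *\<^sub>v u)" "u \<bullet> (\<Sigma> *\<^sub>v u) \<le> M" using lower[OF uc] upper[OF uc] u1 by auto
      then show "(\<sigma> u)\<^sup>2 = u \<bullet> (\<Sigma> *\<^sub>v u)" "0 < \<sigma> u" using Mmin by (auto simp: \<sigma>_def)
      then show "M_min \<le> (\<sigma> u)\<^sup>2" "(\<sigma> u)\<^sup>2 \<le> M" using f by auto
    qed
    have dirD: "(\<lambda>i. if i < p then (1 / \<sigma> u) * (u $ i) else 0) \<in> D" if u: "u \<in> local_dirs p k" for u
    proof -
      let ?u = "\<lambda>i. if i < p then (1 / \<sigma> u) * (u $ i) else 0"
      have "?u \<in> supported V" unfolding V_def by (rule local_dirs_supported[OF u])
      moreover have "L2_set ?u {..<p} \<le> b0"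
      proof -
        have "(\<Sum>i<p. (?u i)\<^sup>2) = (1 / \<sigma> u)\<^sup>2 * (\<Sum>i<p. (u $ i)\<^sup>2)"
          unfolding sum_distrib_left by (intro sum.cong) (auto simp: power_mult_distrib power_divide)
        also have "\<dots> = 1 / (\<sigma> u)\<^sup>2" using scalar_prod_self[OF dir(1)[OF u]] dir(2)[OF u] by (simp add: power_divide)
        also have "\<dots> \<le> 1 / M_min" using dir(3,5)[OF u] Mmin by (intro divide_left_mono mult_pos_pos) auto
        finally have "sqrt (\<Sum>i<p. (?u i)\<^sup>2) \<le> sqrt (1 / M_min)" by (rule real_sqrt_le_mono)
        then show ?thesis by (simp add: L2_set_def b0_def real_sqrt_divide)
      qed
      moreover have "qform p (\<lambda>i j. \<Sigma> $$ (i, j)) ?u = 1"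
      proof -
        have "qform p (\<lambda>i j. \<Sigma> $$ (i, j)) ?u = (1 / \<sigma> u)\<^sup>2 * qform p (\<lambda>i j. \<Sigma> $$ (i, j)) (\<lambda>i. u $ i)"
          unfolding qform_def sum_distrib_left by (intro sum.cong) (auto simp: power2_eq_square)
        also have "\<dots> = (1 / \<sigma> u)\<^sup>2 * (\<sigma> u)\<^sup>2"
          unfolding form_eq_qform[OF \<Sigma>c(1) dir(1)[OF u], symmetric] dir(6)[OF u] ..
        also have "\<dots> = 1" using dir(5)[OF u] by (simp add: power_divide)
        finally show ?thesis .
      qed
      ultimately show ?thesis by (simp add: D_def)
    qed

    have "\<epsilon> < 1" using eps by simp
    then obtain w where cw: "clean_weight p \<epsilon> \<Sigma> Q w"
      using contaminated_weight[OF psd Q eps(1)] by blast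
    note w = clean_weightD[OF cw]
    have "whp (sample_law n p \<epsilon> \<Sigma> Q) (33 * exp (- L)) (\<lambda>x.
      1 - \<epsilon> - 2 * \<rho> \<le> (\<Sum>i<n. w (x i)) / real n \<and>
      (\<forall>c\<in>Cs. \<forall>u\<in>D. \<bar>(\<Sum>i<n. w (x i) * of_bool (\<bar>\<Sum>j<p. u j * x i j\<bar> \<le> c)) / real n
         - (1 - \<epsilon>) * central_prob c\<bar> \<le> (53 + 20000 * M + 5 * ln (b0 + 2)) * \<rho>))"
    proof (rule whp_direction_frequencies[OF psd Q eps(1) _ cw M upper Vf(1) Vs Vd Vf(2) d _ _ D n0 rho0 rho1 rho2 Cs])
      show "\<epsilon> < 1" using eps by simp
      show "0 \<le> b0" using b0 by simp
      show "ln (real (card V)) + real d \<le> L" using l\<delta> by (simp add: L_def)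
    qed
    then obtain E where E: "E \<in> sets (sample_law n p \<epsilon> \<Sigma> Q)"
      "1 - 33 * exp (- L) \<le> measure (sample_law n p \<epsilon> \<Sigma> Q) E"
      and good: "\<forall>x\<in>E. 1 - \<epsilon> - 2 * \<rho> \<le> (\<Sum>i<n. w (x i)) / real n \<and>
        (\<forall>c\<in>Cs. \<forall>u\<in>D. \<bar>(\<Sum>i<n. w (x i) * of_bool (\<bar>\<Sum>j<p. u j * x i j\<bar> \<le> c)) / real n
         - (1 - \<epsilon>) * central_prob c\<bar> \<le> r)"
      unfolding whp_def r_def Kd_def by blast
    have "33 * exp (- L) \<le> 2 * \<delta>"
    proof (rule tail_budget[OF \<delta>])
      have "0 \<le> ln (real (card V))" using cV by simp
      then show "6 * ln (1 / \<delta>) \<le> L" by (simp add: L_def)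
    qed
    then have prob: "1 - 2 * \<delta> \<le> measure (sample_law n p \<epsilon> \<Sigma> Q) E" using E(2) by linarith

    have err: "(op_norm p ((1 / depth_beta) \<cdot>\<^sub>m \<Gamma>hat x - \<Sigma>))\<^sup>2
        \<le> 4 * C3\<^sup>2 * (max (R / real n) (\<epsilon>\<^sup>2) + ln (1 / \<delta>) / real n)"
      if x: "x \<in> E" for x
    proof -
      have xs: "x \<in> sample_space n p"
        using sets.sets_into_space[OF E(1)] x unfolding space_sample_law by blast
      let ?X = "sample_vectors p x"
      have opt: "\<Gamma>hat x \<in> banded_class p k"
        "\<And>\<Gamma>'. \<Gamma>' \<in> banded_class p k \<Longrightarrow>
          matrix_depth (local_dirs p k) n ?X \<Gamma>' \<le> matrix_depth (local_dirs p k) n ?X (\<Gamma>hat x)"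
        using max xs unfolding depth_maximizer_def by auto
      define \<Gamma>\<^sub>0 where "\<Gamma>\<^sub>0 = depth_beta \<cdot>\<^sub>m band p k \<Sigma>"
      have bMmin: "b \<le> M_min" using y1 Mmin by (simp add: y_def)
      have "\<Gamma>\<^sub>0 \<in> banded_class p k" unfolding \<Gamma>\<^sub>0_def
      proof (rule scaled_band_class[OF psd])
        fix v :: "real Matrix.vec" assume v: "v \<in> carrier_vec p"
        have "b * (v \<bullet> v) \<le> M_min * (v \<bullet> v)" using bMmin scalar_prod_self_nonneg by (rule mult_right_mono)
        then show "0 \<le> v \<bullet> (band p k \<Sigma> *\<^sub>v v)" using bias[OF v] lower[OF v] by linarith
      qed (use depth_beta_pos in simp)
      then have depth: "matrix_depth (local_dirs p k) n ?X \<Gamma>\<^sub>0 \<le> matrix_depth (local_dirs p k) n ?X (\<Gamma>hat x)"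
        by (rule opt(2))
      have close: "\<bar>u \<bullet> (\<Gamma>hat x *\<^sub>v u) - depth_beta * (\<sigma> u)\<^sup>2\<bar> \<le> A' * \<tau> * (\<sigma> u)\<^sup>2"
        if u: "u \<in> local_dirs p k" for u
        unfolding A'_def A_def \<tau>_def s_def
      proof (rule deepest_scatter_close[where \<omega> = "\<lambda>i. w (x i)" and X = ?X and \<Gamma>\<^sub>0 = \<Gamma>\<^sub>0 and U = "local_dirs p k" and n = n and K = K and r = r and y = y and \<epsilon> = \<epsilon> and \<sigma> = \<sigma>])
        show "local_dirs p k \<noteq> {}" by (rule local_dirs_nonempty[OF p kf(1)])
        show "sqrt depth_beta * y + 4 * r \<le> 1/10" using budget HT unfolding s_def by linarith
        show "1 - \<epsilon> - r \<le> (\<Sum>i<n. w (x i)) / real n" using bspec[OF good x] r2 by linarith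
        show "0 \<le> v \<bullet> (\<Gamma>hat x *\<^sub>v v)" if "v \<in> local_dirs p k" for v
          using opt(1) dir(1)[OF that] by (simp add: banded_class_def psd_def)
        show "\<bar>v \<bullet> (\<Gamma>\<^sub>0 *\<^sub>v v) - depth_beta * (\<sigma> v)\<^sup>2\<bar> \<le> depth_beta * y * (\<sigma> v)\<^sup>2" if v: "v \<in> local_dirs p k" for v
        proof -
          have "v \<bullet> (\<Gamma>\<^sub>0 *\<^sub>v v) = depth_beta * (v \<bullet> (band p k \<Sigma> *\<^sub>v v))"
            unfolding \<Gamma>\<^sub>0_def smult_mat_mult_vec[OF band_carrier dir(1)[OF v]]
            by (rule scalar_prod_smult_distrib[OF dir(1)[OF v] mult_mat_vec_carrier[OF band_carrier dir(1)[OF v]]])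
          then have "v \<bullet> (\<Gamma>\<^sub>0 *\<^sub>v v) - depth_beta * (\<sigma> v)\<^sup>2 = depth_beta * (v \<bullet> (band p k \<Sigma> *\<^sub>v v) - v \<bullet> (\<Sigma> *\<^sub>v v))"
            by (simp add: dir(6)[OF v] right_diff_distrib)
          moreover have "\<bar>v \<bullet> (band p k \<Sigma> *\<^sub>v v) - v \<bullet> (\<Sigma> *\<^sub>v v)\<bar> \<le> b"
            using bias[OF dir(1)[OF v]] dir(2)[OF v] by (simp add: abs_le_iff)
          ultimately have "\<bar>v \<bullet> (\<Gamma>\<^sub>0 *\<^sub>v v) - depth_beta * (\<sigma> v)\<^sup>2\<bar> \<le> depth_beta * b"
            using depth_beta_pos by (simp add: abs_mult)
          also have "\<dots> = depth_beta * y * M_min" using Mmin by (simp add: y_def)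
          also have "\<dots> \<le> depth_beta * y * (\<sigma> v)\<^sup>2"
            using dir(3)[OF v] y0 depth_beta_pos by (intro mult_left_mono) auto
          finally show ?thesis .
        qed
        fix v and c :: real assume v: "v \<in> local_dirs p k"
          and c: "c \<in> {sqrt depth_beta * (1 - y), sqrt depth_beta * (1 + y),
            sqrt depth_beta - 2 / std_normal_density K * (5/4 * (\<epsilon> + sqrt depth_beta * y + 4 * r)),
            min (sqrt depth_beta + 2 / std_normal_density K * (5/4 * (\<epsilon> + sqrt depth_beta * y + 4 * r))) K}"
        let ?v = "\<lambda>i. if i < p then (1 / \<sigma> v) * (v $ i) else 0"
        have cC: "c \<in> Cs" using c unfolding Cs_def s_def A_def \<tau>_def .
        have ev: "(\<bar>v \<bullet> ?X i\<bar> \<le> c * \<sigma> v) \<longleftrightarrow> (\<bar>\<Sum>j<p. ?v j * x i j\<bar> \<le> c)" for i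
        proof -
          have "(\<Sum>j<p. ?v j * x i j) = (\<Sum>j<p. v $ j * x i j) / \<sigma> v"
            unfolding sum_divide_distrib by (intro sum.cong) auto
          also have "(\<Sum>j<p. v $ j * x i j) = v \<bullet> ?X i"
            by (simp add: sample_vectors_def scalar_prod_def atLeast0LessThan)
          finally show ?thesis using dir(5)[OF v] by (simp add: abs_divide pos_divide_le_eq)
        qed
        show "\<bar>(\<Sum>i<n. w (x i) * of_bool (\<bar>v \<bullet> ?X i\<bar> \<le> c * \<sigma> v)) / real n - (1 - \<epsilon>) * central_prob c\<bar> \<le> r"
          unfolding ev by (rule bspec[OF bspec[OF conjunct2[OF bspec[OF good x]] cC] dirD[OF v]])
      qed (use n0 dir(5) w(2) eps r0 y0 y1 K depth u in \<open>auto simp: s_def\<close>)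
      define e where "e = A' * \<tau> * M / depth_beta"
      have tau: "0 \<le> \<tau>" "\<tau> \<le> 5/4 * (H * (\<epsilon> + sqrt T))"
      proof -
        have "0 \<le> s * y" using s y0 by simp
        then show "0 \<le> \<tau>" using eps r0 by (simp add: \<tau>_def)
        have "1 * \<epsilon> \<le> H * \<epsilon>" using H eps by (intro mult_right_mono) auto
        then show "\<tau> \<le> 5/4 * (H * (\<epsilon> + sqrt T))" using budget by (simp add: \<tau>_def distrib_left)
      qed
      have loc: "\<bar>1 / depth_beta * (u \<bullet> (\<Gamma>hat x *\<^sub>v u)) - u \<bullet> (\<Sigma> *\<^sub>v u)\<bar> \<le> e" if u: "u \<in> local_dirs p k" for u
      proof -
        have "1 / depth_beta * (u \<bullet> (\<Gamma>hat x *\<^sub>v u)) - u \<bullet> (\<Sigma> *\<^sub>v u) = (u \<bullet> (\<Gamma>hat x *\<^sub>v u) - depth_beta * (\<sigma> u)\<^sup>2) / depth_beta"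
          using depth_beta_pos by (simp add: dir(6)[OF u] field_simps)
        also have "\<bar>\<dots>\<bar> \<le> A' * \<tau> * (\<sigma> u)\<^sup>2 / depth_beta"
          using close[OF u] depth_beta_pos by (simp add: abs_divide divide_right_mono)
        also have "\<dots> \<le> e" unfolding e_def
          using dir(4)[OF u] A' tau depth_beta_pos by (intro divide_right_mono mult_left_mono) auto
        finally show ?thesis .
      qed
      have e0: "0 \<le> e" using A' tau M depth_beta_pos by (simp add: e_def)
      have "op_norm p ((1 / depth_beta) \<cdot>\<^sub>m \<Gamma>hat x - \<Sigma>) \<le> 3 * e + 4 * b"
        by (rule op_norm_le_local_forms(2)[OF \<Sigma>c opt(1) p kf(1) e0 b bias loc])
      also have "3 * e \<le> 15/4 * (A' * M * H / depth_beta) * (\<epsilon> + sqrt T)"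
      proof -
        have "A' * M / depth_beta * \<tau> \<le> A' * M / depth_beta * (5/4 * (H * (\<epsilon> + sqrt T)))"
          using tau A' M depth_beta_pos by (intro mult_left_mono) auto
        moreover have "e = A' * M / depth_beta * \<tau>" by (simp add: e_def)
        moreover have "15/4 * (A' * M * H / depth_beta) * (\<epsilon> + sqrt T)
            = 3 * (A' * M / depth_beta * (5/4 * (H * (\<epsilon> + sqrt T))))" by simp
        ultimately show ?thesis by linarith
      qed
      also have "4 * b \<le> 4 * M\<^sub>0 * (\<epsilon> + sqrt T)"
      proof -
        have "M\<^sub>0 * sqrt T \<le> M\<^sub>0 * (\<epsilon> + sqrt T)" using M0 eps by (intro mult_left_mono) auto
        then show ?thesis using bT by simp
      qed
      finally have "op_norm p ((1 / depth_beta) \<cdot>\<^sub>m \<Gamma>hat x - \<Sigma>) \<le> C3 * (\<epsilon> + sqrt T)"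
        by (simp add: C3_def distrib_right)
      moreover have "0 \<le> op_norm p ((1 / depth_beta) \<cdot>\<^sub>m \<Gamma>hat x - \<Sigma>)"
        by (rule op_norm_le_local_forms(1)[OF \<Sigma>c opt(1) p kf(1) e0 b bias loc])
      ultimately have "(op_norm p ((1 / depth_beta) \<cdot>\<^sub>m \<Gamma>hat x - \<Sigma>))\<^sup>2 \<le> (C3 * (\<epsilon> + sqrt T))\<^sup>2"
        by (intro power_mono)
      also have "\<dots> = C3\<^sup>2 * (\<epsilon> + sqrt T)\<^sup>2" by (rule power_mult_distrib)
      also have "\<dots> \<le> C3\<^sup>2 * (4 * (max (R / real n) (\<epsilon>\<^sup>2) + ln (1 / \<delta>) / real n))"
      proof (rule mult_left_mono)
        have "(\<epsilon> + sqrt T)\<^sup>2 \<le> 2 * \<epsilon>\<^sup>2 + 2 * T"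
          using sum_squares_bound[of \<epsilon> "sqrt T"] T by (simp add: power2_sum)
        also have "\<dots> = 2 * \<epsilon>\<^sup>2 + 2 * (R / real n) + 2 * (ln (1 / \<delta>) / real n)"
          by (simp add: T_def add_divide_distrib)
        also have "\<dots> \<le> 4 * (max (R / real n) (\<epsilon>\<^sup>2) + ln (1 / \<delta>) / real n)"
        proof -
          have "0 \<le> ln (1 / \<delta>) / real n" using l\<delta> by simp
          then show ?thesis
            using max.cobounded1[of "R / real n" "\<epsilon>\<^sup>2"] max.cobounded2[of "\<epsilon>\<^sup>2" "R / real n"]
            unfolding distrib_left by linarith
        qed
        finally show "(\<epsilon> + sqrt T)\<^sup>2 \<le> 4 * (max (R / real n) (\<epsilon>\<^sup>2) + ln (1 / \<delta>) / real n)" .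
      qed simp
      finally show ?thesis by (simp only: mult.assoc mult.left_commute)
    qed
    have rate: "R / real n = min (real n powr (- (2 * \<alpha>) / (2 * \<alpha> + 1)) + ln (real p) / real n) (real p / real n)"
    proof -
      have "2 * \<alpha> + 1 \<noteq> 0" using \<alpha> by simp
      then have "- (2 * \<alpha>) / (2 * \<alpha> + 1) = a - 1" by (simp add: a_def divide_simps)
      then have "real n powr (- (2 * \<alpha>) / (2 * \<alpha> + 1)) = real n powr a / real n" using n by (simp add: powr_diff)
      then show ?thesis unfolding R_def using n0 by (simp add: min_divide_distrib_right add_divide_distrib)
    qed
    show "\<exists>E\<in>sets (sample_law n p \<epsilon> \<Sigma> Q).
          E \<subseteq> {x \<in> sample_space n p.
            (op_norm p ((1 / depth_beta) \<cdot>\<^sub>m \<Gamma>hat x - \<Sigma>))\<^sup>2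
              \<le> 4 * C3\<^sup>2 * (max (min (real n powr (- (2 * \<alpha>) / (2 * \<alpha> + 1)) + ln (real p) / real n)
                            (real p / real n))
                       (\<epsilon>\<^sup>2)
                    + ln (1 / \<delta>) / real n)} \<and>
          measure (sample_law n p \<epsilon> \<Sigma> Q) E \<ge> 1 - 2 * \<delta>"
    proof (rule bexI[OF _ E(1)], intro conjI subsetI CollectI)
      fix x assume x: "x \<in> E"
      show "x \<in> sample_space n p" using sets.sets_into_space[OF E(1)] x unfolding space_sample_law by blast
      show "(op_norm p ((1 / depth_beta) \<cdot>\<^sub>m \<Gamma>hat x - \<Sigma>))\<^sup>2
              \<le> 4 * C3\<^sup>2 * (max (min (real n powr (- (2 * \<alpha>) / (2 * \<alpha> + 1)) + ln (real p) / real n)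
                            (real p / real n)) (\<epsilon>\<^sup>2) + ln (1 / \<delta>) / real n)"
        using err[OF x] unfolding rate .
    qed (rule prob)
  qed
qed

end
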